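(* Let $n\geq 3$, let $m\geq 1$ be an integer, and let $0<\alpha<2$ with $\frac n2\leq m+\frac\alpha2<+\infty$. Let $f=f(x,u,Du,\cdots)\geq 0$ be a nonnegative nonlinearity (possibly depending on $x$, $u$ and derivatives of $u$) which is continuous with respect to $x\in\mathbb{R}^n$, and such that $f>0$ at some point of $\mathbb{R}^n$ if $u>0$ in the whole of $\mathbb{R}^n$ (i.e. if $u>0$ everywhere, then $f(x_0,u(x_0),Du(x_0),\cdots)>0$ for some $x_0\in\mathbb{R}^n$). Suppose that $u$ is a nonnegative classical solution of $$(-\Delta)^{m+\frac{\alpha}{2}}u(x)=f(x,u,Du,\cdots),\qquad x\in\mathbb{R}^n,$$ that is, $u\in C^{2m+[\alpha],\{\alpha\}+\epsilon}_{loc}(\mathbb{R}^n)\cap\mathcal{L}_\alpha(\mathbb{R}^n)$ for some arbitrarily small $\epsilon>0$, $u\geq0$ in $\mathbb{R}^n$, and the equation holds pointwise. Then $u\equiv 0$ in $\mathbb{R}^n$.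
   Context: $[\alpha]$ is the integer part of $\alpha$ and $\{\alpha\}=\alpha-[\alpha]$. $\mathcal{L}_\alpha(\mathbb{R}^n)=\{u:\mathbb{R}^n\to\mathbb{R} : \int_{\mathbb{R}^n}\frac{|u(x)|}{1+|x|^{n+\alpha}}dx<\infty\}$. For $0<\alpha<2$ and $u\in C^{[\alpha],\{\alpha\}+\epsilon}_{loc}(\mathbb{R}^n)\cap\mathcal{L}_\alpha(\mathbb{R}^n)$, the fractional Laplacian is $(-\Delta)^{\frac{\alpha}{2}}u(x)=C_{n,\alpha}\lim_{\varepsilon\to0}\int_{|y-x|\geq\varepsilon}\frac{u(x)-u(y)}{|x-y|^{n+\alpha}}dy$, where $C_{n,\alpha}>0$ is the usual normalization constant (Fourier multiplier $|\xi|^\alpha$). For $u\in C^{2m+[\alpha],\{\alpha\}+\epsilon}_{loc}(\mathbb{R}^n)\cap\mathcal{L}_\alpha(\mathbb{R}^n)$ one has $(-\Delta)^{\frac{\alpha}{2}}u\in C^{2m}(\mathbb{R}^n)$, and $(-\Delta)^{m+\frac{\alpha}{2}}u:=(-\Delta)^m\big((-\Delta)^{\frac{\alpha}{2}}u\big)$. In the equation, the right-hand side is the continuous function $x\mapsto f(x,u(x),Du(x),\cdots)$ on $\mathbb{R}^n$. *)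

theory Defs
  imports "HOL-Analysis.Analysis"
begin

definition partial_deriv :: "'n::finite \<Rightarrow> (real^'n \<Rightarrow> real) \<Rightarrow> real^'n \<Rightarrow> real" where
  "partial_deriv i u x = deriv (\<lambda>t. u (x + t *\<^sub>R axis i 1)) 0"

definition iter_partial :: "'n::finite list \<Rightarrow> (real^'n \<Rightarrow> real) \<Rightarrow> real^'n \<Rightarrow> real" where
  "iter_partial is u = foldr partial_deriv is u"

text \<open>The tuple \<open>(u(x), Du(x), \<dots>, D\<^sup>ku(x))\<close>, indexed by lists of coordinate directions of length
  at most \<open>k\<close>; the empty list gives \<open>u(x)\<close>. Entries at longer lists carry no information.\<close>

definition jet :: "nat \<Rightarrow> (real^'n::finite \<Rightarrow> real) \<Rightarrow> real^'n \<Rightarrow> 'n list \<Rightarrow> real" where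
  "jet k u x = (\<lambda>is. if length is \<le> k then iter_partial is u x else 0)"

primrec C_k :: "nat \<Rightarrow> (real^'n::finite \<Rightarrow> real) \<Rightarrow> bool" where
  "C_k 0 u \<longleftrightarrow> continuous_on UNIV u"
| "C_k (Suc k) u \<longleftrightarrow> (\<forall>x. u differentiable (at x)) \<and> (\<forall>i. C_k k (partial_deriv i u))"

definition locally_holder :: "real \<Rightarrow> (real^'n::finite \<Rightarrow> real) \<Rightarrow> bool" where
  "locally_holder \<gamma> v \<longleftrightarrow>
    (\<forall>K. compact K \<longrightarrow> (\<exists>C. \<forall>x\<in>K. \<forall>y\<in>K. \<bar>v x - v y\<bar> \<le> C * dist x y powr \<gamma>))"

text \<open>\<open>C\<^sup>k\<^sup>,\<^sup>\<gamma>\<close>, locally on the whole space; meant for \<open>0 < \<gamma> \<le> 1\<close>.\<close>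

definition C_holder_loc :: "nat \<Rightarrow> real \<Rightarrow> (real^'n::finite \<Rightarrow> real) set" where
  "C_holder_loc k \<gamma> =
    {u. C_k k u \<and> (\<forall>is. length is = k \<longrightarrow> locally_holder \<gamma> (iter_partial is u))}"

definition L_space :: "real \<Rightarrow> (real^'n::finite \<Rightarrow> real) set" where
  "L_space \<alpha> = {u. u \<in> borel_measurable lborel \<and>
     integrable lborel (\<lambda>x. \<bar>u x\<bar> / (1 + norm x powr (real CARD('n) + \<alpha>)))}"

text \<open>The constant for which the operator below has Fourier multiplier \<open>|\<xi>|\<^sup>\<alpha>\<close>, i.e. the inverse of
  the integral of \<open>(1 - cos \<zeta>\<^sub>1) / |\<zeta>|\<^sup>n\<^sup>+\<^sup>\<alpha>\<close> over the whole space, in closed form.\<close>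

definition frac_lap_const :: "nat \<Rightarrow> real \<Rightarrow> real" where
  "frac_lap_const n \<alpha> =
     \<alpha> * 2 powr (\<alpha> - 1) * Gamma ((real n + \<alpha>) / 2) / (pi powr (real n / 2) * Gamma (1 - \<alpha> / 2))"

definition frac_laplacian :: "real \<Rightarrow> (real^'n::finite \<Rightarrow> real) \<Rightarrow> real^'n \<Rightarrow> real" where
  "frac_laplacian \<alpha> u x = frac_lap_const CARD('n) \<alpha> *
     Lim (at_right 0) (\<lambda>\<epsilon>. LINT y:{y. \<epsilon> \<le> norm (y - x)}|lborel.
       (u x - u y) / norm (x - y) powr (real CARD('n) + \<alpha>))"

definition neg_laplacian :: "(real^'n::finite \<Rightarrow> real) \<Rightarrow> real^'n \<Rightarrow> real" where
  "neg_laplacian v x = - (\<Sum>i\<in>UNIV. partial_deriv i (partial_deriv i v) x)"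

definition higher_frac_laplacian ::
    "nat \<Rightarrow> real \<Rightarrow> (real^'n::finite \<Rightarrow> real) \<Rightarrow> real^'n \<Rightarrow> real" where
  "higher_frac_laplacian m \<alpha> u = (neg_laplacian ^^ m) (frac_laplacian \<alpha> u)"

end

theory Submission
  imports Defs
begin

text \<open>
  Put \<open>v = (-\<Delta>)\<^sup>\<alpha>\<^sup>/\<^sup>2 u\<close>, \<open>w\<^sub>j = (-\<Delta>)\<^sup>j v\<close> and let \<open>n\<close> be the dimension. Testing \<open>v\<close> against a bump at
  scale \<open>R\<close> and moving the operator onto the bump, the weight in \<open>L\<^sub>\<alpha>\<close> shows that the averages
  of \<open>v\<close> at scale \<open>R\<close> tend to \<open>0\<close>; integrating by parts, so do those of every \<open>w\<^sub>j\<close>. Averages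
  of a superharmonic function decrease in \<open>R\<close>, so \<open>w\<^sub>m = f \<ge> 0\<close> gives \<open>w\<^sub>j \<ge> 0\<close> successively for
  \<open>j = m - 1, \<dots>, 0\<close>.

  If \<open>u\<close> vanishes at a point, this point is a minimum, and \<open>v \<ge> 0\<close> there forces \<open>u = 0\<close>. Otherwise
  \<open>f(x\<^sub>0) > 0\<close> for some \<open>x\<^sub>0\<close>, and comparison with powers of \<open>1 + |x - x\<^sub>0|\<^sup>2\<close> yields a lower bound of
  order \<open>|x|\<^sup>2\<^sup>-\<^sup>n\<close> for \<open>w\<^sub>m\<^sub>-\<^sub>1\<close>, two powers better at each step, hence
  \<open>v \<ge> c (1 + |x - x\<^sub>0|\<^sup>2)\<^sup>-\<^sup>\<alpha>\<^sup>/\<^sup>2\<close> because \<open>n - 2m \<le> \<alpha>\<close>. But \<open>u + \<kappa> ln (1 + |x - x\<^sub>0|\<^sup>2)\<close> attains its minimum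
  for every \<open>\<kappa> > 0\<close>, and there \<open>v \<le> \<kappa> C (1 + |x - x\<^sub>0|\<^sup>2)\<^sup>-\<^sup>\<alpha>\<^sup>/\<^sup>2\<close>: a contradiction for small \<open>\<kappa>\<close>.
\<close>

section \<open>Integration\<close>

text \<open>The averages vanish by scaling: the operator is homogeneous of degree \<alpha>, and
  after rescaling the pairing is bounded by a constant times the integral of |u(z)| / (R^p + |z -
  x0|^p) with p = n + \<alpha>, with no power of R left over; dominated convergence does the rest.
  The logarithm tends to infinity, which produces a minimum, while by scaling the operator applied
  to it is of size |x|^(-\<alpha>). A positive power |x|^s would only give |x|^(s - \<alpha>), too
  large for a contradiction when the minimum lies far out. Second differences of \<open>u\<close>
  replace the principal value, so that every integral converges absolutely. The pointwise arguments
  need classical second derivatives of each iterate, hence C^(2m) regularity of \<open>v\<close>. It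
  is obtained by splitting the kernel: derivatives fall on \<open>u\<close> near the singularity and
  on the kernel away from it.\<close>

lemma lborel_integrable_affine:
  fixes f :: "'a::euclidean_space \<Rightarrow> real"
  assumes "integrable lborel f" "c \<noteq> 0"
  shows "integrable lborel (\<lambda>x. f (t + c *\<^sub>R x))"
proof -
  have [measurable]: "f \<in> borel_measurable borel" using assms(1) by auto
  have "integrable (density (distr lborel borel (\<lambda>x. t + c *\<^sub>R x)) (\<lambda>_. \<bar>c\<bar>^DIM('a))) f"
    using assms lborel_affine[of c t] by simp
  then show ?thesis
    using assms(2) by (subst (asm) integrable_density) (auto simp: integrable_distr_eq)
qed

lemma lborel_integral_affine:
  fixes f :: "'a::euclidean_space \<Rightarrow> real"
  assumes [measurable]: "f \<in> borel_measurable borel" and "c \<noteq> 0"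
  shows "integral\<^sup>L lborel f = \<bar>c\<bar> ^ DIM('a) * (\<integral>x. f (t + c *\<^sub>R x) \<partial>lborel)"
proof -
  have "integral\<^sup>L lborel f = integral\<^sup>L (density (distr lborel borel (\<lambda>x. t + c *\<^sub>R x)) (\<lambda>_. \<bar>c\<bar>^DIM('a))) f"
    using assms lborel_affine[of c t] by simp
  also have "\<dots> = (\<integral>x. \<bar>c\<bar>^DIM('a) *\<^sub>R f x \<partial>(distr lborel borel (\<lambda>x. t + c *\<^sub>R x)))"
    by (subst integral_density) auto
  also have "\<dots> = \<bar>c\<bar> ^ DIM('a) * (\<integral>x. f (t + c *\<^sub>R x) \<partial>lborel)"
    by (subst integral_distr) auto
  finally show ?thesis .
qed

lemma lborel_integrable_translate:
  fixes f :: "'a::euclidean_space \<Rightarrow> real"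
  assumes "integrable lborel f"
  shows "integrable lborel (\<lambda>x. f (x + t))" "integrable lborel (\<lambda>x. f (t + x))"
    "integrable lborel (\<lambda>x. f (t - x))" "integrable lborel (\<lambda>x. f (- x))" "integrable lborel (\<lambda>x. f (x - t))"
  using lborel_integrable_affine[OF assms, of 1 t] lborel_integrable_affine[OF assms, of "-1" t]
     lborel_integrable_affine[OF assms, of "-1" 0] lborel_integrable_affine[OF assms, of 1 "-t"]
  by (simp_all add: add.commute)

lemma lborel_integral_translate:
  fixes f :: "'a::euclidean_space \<Rightarrow> real"
  assumes "f \<in> borel_measurable borel"
  shows "(\<integral>x. f (x + t) \<partial>lborel) = integral\<^sup>L lborel f" "(\<integral>x. f (t + x) \<partial>lborel) = integral\<^sup>L lborel f"
    "(\<integral>x. f (t - x) \<partial>lborel) = integral\<^sup>L lborel f" "(\<integral>x. f (- x) \<partial>lborel) = integral\<^sup>L lborel f"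
    "(\<integral>x. f (x - t) \<partial>lborel) = integral\<^sup>L lborel f"
  using lborel_integral_affine[OF assms, of 1 t] lborel_integral_affine[OF assms, of "-1" t]
     lborel_integral_affine[OF assms, of "-1" 0] lborel_integral_affine[OF assms, of 1 "-t"]
  by (simp_all add: add.commute)

lemma integrable_dominated:
  fixes f g :: "'a \<Rightarrow> real"
  assumes "integrable M g" "f \<in> borel_measurable M" "\<And>x. \<bar>f x\<bar> \<le> g x"
  shows "integrable M f"
  by (rule Bochner_Integration.integrable_bound[OF assms(1,2)])
     (use assms(3) in \<open>auto intro!: AE_I2 intro: order_trans[OF _ abs_ge_self]\<close>)

lemma continuous_bounded_cball:
  fixes g :: "'a::heine_borel \<Rightarrow> real"
  assumes "continuous_on UNIV g"
  obtains M where "0 \<le> M" "\<And>x. dist a x \<le> r \<Longrightarrow> \<bar>g x\<bar> \<le> M"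
proof -
  have "compact (g ` cball a r)"
    using assms by (intro compact_continuous_image) (auto intro: continuous_on_subset)
  then obtain M where "\<And>x. dist a x \<le> r \<Longrightarrow> \<bar>g x\<bar> \<le> M"
    by (force simp: bounded_iff dest!: compact_imp_bounded)
  then show ?thesis using that[of "\<bar>M\<bar>"] by fastforce
qed

text \<open>In a first countable space limits within a set are tested by sequences, which reduces
  the claim to the sequential theorem. The bound holds only eventually, hence the shift of the
  sequence by \<open>N\<close>.\<close>

lemma integral_dominated_convergence_within:
  fixes s :: "'c::first_countable_topology \<Rightarrow> 'a \<Rightarrow> real"
  assumes "f \<in> borel_measurable M" "\<And>t. s t \<in> borel_measurable M" "integrable M w"
    and lim: "\<And>y. y \<in> space M \<Longrightarrow> ((\<lambda>t. s t y) \<longlongrightarrow> f y) (at x within S)"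
    and bound: "\<forall>\<^sub>F t in at x within S. \<forall>y\<in>space M. \<bar>s t y\<bar> \<le> w y"
  shows "((\<lambda>t. integral\<^sup>L M (s t)) \<longlongrightarrow> integral\<^sup>L M f) (at x within S)"
  unfolding tendsto_at_iff_sequentially
proof (intro allI impI)
  fix X :: "nat \<Rightarrow> 'c" assume X: "\<forall>i. X i \<in> S - {x}" "X \<longlonglongrightarrow> x"
  have F: "filterlim X (at x within S) sequentially"
    using X by (auto simp: filterlim_at)
  from filterlim_iff[THEN iffD1, OF F, rule_format, OF bound]
  obtain N where w: "\<And>n. N \<le> n \<Longrightarrow> \<forall>y\<in>space M. \<bar>s (X n) y\<bar> \<le> w y"
    by (auto simp: eventually_sequentially)
  show "((\<lambda>t. integral\<^sup>L M (s t)) \<circ> X) \<longlonglongrightarrow> integral\<^sup>L M f"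
    unfolding o_def
  proof (rule LIMSEQ_offset, rule integral_dominated_convergence)
    show "AE y in M. norm (s (X (n + N)) y) \<le> w y" for n
      using w[of "n+N"] by auto
    show "AE y in M. (\<lambda>n. s (X (n + N)) y) \<longlonglongrightarrow> f y"
      using lim by (intro AE_I2 LIMSEQ_ignore_initial_segment filterlim_compose[OF _ F])
  qed fact+
qed

text \<open>By the mean value theorem the difference quotients at \<open>a\<close> are values of
  \<open>f'\<close> at intermediate points, so the majorant \<open>g\<close> of the derivative
  dominates them as well.\<close>

lemma has_real_derivative_integral:
  fixes f f' :: "real \<Rightarrow> 'a \<Rightarrow> real"
  assumes "0 < d"
    and int: "\<And>t. integrable M (f t)"
    and der: "\<And>t y. \<bar>t - a\<bar> < d \<Longrightarrow> y \<in> space M \<Longrightarrow> ((\<lambda>t. f t y) has_real_derivative f' t y) (at t)"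
    and bd: "\<And>t y. \<bar>t - a\<bar> < d \<Longrightarrow> y \<in> space M \<Longrightarrow> \<bar>f' t y\<bar> \<le> g y"
    and g: "integrable M g" and [measurable]: "f' a \<in> borel_measurable M"
  shows "((\<lambda>t. integral\<^sup>L M (f t)) has_real_derivative integral\<^sup>L M (f' a)) (at a)"
  unfolding has_field_derivative_iff
proof -
  have [measurable]: "f t \<in> borel_measurable M" for t using int by auto
  have "((\<lambda>t. \<integral>y. (f t y - f a y) / (t - a) \<partial>M) \<longlongrightarrow> integral\<^sup>L M (f' a)) (at a)"
  proof (rule integral_dominated_convergence_within[OF _ _ g])
    show "((\<lambda>t. (f t y - f a y) / (t - a)) \<longlongrightarrow> f' a y) (at a)" if "y \<in> space M" for y
      using der[of a y] that \<open>0 < d\<close> unfolding has_field_derivative_iff by simp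
    have "\<bar>(f t y - f a y) / (t - a)\<bar> \<le> g y" if "\<bar>t - a\<bar> < d" "t \<noteq> a" "y \<in> space M" for t y
    proof -
      have "\<exists>z. \<bar>z - a\<bar> < d \<and> f t y - f a y = (t - a) * f' z y"
      proof (cases "a < t")
        case True
        have "((\<lambda>t. f t y) has_real_derivative f' z y) (at z)" if "a \<le> z" "z \<le> t" for z
          using der[of z y] that True \<open>\<bar>t - a\<bar> < d\<close> \<open>y \<in> space M\<close> by auto
        from MVT2[OF True this] obtain z where "a < z" "z < t" "f t y - f a y = (t - a) * f' z y"
          by blast
        with that show ?thesis by (intro exI[of _ z]) auto
      next
        case False
        with that have "t < a" by auto
        have "((\<lambda>t. f t y) has_real_derivative f' z y) (at z)" if "t \<le> z" "z \<le> a" for z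
          using der[of z y] that \<open>t < a\<close> \<open>\<bar>t - a\<bar> < d\<close> \<open>y \<in> space M\<close> by auto
        from MVT2[OF \<open>t < a\<close> this] obtain z where "t < z" "z < a" "f a y - f t y = (a - t) * f' z y"
          by blast
        with that show ?thesis by (intro exI[of _ z]) (auto simp: algebra_simps)
      qed
      then obtain z where z: "\<bar>z - a\<bar> < d" "f t y - f a y = (t - a) * f' z y" by blast
      then have "(f t y - f a y) / (t - a) = f' z y" using that by simp
      then show ?thesis using bd[OF z(1) that(3)] by simp
    qed
    then show "\<forall>\<^sub>F t in at a. \<forall>y\<in>space M. \<bar>(f t y - f a y) / (t - a)\<bar> \<le> g y"
      unfolding eventually_at using \<open>0 < d\<close> by (intro exI[of _ d]) (auto simp: dist_real_def)
  qed auto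
  moreover have "(\<integral>y. (f t y - f a y) / (t - a) \<partial>M) = (integral\<^sup>L M (f t) - integral\<^sup>L M (f a)) / (t - a)" for t
    using Bochner_Integration.integral_diff[OF int int, of t a] by simp
  ultimately show "((\<lambda>t. (integral\<^sup>L M (f t) - integral\<^sup>L M (f a)) / (t - a)) \<longlongrightarrow> integral\<^sup>L M (f' a)) (at a)"
    by (simp only:)
qed

lemma continuous_on_integral:
  fixes f :: "'b::metric_space \<Rightarrow> 'a \<Rightarrow> real"
  assumes [measurable]: "\<And>x. f x \<in> borel_measurable M"
    and cont: "\<And>y. y \<in> space M \<Longrightarrow> continuous_on UNIV (\<lambda>x. f x y)"
    and bd: "\<And>x0. \<exists>g. integrable M g \<and> (\<forall>x y. dist x x0 < 1 \<longrightarrow> y \<in> space M \<longrightarrow> \<bar>f x y\<bar> \<le> g y)"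
  shows "continuous_on UNIV (\<lambda>x. integral\<^sup>L M (f x))"
  unfolding continuous_on_eq_continuous_at[OF open_UNIV]
proof
  fix x0
  obtain g where g: "integrable M g" "\<forall>x y. dist x x0 < 1 \<longrightarrow> y \<in> space M \<longrightarrow> \<bar>f x y\<bar> \<le> g y"
    using bd by blast
  show "isCont (\<lambda>x. integral\<^sup>L M (f x)) x0"
    unfolding isCont_def
  proof (rule integral_dominated_convergence_within[OF _ _ g(1)])
    show "((\<lambda>x. f x y) \<longlongrightarrow> f x0 y) (at x0)" if "y \<in> space M" for y
      using cont[OF that] by (simp add: continuous_on_def)
    show "\<forall>\<^sub>F t in at x0. \<forall>y\<in>space M. \<bar>f t y\<bar> \<le> g y"
      unfolding eventually_at using g(2) by (intro exI[of _ 1]) auto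
  qed auto
qed

text \<open>A substitute for polar coordinates: |f| lies below the sum over all \<open>j\<close> of
  \<open>a j\<close> times the indicator of the ball of radius \<open>r j\<close>, and that sum is
  integrated term by term.\<close>

lemma integrable_dyadic:
  fixes f :: "'a::euclidean_space \<Rightarrow> real"
  assumes [measurable]: "f \<in> borel_measurable borel"
    and a: "\<And>j. 0 \<le> a j" and r: "\<And>j. 0 \<le> r j"
    and f: "\<And>y. f y \<noteq> 0 \<Longrightarrow> \<exists>j. norm y < r j \<and> \<bar>f y\<bar> \<le> a j"
    and s: "summable (\<lambda>j. a j * r j ^ DIM('a))"
  shows "integrable lborel f"
proof (rule integrableI_bounded)
  define \<omega> where "\<omega> = unit_ball_vol DIM('a)"
  have \<omega>: "0 \<le> \<omega>" by (simp add: \<omega>_def)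
  have "(\<integral>\<^sup>+y. norm (f y) \<partial>lborel) \<le> (\<integral>\<^sup>+(y::'a). (\<Sum>j. ennreal (a j) * indicator (ball 0 (r j)) y) \<partial>lborel)"
  proof (intro nn_integral_mono)
    fix y :: 'a
    show "ennreal (norm (f y)) \<le> (\<Sum>j. ennreal (a j) * indicator (ball 0 (r j)) y)"
    proof (cases "f y = 0")
      case False
      then obtain j where j: "norm y < r j" "\<bar>f y\<bar> \<le> a j" using f by blast
      then have "ennreal (norm (f y)) \<le> ennreal (a j) * indicator (ball 0 (r j)) y"
        by (simp add: ennreal_leI)
      also have "\<dots> = (\<Sum>i\<in>{j}. ennreal (a i) * indicator (ball 0 (r i)) y)" by (subst sum.insert) auto
      also have "\<dots> \<le> (\<Sum>j. ennreal (a j) * indicator (ball 0 (r j)) y)"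
        by (rule sum_le_suminf) auto
      finally show ?thesis .
    qed simp
  qed
  also have "\<dots> = (\<Sum>j. \<integral>\<^sup>+(y::'a). ennreal (a j) * indicator (ball 0 (r j)) y \<partial>lborel)"
    by (rule nn_integral_suminf) (auto intro!: borel_measurable_times_ennreal borel_measurable_indicator)
  also have "\<dots> = (\<Sum>j. ennreal (\<omega> * (a j * r j ^ DIM('a))))"
    using a r \<omega> by (simp add: nn_integral_cmult_indicator emeasure_ball flip: \<omega>_def ennreal_mult) (simp add: mult_ac)
  also have "\<dots> = ennreal (\<Sum>j. \<omega> * (a j * r j ^ DIM('a)))"
    using a r \<omega> s by (intro suminf_ennreal2) (auto intro!: summable_mult)
  also have "\<dots> < \<infinity>" by simp
  finally show "(\<integral>\<^sup>+y. norm (f y) \<partial>lborel) < \<infinity>" .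
qed auto

text \<open>On the shell where |y| lies between 2^j and 2^(j+1) the integrand is at most 2^(-j (n +
  \<delta>)), while the ball of radius 2^(j+1) has volume of order 2^(j n): the series is geometric
  with ratio 2^(-\<delta>).\<close>

lemma integrable_norm_powr_outside:
  fixes \<delta> :: real
  assumes "0 < \<delta>"
  shows "integrable lborel (\<lambda>y::'a::euclidean_space. indicator (- ball 0 1) y * norm y powr - (DIM('a) + \<delta>))"
proof (rule integrable_dyadic[where a="\<lambda>j. (2 ^ j) powr - (DIM('a) + \<delta>)" and r="\<lambda>j. 2 ^ Suc j"])
  fix y :: 'a assume "indicator (- ball 0 1) y * norm y powr - (DIM('a) + \<delta>) \<noteq> 0"
  then have y: "1 \<le> norm y" by (auto simp: indicator_def split: if_splits)
  define j where "j = nat \<lfloor>log 2 (norm y)\<rfloor>"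
  have "0 \<le> log 2 (norm y)" using y by (subst zero_le_log_cancel_iff) auto
  then have j: "real j \<le> log 2 (norm y)" "log 2 (norm y) < real j + 1" unfolding j_def by linarith+
  have "2 powr real j \<le> norm y" using j(1) y le_log_iff[of 2 "norm y" "real j"] by fastforce
  moreover have "norm y < 2 powr real (Suc j)" using j(2) y log_less_iff[of 2 "norm y" "real j + 1"] by (cases "y = 0") (simp_all add: add.commute)
  ultimately have "2 ^ j \<le> norm y" "norm y < 2 ^ Suc j" by (simp_all add: powr_realpow del: of_nat_Suc power_Suc)
  then show "\<exists>j. norm y < 2 ^ Suc j \<and> \<bar>indicator (- ball 0 1) y * norm y powr - (DIM('a) + \<delta>)\<bar> \<le> (2 ^ j) powr - (DIM('a) + \<delta>)"
    using \<open>0 < \<delta>\<close> y by (intro exI[of _ j]) (auto simp: indicator_def intro!: powr_mono2')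
next
  have "(2 ^ j) powr - (DIM('a) + \<delta>) * (2 ^ Suc j) ^ DIM('a) = 2 ^ DIM('a) * (2 powr - \<delta>) ^ j" for j
  proof -
    have "(2::real) ^ j = 2 powr j" "(2::real) ^ Suc j = 2 powr (real j + 1)"
      by (simp_all add: powr_realpow powr_add)
    then show ?thesis
      by (simp add: powr_powr flip: powr_realpow powr_add) (simp add: algebra_simps)
  qed
  moreover have "summable (\<lambda>j. 2 ^ DIM('a) * (2 powr - \<delta>) ^ j)"
    using \<open>0 < \<delta>\<close> by (intro summable_mult summable_geometric) (simp add: powr_less_one)
  ultimately show "summable (\<lambda>j. (2 ^ j) powr - (DIM('a) + \<delta>) * (2 ^ Suc j) ^ DIM('a))" by (simp only:)
qed auto

text \<open>The same argument with shells of radii 2^(-j) shrinking to the origin. At the origin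
  itself the integrand is 0, because \<open>powr\<close> with base 0 is 0.\<close>

lemma integrable_norm_powr_inside:
  fixes \<delta> :: real
  assumes "0 < \<delta>" "\<delta> \<le> real DIM('a::euclidean_space)"
  shows "integrable lborel (\<lambda>y::'a::euclidean_space. indicator (ball 0 1) y * norm y powr (\<delta> - DIM('a)))"
proof (rule integrable_dyadic[where a="\<lambda>j. (2 powr - (real j + 1)) powr (\<delta> - DIM('a))" and r="\<lambda>j. 2 powr - real j"])
  fix y :: 'a assume "indicator (ball 0 1) y * norm y powr (\<delta> - DIM('a)) \<noteq> 0"
  then have y: "norm y < 1" "0 < norm y" by (auto simp: indicator_def split: if_splits)
  define j where "j = nat (\<lceil>- log 2 (norm y)\<rceil> - 1)"
  have "0 < - log 2 (norm y)" using y by (simp del: zero_less_norm_iff)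
  then have j: "real j < - log 2 (norm y)" "- log 2 (norm y) \<le> real j + 1" unfolding j_def by linarith+
  have "norm y < 2 powr - real j" using j(1) y log_less_iff[of 2 "norm y" "- real j"] by simp
  moreover have "2 powr - (real j + 1) \<le> norm y" using j(2) y le_log_iff[of 2 "norm y" "- (real j + 1)"] by simp
  ultimately show "\<exists>j. norm y < 2 powr - real j \<and> 
      \<bar>indicator (ball 0 1) y * norm y powr (\<delta> - DIM('a))\<bar> \<le> (2 powr - (real j + 1)) powr (\<delta> - DIM('a))"
    using assms y by (intro exI[of _ j]) (auto simp: indicator_def intro!: powr_mono2')
next
  have "(2 powr - (real j + 1)) powr (\<delta> - DIM('a)) * (2 powr - real j) ^ DIM('a) = 2 powr (DIM('a) - \<delta>) * (2 powr - \<delta>) ^ j" for j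
    by (simp add: powr_powr flip: powr_realpow powr_add) (simp add: algebra_simps)
  moreover have "summable (\<lambda>j. 2 powr (DIM('a) - \<delta>) * (2 powr - \<delta>) ^ j)"
    using \<open>0 < \<delta>\<close> by (intro summable_mult summable_geometric) (simp add: powr_less_one)
  ultimately show "summable (\<lambda>j. (2 powr - (real j + 1)) powr (\<delta> - DIM('a)) * (2 powr - real j) ^ DIM('a))" by (simp only:)
qed (auto intro!: borel_measurable_times borel_measurable_indicator)

section \<open>The operator in terms of second differences\<close>

text \<open>The sign is that of the positive operator: nonpositive at a minimum of \<open>u\<close>.
  Adding the two sides cancels the first order term of \<open>u\<close>, which is what lets the
  singular integral converge absolutely.\<close>

definition sdiff :: "('a::real_normed_vector \<Rightarrow> real) \<Rightarrow> 'a \<Rightarrow> 'a \<Rightarrow> real" where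
  "sdiff u x y = 2 * u x - u (x + y) - u (x - y)"

text \<open>The value at \<open>0\<close> is \<open>0\<close>, a junk value of \<open>powr\<close>.\<close>

definition riesz :: "real \<Rightarrow> 'a::euclidean_space \<Rightarrow> real" where
  "riesz \<alpha> y = norm y powr - (real DIM('a) + \<alpha>)"

text \<open>Without the constant, and twice the principal value integral.\<close>

definition sym_frac_lap :: "real \<Rightarrow> ('a::euclidean_space \<Rightarrow> real) \<Rightarrow> 'a \<Rightarrow> real" where
  "sym_frac_lap \<alpha> u x = (\<integral>y. sdiff u x y * riesz \<alpha> y \<partial>lborel)"

definition tail_weight :: "real \<Rightarrow> 'a::euclidean_space \<Rightarrow> real" where
  "tail_weight \<alpha> x = 1 / (1 + norm x powr (real DIM('a) + \<alpha>))"

lemma sdiff_0 [simp]: "sdiff u x 0 = 0"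
  by (simp add: sdiff_def)

lemma riesz_nonneg [simp]: "0 \<le> riesz \<alpha> y"
  by (simp add: riesz_def)

lemma riesz_minus [simp]: "riesz \<alpha> (- y) = riesz \<alpha> y"
  by (simp add: riesz_def)

lemma riesz_0 [simp]: "riesz \<alpha> 0 = 0"
  by (simp add: riesz_def)

lemma riesz_eq: "riesz \<alpha> (y::'a::euclidean_space) = 1 / norm y powr (real DIM('a) + \<alpha>)"
  unfolding riesz_def by (rule powr_minus_divide)

lemma tail_weight_pos: "0 < tail_weight \<alpha> x"
  by (simp add: tail_weight_def add_pos_nonneg)

lemma tail_weight_nonneg [simp]: "0 \<le> tail_weight \<alpha> x"
  using tail_weight_pos[of \<alpha> x] by simp

lemma measurable_riesz [measurable]: "riesz \<alpha> \<in> borel_measurable borel"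
  unfolding riesz_def by measurable

lemma measurable_tail_weight [measurable]: "tail_weight \<alpha> \<in> borel_measurable borel"
  unfolding tail_weight_def by measurable

text \<open>For |y| \<ge> e, |x + y| is at most (r / e + 1) |y| and 1 is at most |y| / e. Hence the
  kernel seen from any \<open>x\<close> in a bounded set is controlled by the fixed weight at the
  translated point.\<close>

lemma riesz_le_tail_weight:
  fixes x y :: "'a::euclidean_space"
  assumes "0 < \<alpha>" "0 < e" "e \<le> norm y" "norm x \<le> r"
  shows "riesz \<alpha> y \<le> ((1 / e) powr (real DIM('a) + \<alpha>) + (r / e + 1) powr (real DIM('a) + \<alpha>)) * tail_weight \<alpha> (x + y)"
proof -
  define p where "p = real DIM('a) + \<alpha>"
  have p: "0 < p" using assms by (simp add: p_def add_nonneg_pos)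
  have y: "0 < norm y" using assms by linarith
  have r: "0 \<le> r" using assms(4) norm_ge_zero order_trans by blast
  have 1: "1 \<le> (norm y / e) powr p"
    using assms p by (intro ge_one_powr_ge_zero) auto
  have "norm (x + y) \<le> r + norm y"
    using norm_triangle_ineq[of x y] assms by linarith
  also have "\<dots> \<le> (r / e + 1) * norm y"
    using assms r mult_left_mono[of e "norm y" "r / e"] by (simp add: field_simps)
  finally have 2: "norm (x + y) powr p \<le> ((r / e + 1) * norm y) powr p"
    using p by (intro powr_mono2) auto
  have "1 + norm (x + y) powr p \<le> ((1 / e) powr p + (r / e + 1) powr p) * norm y powr p"
  proof -
    have "(norm y / e) powr p = (1 / e) powr p * norm y powr p"
      using assms by (simp flip: powr_mult)
    moreover have "((r / e + 1) * norm y) powr p = (r / e + 1) powr p * norm y powr p"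
      using assms r by (simp add: powr_mult)
    ultimately show ?thesis using 1 2 by (simp add: distrib_right)
  qed
  moreover have "0 < 1 + norm (x + y) powr p" by (simp add: add_pos_nonneg)
  ultimately show ?thesis
    using y unfolding riesz_def tail_weight_def p_def[symmetric]
    by (simp add: powr_minus divide_simps mult.commute)
qed

lemma integrable_tail_weight:
  assumes "0 < \<alpha>"
  shows "integrable lborel (tail_weight \<alpha> :: 'a::euclidean_space \<Rightarrow> real)"
proof (rule integrable_dominated)
  show "integrable lborel (\<lambda>y::'a. indicator (ball 0 1) y + indicator (- ball 0 1) y * norm y powr - (real DIM('a) + \<alpha>))"
    by (intro Bochner_Integration.integrable_add integrable_norm_powr_outside integrable_real_indicator
        emeasure_lborel_ball_finite) (auto simp: assms)
  show "\<bar>tail_weight \<alpha> y\<bar> \<le> indicator (ball 0 1) y + indicator (- ball 0 1) y * norm y powr - (real DIM('a) + \<alpha>)" for y :: 'a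
  proof (cases "norm y < 1")
    case True
    then show ?thesis by (simp add: tail_weight_def divide_le_eq add_pos_nonneg)
  next
    case False
    then have "0 < norm y powr (real DIM('a) + \<alpha>)" by auto
    then have "tail_weight \<alpha> y \<le> 1 / norm y powr (real DIM('a) + \<alpha>)" by (simp add: tail_weight_def frac_le)
    then show ?thesis using False by (simp add: powr_minus_divide[of _ "real DIM('a) + \<alpha>"] del: minus_add_distrib)
  qed
qed measurable

text \<open>From |x| \<le> 2 max (|r|, |x - a|): weights with centres in a bounded set are
  comparable, with one constant for all of them.\<close>

lemma tail_weight_translate_le:
  fixes r :: real
  assumes "0 < \<alpha>"
  shows "\<exists>C>0. \<forall>a x. norm a \<le> r \<longrightarrow> tail_weight \<alpha> (x - a) \<le> C * tail_weight \<alpha> (x::'a::euclidean_space)"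
proof -
  define p where "p = real DIM('a) + \<alpha>"
  have p: "0 < p" using assms by (simp add: p_def add_nonneg_pos)
  define C where "C = 1 + (2 * \<bar>r\<bar>) powr p + 2 powr p"
  have C: "0 < C" by (simp add: C_def add_pos_nonneg)
  have "1 + norm x powr p \<le> C * (1 + norm (x - a) powr p)" if "norm a \<le> r" for x a :: 'a
  proof -
    have "norm x \<le> norm a + norm (x - a)" using norm_triangle_sub[of x a] by simp
    also have "\<dots> \<le> max (2 * \<bar>r\<bar>) (2 * norm (x - a))" using that by linarith
    finally have "norm x powr p \<le> (max (2 * \<bar>r\<bar>) (2 * norm (x - a))) powr p"
      using p by (intro powr_mono2) auto
    also have "\<dots> \<le> (2 * \<bar>r\<bar>) powr p + (2 * norm (x - a)) powr p"
      by (simp add: max_def)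
    finally have "norm x powr p \<le> (2 * \<bar>r\<bar>) powr p + 2 powr p * norm (x - a) powr p"
      by (simp add: powr_mult)
    moreover have "0 \<le> norm (x - a) powr p" "0 \<le> (2 * \<bar>r\<bar>) powr p * norm (x - a) powr p" "0 \<le> 2 powr p" by auto
    ultimately show ?thesis unfolding C_def distrib_left distrib_right by linarith
  qed
  then have "tail_weight \<alpha> (x - a) \<le> C * tail_weight \<alpha> x" if "norm a \<le> r" for x a :: 'a
    using that unfolding tail_weight_def p_def[symmetric]
    by (simp add: divide_simps add_pos_nonneg mult.commute split: if_splits)
  then show ?thesis using C by blast
qed

text \<open>The assumption \<open>sd\<close> covers both ranges of \<alpha> at once: for \<alpha> <
  1 it follows from a Hoelder bound on \<open>u\<close>, for \<alpha> \<ge> 1 from one on the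
  gradient. Since \<sigma> exceeds \<alpha>, the second difference times the kernel is of order
  |y|^(\<sigma> - \<alpha> - n), integrable at 0; the upper limit on \<sigma> keeps this exponent
  nonpositive.\<close>

locale frac_admissible =
  fixes \<alpha> \<sigma> :: real and u :: "'a::euclidean_space \<Rightarrow> real"
  assumes \<alpha>: "0 < \<alpha>" "\<alpha> < 2" and \<sigma>: "\<alpha> < \<sigma>" "\<sigma> \<le> \<alpha> + real DIM('a)"
    and cont: "continuous_on UNIV u"
    and sd: "\<And>r. \<exists>C. \<forall>x y. norm x \<le> r \<longrightarrow> norm y \<le> r \<longrightarrow> \<bar>sdiff u x y\<bar> \<le> C * norm y powr \<sigma>"
    and L: "integrable lborel (\<lambda>x. \<bar>u x\<bar> * tail_weight \<alpha> x)"
begin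

lemma meas [measurable]: "u \<in> borel_measurable borel"
  using cont by (rule borel_measurable_continuous_onI)

lemma meas_sdiff [measurable]: "sdiff u x \<in> borel_measurable borel"
  unfolding sdiff_def by measurable

end

section \<open>Convergence of the principal value\<close>

lemma integrable_riesz_tail:
  fixes u :: "'a::euclidean_space \<Rightarrow> real"
  assumes "0 < \<alpha>" "0 < e" and [measurable]: "u \<in> borel_measurable borel"
    and L: "integrable lborel (\<lambda>x. \<bar>u x\<bar> * tail_weight \<alpha> x)"
  shows "integrable lborel (\<lambda>y. indicator {y. e \<le> norm y} y * (u (x + y) * riesz \<alpha> y))"
    and "integrable lborel (\<lambda>y. indicator {y. e \<le> norm y} y * (u (x - y) * riesz \<alpha> y))"
proof -
  define C where "C = ((1 / e) powr (real DIM('a) + \<alpha>) + (norm x / e + 1) powr (real DIM('a) + \<alpha>))"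
  show 1: "integrable lborel (\<lambda>y. indicator {y. e \<le> norm y} y * (u (x + y) * riesz \<alpha> y))"
  proof (rule integrable_dominated)
    show "integrable lborel (\<lambda>y. C * (\<bar>u (x + y)\<bar> * tail_weight \<alpha> (x + y)))"
      using lborel_integrable_translate(2)[OF L, of x] by simp
    show "\<bar>indicator {y. e \<le> norm y} y * (u (x + y) * riesz \<alpha> y)\<bar> \<le> C * (\<bar>u (x + y)\<bar> * tail_weight \<alpha> (x + y))" for y
    proof (cases "e \<le> norm y")
      case True
      from riesz_le_tail_weight[OF assms(1,2) this order_refl, of x]
      have "\<bar>u (x + y)\<bar> * riesz \<alpha> y \<le> \<bar>u (x + y)\<bar> * (C * tail_weight \<alpha> (x + y))"
        unfolding C_def by (intro mult_left_mono) auto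
      then show ?thesis using True by (simp add: abs_mult mult_ac)
    qed (simp add: C_def)
  qed measurable
  show "integrable lborel (\<lambda>y. indicator {y. e \<le> norm y} y * (u (x - y) * riesz \<alpha> y))"
    using lborel_integrable_translate(4)[OF 1] by (simp add: indicator_def)
qed

lemma L_one:
  assumes "0 < \<alpha>"
  shows "integrable lborel (\<lambda>x::'a::euclidean_space. \<bar>1\<bar> * tail_weight \<alpha> x)"
  using integrable_tail_weight[OF assms] by simp

context frac_admissible
begin

lemma integrable_sdiff_tail:
  assumes "0 < e"
  shows "integrable lborel (\<lambda>y. indicator {y. e \<le> norm y} y * (sdiff u x y * riesz \<alpha> y))"
proof -
  have "integrable lborel (\<lambda>y. 2 * u x * (indicator {y. e \<le> norm y} y * (1 * riesz \<alpha> y)) 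
      - indicator {y. e \<le> norm y} y * (u (x + y) * riesz \<alpha> y) - indicator {y. e \<le> norm y} y * (u (x - y) * riesz \<alpha> y))"
    using integrable_riesz_tail(1)[OF \<alpha>(1) assms, of "\<lambda>_. 1"] L_one[OF \<alpha>(1)]
    by (intro Bochner_Integration.integrable_diff integrable_mult_right integrable_riesz_tail \<alpha> assms L meas) auto
  then show ?thesis
    by (rule Bochner_Integration.integrable_cong[THEN iffD1, rotated 2]) (auto simp: sdiff_def algebra_simps)
qed

lemma near_bound:
  obtains C where "0 \<le> C"
    "\<And>x y. norm x \<le> r \<Longrightarrow> norm y < 1 \<Longrightarrow> \<bar>sdiff u x y\<bar> * riesz \<alpha> y \<le> C * (indicator (ball 0 1) y * norm y powr (\<sigma> - \<alpha> - real DIM('a)))"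
proof -
  \<comment> \<open>Enlarging the radius to at least 1 lets a single constant serve all |y| <
    1.\<close>
  obtain C where C: "\<And>x y. norm x \<le> max r 1 \<Longrightarrow> norm y \<le> max r 1 \<Longrightarrow> \<bar>sdiff u x y\<bar> \<le> C * norm y powr \<sigma>"
    using sd by meson
  have "\<bar>sdiff u x y\<bar> * riesz \<alpha> y \<le> \<bar>C\<bar> * (indicator (ball 0 1) y * norm y powr (\<sigma> - \<alpha> - real DIM('a)))"
    if "norm x \<le> r" "norm y < 1" for x y
  proof -
    have "\<bar>sdiff u x y\<bar> \<le> C * norm y powr \<sigma>" using C that by simp
    also have "\<dots> \<le> \<bar>C\<bar> * norm y powr \<sigma>" by (intro mult_right_mono) auto
    finally have "\<bar>sdiff u x y\<bar> * riesz \<alpha> y \<le> (\<bar>C\<bar> * norm y powr \<sigma>) * riesz \<alpha> y"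
      by (rule mult_right_mono) simp
    then show ?thesis using that by (simp add: riesz_def algebra_simps flip: powr_add)
  qed
  then show ?thesis by (intro that[of "\<bar>C\<bar>"]) auto
qed

lemma integrable_near:
  "integrable lborel (\<lambda>y::'a. indicator (ball 0 1) y * norm y powr (\<sigma> - \<alpha> - real DIM('a)))"
  using integrable_norm_powr_inside[of "\<sigma> - \<alpha>", where 'a='a] \<sigma> by simp

lemma integrable_sdiff: "integrable lborel (\<lambda>y. sdiff u x y * riesz \<alpha> y)"
proof -
  obtain C where C: "0 \<le> C" "\<And>y. norm y < 1 \<Longrightarrow> \<bar>sdiff u x y\<bar> * riesz \<alpha> y \<le> C * (indicator (ball 0 1) y * norm y powr (\<sigma> - \<alpha> - real DIM('a)))"
    using near_bound[of "norm x"] by (metis order_refl)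
  have "integrable lborel (\<lambda>y. indicator (ball 0 1) y * (sdiff u x y * riesz \<alpha> y))"
  proof (rule Bochner_Integration.integrable_bound)
    show "integrable lborel (\<lambda>y::'a. C * (indicator (ball 0 1) y * norm y powr (\<sigma> - \<alpha> - real DIM('a))))"
      using integrable_near by simp
    show "AE y in lborel. norm (indicator (ball 0 1) y * (sdiff u x y * riesz \<alpha> y))
      \<le> norm (C * (indicator (ball 0 1) y * norm y powr (\<sigma> - \<alpha> - real DIM('a))))"
      using C by (intro AE_I2) (auto simp: indicator_def abs_mult)
  qed (auto intro!: borel_measurable_times borel_measurable_indicator)
  from Bochner_Integration.integrable_add[OF this integrable_sdiff_tail[of 1 x]] show ?thesis
    by (rule Bochner_Integration.integrable_cong[THEN iffD1, rotated 2]) (auto simp: indicator_def)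
qed

text \<open>The truncated domain is symmetric about \<open>x\<close>, so reflecting y to -y and
  averaging replaces the one-sided difference by half the second difference; this is the origin of
  the factor 1/2. The second difference version has an integrable majorant, so the truncation is
  removed by dominated convergence.\<close>

lemma pv_limit:
  "((\<lambda>e. LINT y:{y. e \<le> norm (y - x)}|lborel. (u x - u y) / norm (x - y) powr (real DIM('a) + \<alpha>))
     \<longlongrightarrow> sym_frac_lap \<alpha> u x / 2) (at_right 0)"
proof -
  have eq: "(LINT y:{y. e \<le> norm (y - x)}|lborel. (u x - u y) / norm (x - y) powr (real DIM('a) + \<alpha>)) =
     (\<integral>y. indicator {y. e \<le> norm y} y * (sdiff u x y * riesz \<alpha> y) \<partial>lborel) / 2" if "0 < e" for e
  proof -
    let ?I = "indicator {y. e \<le> norm y} :: 'a \<Rightarrow> real"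
    have 0: "integrable lborel (\<lambda>y. u x * (?I y * (1 * riesz \<alpha> y)))"
      using integrable_riesz_tail(1)[OF \<alpha>(1) that, of "\<lambda>_. 1"] L_one[OF \<alpha>(1)] by auto
    have 1: "integrable lborel (\<lambda>y. u x * (?I y * (1 * riesz \<alpha> y)) - ?I y * (u (x + y) * riesz \<alpha> y))"
      by (intro Bochner_Integration.integrable_diff 0 integrable_riesz_tail \<alpha> that L meas)
    have 2: "integrable lborel (\<lambda>y. u x * (?I y * (1 * riesz \<alpha> y)) - ?I y * (u (x - y) * riesz \<alpha> y))"
      by (intro Bochner_Integration.integrable_diff 0 integrable_riesz_tail \<alpha> that L meas)
    let ?f = "\<lambda>y. u x * (?I y * (1 * riesz \<alpha> y)) - ?I y * (u (x + y) * riesz \<alpha> y)"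
    have "(LINT y:{y. e \<le> norm (y - x)}|lborel. (u x - u y) / norm (x - y) powr (real DIM('a) + \<alpha>))
        = (\<integral>y. ?f (y - x) \<partial>lborel)"
      unfolding set_lebesgue_integral_def
      by (intro Bochner_Integration.integral_cong)
         (auto simp: riesz_eq indicator_def norm_minus_commute[of x] diff_divide_distrib)
    also have "\<dots> = integral\<^sup>L lborel ?f"
      by (rule lborel_integral_translate) measurable
    finally have A: "(LINT y:{y. e \<le> norm (y - x)}|lborel. (u x - u y) / norm (x - y) powr (real DIM('a) + \<alpha>))
        = integral\<^sup>L lborel ?f" .
    have "integral\<^sup>L lborel ?f = (\<integral>y. ?f (- y) \<partial>lborel)"
      by (rule lborel_integral_translate(4)[symmetric]) measurable
    also have "\<dots> = (\<integral>y. u x * (?I y * (1 * riesz \<alpha> y)) - ?I y * (u (x - y) * riesz \<alpha> y) \<partial>lborel)"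
      by (simp add: indicator_def)
    finally have B: "integral\<^sup>L lborel ?f = (\<integral>y. u x * (?I y * (1 * riesz \<alpha> y)) - ?I y * (u (x - y) * riesz \<alpha> y) \<partial>lborel)" .
    have "2 * integral\<^sup>L lborel ?f = integral\<^sup>L lborel ?f + (\<integral>y. u x * (?I y * (1 * riesz \<alpha> y)) - ?I y * (u (x - y) * riesz \<alpha> y) \<partial>lborel)"
      using B by simp
    also have "\<dots> = (\<integral>y. ?f y + (u x * (?I y * (1 * riesz \<alpha> y)) - ?I y * (u (x - y) * riesz \<alpha> y)) \<partial>lborel)"
      by (rule Bochner_Integration.integral_add[OF 1 2, symmetric])
    also have "\<dots> = (\<integral>y. ?I y * (sdiff u x y * riesz \<alpha> y) \<partial>lborel)"
      by (intro Bochner_Integration.integral_cong) (auto simp: sdiff_def algebra_simps)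
    finally show ?thesis using A by simp
  qed
  have "((\<lambda>e. (\<integral>y. indicator {y. e \<le> norm y} y * (sdiff u x y * riesz \<alpha> y) \<partial>lborel)) \<longlongrightarrow> sym_frac_lap \<alpha> u x) (at_right 0)"
    unfolding sym_frac_lap_def
  proof (rule integral_dominated_convergence_within)
    show "integrable lborel (\<lambda>y. \<bar>sdiff u x y * riesz \<alpha> y\<bar>)" using integrable_sdiff by auto
    show "\<forall>\<^sub>F t in at_right 0. \<forall>y\<in>space lborel. \<bar>indicator {y. t \<le> norm y} y * (sdiff u x y * riesz \<alpha> y)\<bar>
        \<le> \<bar>sdiff u x y * riesz \<alpha> y\<bar>"
      by (auto simp: indicator_def)
    show "((\<lambda>t. indicator {y. t \<le> norm y} y * (sdiff u x y * riesz \<alpha> y)) \<longlongrightarrow> sdiff u x y * riesz \<alpha> y) (at_right 0)" for y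
    proof (cases "y = 0")
      case False
      have "\<forall>\<^sub>F t in at_right 0. t < norm y" by (rule eventually_at_rightI[of 0 "norm y"]) (use False in auto)
      then have "\<forall>\<^sub>F t in at_right 0. indicator {y. t \<le> norm y} y * (sdiff u x y * riesz \<alpha> y) = sdiff u x y * riesz \<alpha> y"
        by eventually_elim (auto simp: indicator_def)
      then show ?thesis by (rule tendsto_eventually)
    qed simp
  qed measurable
  then have "((\<lambda>e. (\<integral>y. indicator {y. e \<le> norm y} y * (sdiff u x y * riesz \<alpha> y) \<partial>lborel) / 2) \<longlongrightarrow> sym_frac_lap \<alpha> u x / 2) (at_right 0)"
    by (intro tendsto_intros) auto
  then show ?thesis
    by (rule Lim_transform_eventually) (rule eventually_at_rightI[of 0 1], use eq in auto)
qed

end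

section \<open>Duality with a bump\<close>

lemma integrable_continuous_bump:
  fixes g b :: "'a::euclidean_space \<Rightarrow> real"
  assumes g: "continuous_on UNIV g" and [measurable]: "b \<in> borel_measurable borel"
    and b: "\<And>x. r \<le> norm x \<Longrightarrow> b x = 0" "\<And>x. \<bar>b x\<bar> \<le> B"
  shows "integrable lborel (\<lambda>x. g x * b x)"
proof -
  have [measurable]: "g \<in> borel_measurable borel" using g by (rule borel_measurable_continuous_onI)
  obtain M where M: "\<And>x. norm x \<le> r \<Longrightarrow> \<bar>g x\<bar> \<le> M"
    using continuous_bounded_cball[OF g, of 0 r] by auto
  have B: "0 \<le> B" using b(2)[of 0] by simp
  show ?thesis
  proof (rule integrable_dominated)
    show "integrable lborel (\<lambda>x::'a. (M * B) * indicator (cball 0 r) x)"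
      by (intro integrable_mult_right integrable_real_indicator emeasure_lborel_cball_finite) auto
    show "\<bar>g x * b x\<bar> \<le> (M * B) * indicator (cball 0 r) x" for x
    proof (cases "norm x \<le> r")
      case True
      then have "\<bar>g x\<bar> * \<bar>b x\<bar> \<le> M * B"
        using M[OF True] b(2)[of x] by (intro mult_mono) auto
      then show ?thesis using True by (simp add: abs_mult)
    qed (use b(1)[of x] in simp)
  qed measurable
qed

text \<open>For |x| \<le> 2 the quadratic bound handles |y| < 1 and the trivial bound 4 handles the
  rest, giving a constant. For |x| > 2 the bump vanishes at \<open>x\<close>, so only those
  \<open>y\<close> with x + y or x - y in the unit ball contribute; they satisfy |y| \<ge> |x| / 2,
  where the kernel is of the order of the weight at \<open>x\<close>. This decay in \<open>x\<close>
  is what allows pairing with an element of \<open>L_space\<close>.\<close>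

lemma sdiff_bump_integral_bound:
  fixes b :: "'a::euclidean_space \<Rightarrow> real"
  assumes \<alpha>: "0 < \<alpha>" "\<alpha> < 2" "2 \<le> real DIM('a) + \<alpha>" and [measurable]: "b \<in> borel_measurable borel"
    and b: "\<And>x. 1 \<le> norm x \<Longrightarrow> b x = 0" "\<And>x. \<bar>b x\<bar> \<le> 1"
    and C: "\<And>x y. norm x \<le> 2 \<Longrightarrow> \<bar>sdiff b x y\<bar> \<le> C * norm y ^ 2"
  shows "\<exists>K\<ge>0. \<forall>x. integrable lborel (\<lambda>y. \<bar>sdiff b x y\<bar> * riesz \<alpha> y) \<and>
      (\<integral>y. \<bar>sdiff b x y\<bar> * riesz \<alpha> y \<partial>lborel) \<le> K * tail_weight \<alpha> x"
proof -
  define p where "p = real DIM('a) + \<alpha>"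
  have p: "0 < p" using \<alpha> by (simp add: p_def add_nonneg_pos)
  define near where "near y = indicator (ball 0 1) y * norm y powr (2 - \<alpha> - real DIM('a))" for y :: 'a
  define far where "far y = indicator (- ball 0 1) y * norm y powr - (real DIM('a) + \<alpha>)" for y :: 'a
  have near: "integrable lborel near"
    unfolding near_def using integrable_norm_powr_inside[of "2 - \<alpha>", where 'a='a] \<alpha> by simp
  have far: "integrable lborel far"
    unfolding far_def using integrable_norm_powr_outside[of \<alpha>, where 'a='a] \<alpha> by simp
  have nn: "0 \<le> near y" "0 \<le> far y" for y by (auto simp: near_def far_def)
  have C0: "0 \<le> C"
  proof -
    obtain e :: 'a where "norm e = 1" using vector_choose_size[of 1] by auto
    then show ?thesis using C[of 0 e] by simp
  qed
  define V where "V = integral\<^sup>L lborel (indicator (ball (0::'a) 1) :: 'a \<Rightarrow> real)"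
  have V: "0 \<le> V" unfolding V_def by (intro Bochner_Integration.integral_nonneg) auto
  have iV: "integrable lborel (indicator (ball 0 1) :: 'a \<Rightarrow> real)"
    by (intro integrable_real_indicator emeasure_lborel_ball_finite) auto
  define K1 where "K1 = (C * integral\<^sup>L lborel near + 4 * integral\<^sup>L lborel far) * (1 + 2 powr p)"
  define K2 where "K2 = 2 * 2 powr p * (2 * V)"
  have I0: "0 \<le> integral\<^sup>L lborel near" "0 \<le> integral\<^sup>L lborel far"
    using nn by (auto intro!: Bochner_Integration.integral_nonneg)
  have K1: "0 \<le> K1" unfolding K1_def using I0 C0 by (intro mult_nonneg_nonneg add_nonneg_nonneg) auto
  have K2: "0 \<le> K2" unfolding K2_def using V by simp
  have main: "\<exists>G. integrable lborel G \<and> (\<forall>y. \<bar>sdiff b x y\<bar> * riesz \<alpha> y \<le> G y) \<and> integral\<^sup>L lborel G \<le> max K1 K2 * tail_weight \<alpha> x" for x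
  proof (cases "norm x \<le> 2")
    case True
    have le: "\<bar>sdiff b x y\<bar> * riesz \<alpha> y \<le> C * near y + 4 * far y" for y
    proof (cases "norm y < 1")
      case y: True
      have "\<bar>sdiff b x y\<bar> * riesz \<alpha> y \<le> (C * norm y ^ 2) * riesz \<alpha> y"
        using C[OF True] by (intro mult_right_mono) auto
      also have "\<dots> = C * near y"
      proof (cases "y = 0")
        case False
        then have "norm y powr 2 * norm y powr - (real DIM('a) + \<alpha>) = norm y powr (2 - \<alpha> - real DIM('a))"
          by (simp only: powr_add[symmetric]) (simp add: algebra_simps)
        moreover have sq: "norm y ^ 2 = norm y powr 2" using False by simp
        ultimately have "norm y ^ 2 * riesz \<alpha> y = norm y powr (2 - \<alpha> - real DIM('a))"
          unfolding riesz_def sq by simp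
        moreover have "near y = norm y powr (2 - \<alpha> - real DIM('a))" using y by (simp add: near_def)
        ultimately show ?thesis by simp
      qed (simp add: near_def)
      finally show ?thesis using nn(2)[of y] by linarith
    next
      case y: False
      have "\<bar>sdiff b x y\<bar> \<le> 4" unfolding sdiff_def using b(2)[of x] b(2)[of "x+y"] b(2)[of "x-y"] by linarith
      then have "\<bar>sdiff b x y\<bar> * riesz \<alpha> y \<le> 4 * riesz \<alpha> y" by (intro mult_right_mono) auto
      also have "\<dots> = 4 * far y" using y by (simp add: far_def riesz_def)
      finally show ?thesis using mult_nonneg_nonneg[OF C0 nn(1)[of y]] by linarith
    qed
    have "norm x powr p \<le> 2 powr p" using p True by (intro powr_mono2) auto
    then have "1 / (1 + 2 powr p) \<le> tail_weight \<alpha> x"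
      unfolding tail_weight_def p_def[symmetric] by (intro divide_left_mono mult_pos_pos) (auto simp: add_pos_nonneg)
    then have "1 \<le> (1 + 2 powr p) * tail_weight \<alpha> x" by (simp add: divide_le_eq add_pos_nonneg mult.commute)
    then have "(C * integral\<^sup>L lborel near + 4 * integral\<^sup>L lborel far) * 1 \<le> (C * integral\<^sup>L lborel near + 4 * integral\<^sup>L lborel far) * ((1 + 2 powr p) * tail_weight \<alpha> x)"
      using I0 C0 by (intro mult_left_mono add_nonneg_nonneg mult_nonneg_nonneg) auto
    also have "\<dots> = K1 * tail_weight \<alpha> x" by (simp add: K1_def)
    also have "\<dots> \<le> max K1 K2 * tail_weight \<alpha> x" by (intro mult_right_mono) auto
    finally show ?thesis using le near far
      by (intro exI[of _ "\<lambda>y. C * near y + 4 * far y"]) auto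
  next
    case False
    let ?G = "\<lambda>y. 2 * 2 powr p * tail_weight \<alpha> x * (indicator (ball 0 1) (x + y) + indicator (ball 0 1) (x - y))"
    have bx: "b x = 0" using False b(1) by auto
    \<comment> \<open>Here |x| > 2, so |y| \<ge> |x| - 1 \<ge> |x| / 2. The extra factor 2 comes
      from 1 \<le> |x|^p.\<close>
    have r: "riesz \<alpha> y \<le> 2 * 2 powr p * tail_weight \<alpha> x" if "norm x \<le> norm y + 1" for y :: 'a
    proof -
      have "norm x / 2 \<le> norm y" using that False by linarith
      then have "riesz \<alpha> y \<le> 1 / (norm x / 2) powr p"
        unfolding riesz_eq p_def[symmetric] using p False by (intro divide_left_mono powr_mono2 mult_pos_pos) auto
      also have "\<dots> = 2 powr p * (1 / norm x powr p)" using False by (simp add: powr_divide)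
      also have "1 / norm x powr p \<le> 2 / (1 + norm x powr p)"
      proof -
        have "1 \<le> norm x powr p" using p False by (intro ge_one_powr_ge_zero) auto
        then show ?thesis by (simp add: divide_simps add_pos_nonneg)
      qed
      finally show ?thesis by (simp add: tail_weight_def p_def mult_ac)
    qed
    have le: "\<bar>sdiff b x y\<bar> * riesz \<alpha> y \<le> ?G y" for y
    proof -
      have t: "\<bar>b z\<bar> * riesz \<alpha> y \<le> 2 * 2 powr p * tail_weight \<alpha> x * indicator (ball 0 1) z" if "norm x \<le> norm y + norm z" for z
      proof (cases "norm z < 1")
        case True
        then have "\<bar>b z\<bar> * riesz \<alpha> y \<le> 1 * (2 * 2 powr p * tail_weight \<alpha> x)"
          using b(2)[of z] r[of y] that by (intro mult_mono) auto
        then show ?thesis using True by simp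
      qed (use b(1)[of z] in simp)
      have "\<bar>sdiff b x y\<bar> * riesz \<alpha> y \<le> (\<bar>b (x + y)\<bar> + \<bar>b (x - y)\<bar>) * riesz \<alpha> y"
        unfolding sdiff_def bx by (intro mult_right_mono) auto
      also have "\<dots> \<le> ?G y"
        using t[of "x + y"] t[of "x - y"] norm_triangle_ineq4[of "x + y" y] norm_triangle_ineq[of "x - y" y]
        by (simp add: distrib_right distrib_left add.commute)
      finally show ?thesis .
    qed
    have i1: "integrable lborel (\<lambda>y. indicator (ball 0 1) (x + y) :: real)" "integrable lborel (\<lambda>y. indicator (ball 0 1) (x - y) :: real)"
      using lborel_integrable_translate[OF iV] by auto
    have "integral\<^sup>L lborel ?G = 2 * 2 powr p * tail_weight \<alpha> x * (V + V)"
      using i1 lborel_integral_translate(2,3)[OF borel_measurable_integrable[OF iV, simplified], of x] unfolding V_def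
      by simp
    also have "\<dots> = K2 * tail_weight \<alpha> x" by (simp add: K2_def)
    also have "\<dots> \<le> max K1 K2 * tail_weight \<alpha> x" by (intro mult_right_mono) auto
    finally show ?thesis using le i1 by (intro exI[of _ ?G]) auto
  qed
  show ?thesis
  proof (intro exI[of _ "max K1 K2"] conjI allI)
    show "0 \<le> max K1 K2" using K1 by simp
    fix x
    obtain G where G: "integrable lborel G" "\<And>y. \<bar>sdiff b x y\<bar> * riesz \<alpha> y \<le> G y" "integral\<^sup>L lborel G \<le> max K1 K2 * tail_weight \<alpha> x"
      using main[of x] by blast
    have [measurable]: "sdiff b x \<in> borel_measurable borel" unfolding sdiff_def by measurable
    show i: "integrable lborel (\<lambda>y. \<bar>sdiff b x y\<bar> * riesz \<alpha> y)"
      by (rule integrable_dominated[OF G(1)]) (use G(2) in \<open>auto simp: abs_mult\<close>)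
    have "(\<integral>y. \<bar>sdiff b x y\<bar> * riesz \<alpha> y \<partial>lborel) \<le> integral\<^sup>L lborel G"
      using G i by (intro integral_mono) auto
    then show "(\<integral>y. \<bar>sdiff b x y\<bar> * riesz \<alpha> y \<partial>lborel) \<le> max K1 K2 * tail_weight \<alpha> x" using G(3) by simp
  qed
qed

context frac_admissible
begin

text \<open>Uniformity over the unit ball, which carries the bump, is what the integrability
  condition of Fubini's theorem asks for in the duality argument. Near 0 the local second order
  bound is used; far away the three terms of the second difference are bounded one by one.\<close>

lemma sdiff_L1_bound:
  "\<exists>K. \<forall>x. norm x \<le> 1 \<longrightarrow> (\<integral>y. \<bar>sdiff u x y\<bar> * riesz \<alpha> y \<partial>lborel) \<le> K"
proof -
  define p where "p = real DIM('a) + \<alpha>"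
  \<comment> \<open>The constant of \<open>riesz_le_tail_weight\<close> for \<open>e = 1\<close> and
    \<open>r = 1\<close>.\<close>
  define c where "c = 1 + 2 powr p"
  have c: "0 \<le> c" by (simp add: c_def)
  define near where "near y = indicator (ball 0 1) y * norm y powr (\<sigma> - \<alpha> - real DIM('a))" for y :: 'a
  define far where "far y = indicator (- ball 0 1) y * norm y powr - (real DIM('a) + \<alpha>)" for y :: 'a
  have near: "integrable lborel near"
    unfolding near_def by (rule integrable_near)
  have far: "integrable lborel far"
    unfolding far_def using integrable_norm_powr_outside[of \<alpha>, where 'a='a] \<alpha> by simp
  have nn: "0 \<le> near y" "0 \<le> far y" for y by (auto simp: near_def far_def)
  obtain C where C: "0 \<le> C" "\<And>x y. norm x \<le> 1 \<Longrightarrow> norm y < 1 \<Longrightarrow> \<bar>sdiff u x y\<bar> * riesz \<alpha> y \<le> C * near y"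
    using near_bound[of 1] unfolding near_def by metis
  obtain M where M0: "0 \<le> M" and M: "\<And>x. norm x \<le> 1 \<Longrightarrow> \<bar>u x\<bar> \<le> M"
    using continuous_bounded_cball[OF cont, of 0 1] by auto
  let ?G = "\<lambda>x y. C * near y + 2 * M * far y + c * (\<bar>u (x + y)\<bar> * tail_weight \<alpha> (x + y)) + c * (\<bar>u (x - y)\<bar> * tail_weight \<alpha> (x - y))"
  have le: "\<bar>sdiff u x y\<bar> * riesz \<alpha> y \<le> ?G x y" if x: "norm x \<le> 1" for x y
  proof (cases "norm y < 1")
    case True
    have "0 \<le> 2 * M * far y + c * (\<bar>u (x + y)\<bar> * tail_weight \<alpha> (x + y)) + c * (\<bar>u (x - y)\<bar> * tail_weight \<alpha> (x - y))"
      using M0 c nn by (intro add_nonneg_nonneg mult_nonneg_nonneg) auto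
    then show ?thesis using C(2)[OF x True] by linarith
  next
    case False
    have r: "riesz \<alpha> y \<le> c * tail_weight \<alpha> (x + z)" if "norm z = norm y" for z
      using riesz_le_tail_weight[of \<alpha> 1 z x 1] False x \<alpha> that by (simp add: c_def p_def riesz_def)
    have f: "riesz \<alpha> y = far y" using False by (simp add: far_def riesz_def)
    have "\<bar>sdiff u x y\<bar> * riesz \<alpha> y \<le> (2 * \<bar>u x\<bar> + \<bar>u (x + y)\<bar> + \<bar>u (x - y)\<bar>) * riesz \<alpha> y"
      unfolding sdiff_def by (intro mult_right_mono) auto
    also have "\<dots> = 2 * \<bar>u x\<bar> * riesz \<alpha> y + \<bar>u (x + y)\<bar> * riesz \<alpha> y + \<bar>u (x - y)\<bar> * riesz \<alpha> y"
      by (simp add: algebra_simps)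
    also have "\<dots> \<le> 2 * M * riesz \<alpha> y + \<bar>u (x + y)\<bar> * (c * tail_weight \<alpha> (x + y)) + \<bar>u (x - y)\<bar> * (c * tail_weight \<alpha> (x - y))"
      using M[OF x] r[of y] r[of "-y"] by (intro add_mono mult_left_mono mult_right_mono) auto
    finally show ?thesis using f mult_nonneg_nonneg[OF C(1) nn(1)[of y]] by (simp add: mult_ac)
  qed
  show ?thesis
  proof (intro exI allI impI)
    fix x :: 'a assume x: "norm x \<le> 1"
    have i: "integrable lborel (\<lambda>y. \<bar>u (x + y)\<bar> * tail_weight \<alpha> (x + y))" "integrable lborel (\<lambda>y. \<bar>u (x - y)\<bar> * tail_weight \<alpha> (x - y))"
      using lborel_integrable_translate[OF L] by auto
    have j: "(\<integral>y. \<bar>u (x + y)\<bar> * tail_weight \<alpha> (x + y) \<partial>lborel) = (\<integral>y. \<bar>u y\<bar> * tail_weight \<alpha> y \<partial>lborel)"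
      "(\<integral>y. \<bar>u (x - y)\<bar> * tail_weight \<alpha> (x - y) \<partial>lborel) = (\<integral>y. \<bar>u y\<bar> * tail_weight \<alpha> y \<partial>lborel)"
      using lborel_integral_translate(2,3)[of "\<lambda>y. \<bar>u y\<bar> * tail_weight \<alpha> y" x] by auto
    have "(\<integral>y. \<bar>sdiff u x y\<bar> * riesz \<alpha> y \<partial>lborel) \<le> integral\<^sup>L lborel (?G x)"
    proof (rule integral_mono)
      show "integrable lborel (\<lambda>y. \<bar>sdiff u x y\<bar> * riesz \<alpha> y)"
        using integrable_abs[OF integrable_sdiff[of x]] by (simp add: abs_mult)
    qed (use le[OF x] near far i in auto)
    also have "\<dots> = C * integral\<^sup>L lborel near + 2 * M * integral\<^sup>L lborel far 
        + c * (\<integral>y. \<bar>u y\<bar> * tail_weight \<alpha> y \<partial>lborel) + c * (\<integral>y. \<bar>u y\<bar> * tail_weight \<alpha> y \<partial>lborel)"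
      using near far i j by simp
    finally show "(\<integral>y. \<bar>sdiff u x y\<bar> * riesz \<alpha> y \<partial>lborel) \<le> \<dots>" .
  qed
qed

text \<open>For each fixed \<open>y\<close> the second difference moves from \<open>u\<close> to
  \<open>b\<close> by translation invariance in \<open>x\<close>; Fubini then moves the whole
  operator. The two exchanges of integrals have separate majorants: \<open>F\<close> rests on the
  compact support of \<open>b\<close>, \<open>G\<close> on the decay of the operator applied to
  \<open>b\<close>.\<close>

lemma sym_frac_lap_bump_weak:
  assumes n: "2 \<le> real DIM('a) + \<alpha>" and [measurable]: "b \<in> borel_measurable borel"
    and b: "\<And>x. 1 \<le> norm x \<Longrightarrow> b x = 0" "\<And>x. \<bar>b x\<bar> \<le> 1"
    and K: "0 \<le> K" "\<And>x. integrable lborel (\<lambda>y. \<bar>sdiff b x y\<bar> * riesz \<alpha> y)"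
     "\<And>x. (\<integral>y. \<bar>sdiff b x y\<bar> * riesz \<alpha> y \<partial>lborel) \<le> K * tail_weight \<alpha> x"
  shows "\<bar>\<integral>x. sym_frac_lap \<alpha> u x * b x \<partial>lborel\<bar> \<le> K * (\<integral>x. \<bar>u x\<bar> * tail_weight \<alpha> x \<partial>lborel)"
proof -
  have ms[measurable]: "(\<lambda>p. sdiff u (fst p) (snd p)) \<in> borel_measurable (lborel \<Otimes>\<^sub>M lborel)"
    "(\<lambda>p. sdiff b (fst p) (snd p)) \<in> borel_measurable (lborel \<Otimes>\<^sub>M lborel)"
    unfolding sdiff_def by measurable
  have [measurable]: "sdiff b x \<in> borel_measurable borel" for x
    unfolding sdiff_def by measurable
  obtain N where N: "\<And>x. norm x \<le> 1 \<Longrightarrow> (\<integral>y. \<bar>sdiff u x y\<bar> * riesz \<alpha> y \<partial>lborel) \<le> N"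
    using sdiff_L1_bound by blast
  have nn: "0 \<le> (\<integral>y. \<bar>sdiff u x y\<bar> * riesz \<alpha> y \<partial>lborel)" "0 \<le> (\<integral>y. \<bar>sdiff b x y\<bar> * riesz \<alpha> y \<partial>lborel)" for x
    by (intro Bochner_Integration.integral_nonneg; simp)+
  have N0: "0 \<le> N" using order_trans[OF nn(1)[of 0] N[of 0]] by simp
  have F: "integrable (lborel \<Otimes>\<^sub>M lborel) (\<lambda>p. sdiff u (fst p) (snd p) * riesz \<alpha> (snd p) * b (fst p))"
  proof (rule lborel_pair.Fubini_integrable)
    show "integrable lborel (\<lambda>x. \<integral>y. norm (sdiff u (fst (x, y)) (snd (x, y)) * riesz \<alpha> (snd (x, y)) * b (fst (x, y))) \<partial>lborel)"
    proof (rule Bochner_Integration.integrable_bound)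
      show "integrable lborel (\<lambda>x::'a. N * indicator (ball 0 1) x)"
        by (intro integrable_mult_right integrable_real_indicator emeasure_lborel_ball_finite) auto
      have "\<bar>\<integral>y. norm (sdiff u x y * riesz \<alpha> y * b x) \<partial>lborel\<bar> \<le> \<bar>N * indicator (ball 0 1) x\<bar>" for x
      proof (cases "norm x < 1")
        case True
        have "\<bar>\<integral>y. norm (sdiff u x y * riesz \<alpha> y * b x) \<partial>lborel\<bar> = (\<integral>y. \<bar>sdiff u x y\<bar> * riesz \<alpha> y \<partial>lborel) * \<bar>b x\<bar>"
          using nn(1)[of x] by (simp add: abs_mult)
        also have "\<dots> \<le> N * 1"
          using N[of x] True b(2)[of x] nn(1)[of x] N0 by (intro mult_mono) auto
        finally show ?thesis using True N0 by simp
      qed (use b(1)[of x] in simp)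
      then show "AE x in lborel. norm (\<integral>y. norm (sdiff u (fst (x, y)) (snd (x, y)) * riesz \<alpha> (snd (x, y)) * b (fst (x, y))) \<partial>lborel)
          \<le> norm (N * indicator (ball 0 1) x)"
        by (intro AE_I2) simp
    qed measurable
  qed (use integrable_sdiff in \<open>auto intro!: AE_I2 integrable_mult_left\<close>)
  have G: "integrable (lborel \<Otimes>\<^sub>M lborel) (\<lambda>p. u (fst p) * (sdiff b (fst p) (snd p) * riesz \<alpha> (snd p)))"
  proof (rule lborel_pair.Fubini_integrable)
    show "integrable lborel (\<lambda>x. \<integral>y. norm (u (fst (x, y)) * (sdiff b (fst (x, y)) (snd (x, y)) * riesz \<alpha> (snd (x, y)))) \<partial>lborel)"
    proof (rule Bochner_Integration.integrable_bound)
      show "integrable lborel (\<lambda>x::'a. K * (\<bar>u x\<bar> * tail_weight \<alpha> x))"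
        using L by simp
      have "\<bar>\<integral>y. norm (u x * (sdiff b x y * riesz \<alpha> y)) \<partial>lborel\<bar> \<le> \<bar>K * (\<bar>u x\<bar> * tail_weight \<alpha> x)\<bar>" for x
      proof -
        have "\<bar>\<integral>y. norm (u x * (sdiff b x y * riesz \<alpha> y)) \<partial>lborel\<bar> = \<bar>u x\<bar> * (\<integral>y. \<bar>sdiff b x y\<bar> * riesz \<alpha> y \<partial>lborel)"
          using nn(2)[of x] by (simp add: abs_mult)
        also have "\<dots> \<le> \<bar>u x\<bar> * (K * tail_weight \<alpha> x)"
          using K(3)[of x] by (intro mult_left_mono) auto
        finally show ?thesis using K(1) by (simp add: abs_mult mult_ac)
      qed
      then show "AE x in lborel. norm (\<integral>y. norm (u (fst (x, y)) * (sdiff b (fst (x, y)) (snd (x, y)) * riesz \<alpha> (snd (x, y)))) \<partial>lborel)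
          \<le> norm (K * (\<bar>u x\<bar> * tail_weight \<alpha> x))"
        by (intro AE_I2) simp
    qed measurable
    have "integrable lborel (\<lambda>y. sdiff b x y * riesz \<alpha> y)" for x
      by (rule Bochner_Integration.integrable_bound[OF K(2)[of x]]) (auto simp: abs_mult)
    then show "AE x in lborel. integrable lborel (\<lambda>y. u (fst (x, y)) * (sdiff b (fst (x, y)) (snd (x, y)) * riesz \<alpha> (snd (x, y))))"
      by simp
  qed measurable
  have sw: "(\<integral>x. sdiff u x y * riesz \<alpha> y * b x \<partial>lborel) = (\<integral>x. u x * (sdiff b x y * riesz \<alpha> y) \<partial>lborel)" for y
  proof -
    have A: "integrable lborel (\<lambda>x. u x * b x)"
      by (rule integrable_continuous_bump[OF cont _ b]) auto
    have B: "integrable lborel (\<lambda>x. u (x + z) * b x)" for z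
      by (rule integrable_continuous_bump[OF _ _ b]) (auto intro!: continuous_on_compose2[OF cont] continuous_intros)
    have B': "integrable lborel (\<lambda>x. u x * b (x - z))" for z
      using lborel_integrable_translate(5)[OF B[of z], of z] by simp
    have E: "(\<integral>x. u (x + z) * b x \<partial>lborel) = (\<integral>x. u x * b (x - z) \<partial>lborel)" for z
      using lborel_integral_translate(5)[of "\<lambda>x. u (x + z) * b x" z] by simp
    have "(\<integral>x. sdiff u x y * riesz \<alpha> y * b x \<partial>lborel) = riesz \<alpha> y * (\<integral>x. 2 * (u x * b x) - u (x + y) * b x - u (x + -y) * b x \<partial>lborel)"
      unfolding sdiff_def by (subst integral_mult_right_zero[symmetric], intro Bochner_Integration.integral_cong) (auto simp: algebra_simps)
    also have "(\<integral>x. 2 * (u x * b x) - u (x + y) * b x - u (x + -y) * b x \<partial>lborel) = 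
       2 * (\<integral>x. u x * b x \<partial>lborel) - (\<integral>x. u x * b (x - y) \<partial>lborel) - (\<integral>x. u x * b (x - -y) \<partial>lborel)"
      using A B[of y] B[of "-y"] E[of y] E[of "-y"] by simp
    also have "\<dots> = (\<integral>x. 2 * (u x * b x) - u x * b (x - y) - u x * b (x - -y) \<partial>lborel)"
      using A B'[of y] B'[of "-y"] by simp
    also have "riesz \<alpha> y * \<dots> = (\<integral>x. u x * (sdiff b x y * riesz \<alpha> y) \<partial>lborel)"
      unfolding sdiff_def by (subst integral_mult_right_zero[symmetric], intro Bochner_Integration.integral_cong) (auto simp: algebra_simps)
    finally show ?thesis .
  qed
  have "(\<integral>x. sym_frac_lap \<alpha> u x * b x \<partial>lborel) = (\<integral>x. \<integral>y. sdiff u x y * riesz \<alpha> y * b x \<partial>lborel \<partial>lborel)"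
    by (simp add: sym_frac_lap_def)
  also have "\<dots> = (\<integral>y. \<integral>x. sdiff u x y * riesz \<alpha> y * b x \<partial>lborel \<partial>lborel)"
    by (rule lborel_pair.Fubini_integral[symmetric]) (use F in \<open>simp add: case_prod_beta'\<close>)
  also have "\<dots> = (\<integral>y. \<integral>x. u x * (sdiff b x y * riesz \<alpha> y) \<partial>lborel \<partial>lborel)"
    by (simp only: sw)
  also have "\<dots> = (\<integral>x. \<integral>y. u x * (sdiff b x y * riesz \<alpha> y) \<partial>lborel \<partial>lborel)"
    by (rule lborel_pair.Fubini_integral) (use G in \<open>simp add: case_prod_beta'\<close>)
  finally have eq: "(\<integral>x. sym_frac_lap \<alpha> u x * b x \<partial>lborel) = (\<integral>x. u x * sym_frac_lap \<alpha> b x \<partial>lborel)"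
    by (simp add: sym_frac_lap_def)
  have "\<bar>\<integral>x. u x * sym_frac_lap \<alpha> b x \<partial>lborel\<bar> \<le> (\<integral>x. K * (\<bar>u x\<bar> * tail_weight \<alpha> x) \<partial>lborel)"
  proof (rule order_trans[OF integral_abs_bound integral_mono'])
    show "integrable lborel (\<lambda>x. K * (\<bar>u x\<bar> * tail_weight \<alpha> x))" using L by simp
    fix x
    have "\<bar>sym_frac_lap \<alpha> b x\<bar> \<le> (\<integral>y. \<bar>sdiff b x y * riesz \<alpha> y\<bar> \<partial>lborel)"
      unfolding sym_frac_lap_def by (rule integral_abs_bound)
    also have "\<dots> \<le> K * tail_weight \<alpha> x" using K(3)[of x] by (simp add: abs_mult)
    finally have "\<bar>u x\<bar> * \<bar>sym_frac_lap \<alpha> b x\<bar> \<le> \<bar>u x\<bar> * (K * tail_weight \<alpha> x)" by (rule mult_left_mono) simp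
    then show "\<bar>u x * sym_frac_lap \<alpha> b x\<bar> \<le> K * (\<bar>u x\<bar> * tail_weight \<alpha> x)" by (simp add: abs_mult mult_ac)
  qed (simp add: K(1))
  then show ?thesis using eq by simp
qed

end

section \<open>Scaling and averages at large scale\<close>

lemma tail_weight_scale_le:
  fixes x0 :: "'a::euclidean_space"
  assumes "0 < \<alpha>" "0 < R"
  shows "\<exists>C>0. \<forall>z. tail_weight \<alpha> ((z - x0) /\<^sub>R R) \<le> C * tail_weight \<alpha> z"
proof -
  define p where "p = real DIM('a) + \<alpha>"
  have p: "0 < p" using assms by (simp add: p_def add_nonneg_pos)
  obtain C where C: "C > 0" "\<And>z. tail_weight \<alpha> (z - x0) \<le> C * tail_weight \<alpha> z"
    using tail_weight_translate_le[OF assms(1), of "norm x0"] by blast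
  define D where "D = 1 + R powr p"
  have D: "0 < D" by (simp add: D_def add_pos_nonneg)
  have "tail_weight \<alpha> (w /\<^sub>R R) \<le> D * tail_weight \<alpha> w" for w :: 'a
  proof -
    have "1 + norm w powr p \<le> D * (1 + norm (w /\<^sub>R R) powr p)"
    proof -
      have "R powr p * norm (w /\<^sub>R R) powr p = norm w powr p"
        using \<open>0 < R\<close> by (simp add: mult.assoc[symmetric] flip: powr_mult)
      moreover have "0 \<le> R powr p" "0 \<le> norm (w /\<^sub>R R) powr p" by auto
      ultimately show ?thesis unfolding D_def distrib_left distrib_right by linarith
    qed
    then show ?thesis
      unfolding tail_weight_def p_def[symmetric]
      by (simp add: divide_simps add_pos_nonneg mult.commute split: if_splits)
  qed
  then have "tail_weight \<alpha> ((z - x0) /\<^sub>R R) \<le> (D * C) * tail_weight \<alpha> z" for z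
    using mult_left_mono[OF C(2)[of z], of D] D order_trans unfolding mult.assoc by (meson less_imp_le)
  then show ?thesis using C(1) D by (intro exI[of _ "D * C"]) auto
qed

context frac_admissible
begin

lemma rescale:
  assumes "0 < R"
  shows "frac_admissible \<alpha> \<sigma> (\<lambda>x. u (x0 + R *\<^sub>R x))"
proof
  show "continuous_on UNIV (\<lambda>x. u (x0 + R *\<^sub>R x))"
    by (intro continuous_on_compose2[OF cont] continuous_intros) auto
  fix r
  obtain C where C: "\<And>x y. norm x \<le> norm x0 + R * \<bar>r\<bar> \<Longrightarrow> norm y \<le> norm x0 + R * \<bar>r\<bar> \<Longrightarrow> \<bar>sdiff u x y\<bar> \<le> C * norm y powr \<sigma>"
    using sd by meson
  show "\<exists>C. \<forall>x y. norm x \<le> r \<longrightarrow> norm y \<le> r \<longrightarrow> \<bar>sdiff (\<lambda>x. u (x0 + R *\<^sub>R x)) x y\<bar> \<le> C * norm y powr \<sigma>"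
  proof (intro exI[of _ "C * R powr \<sigma>"] allI impI)
    fix x y :: 'a assume "norm x \<le> r" "norm y \<le> r"
    then have *: "norm (R *\<^sub>R x) \<le> R * \<bar>r\<bar>" "norm (R *\<^sub>R y) \<le> R * \<bar>r\<bar>" using assms by auto
    then have "norm (x0 + R *\<^sub>R x) \<le> norm x0 + R * \<bar>r\<bar>"
      using norm_triangle_ineq[of x0 "R *\<^sub>R x"] by linarith
    then have "\<bar>sdiff u (x0 + R *\<^sub>R x) (R *\<^sub>R y)\<bar> \<le> C * norm (R *\<^sub>R y) powr \<sigma>"
      using * by (intro C) (auto simp: add_increasing)
    then show "\<bar>sdiff (\<lambda>x. u (x0 + R *\<^sub>R x)) x y\<bar> \<le> C * R powr \<sigma> * norm y powr \<sigma>"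
      using assms by (simp add: sdiff_def scaleR_add_right scaleR_diff_right powr_mult add.assoc diff_add_eq add_diff_eq)
  qed
next
  obtain C where C: "C > 0" "\<And>z. tail_weight \<alpha> ((z - x0) /\<^sub>R R) \<le> C * tail_weight \<alpha> z"
    using tail_weight_scale_le[OF \<alpha>(1) assms] by blast
  have "integrable lborel (\<lambda>z. \<bar>u z\<bar> * tail_weight \<alpha> ((z - x0) /\<^sub>R R))"
  proof (rule Bochner_Integration.integrable_bound)
    show "integrable lborel (\<lambda>z. C * (\<bar>u z\<bar> * tail_weight \<alpha> z))" using L by simp
    have "\<bar>u z\<bar> * tail_weight \<alpha> ((z - x0) /\<^sub>R R) \<le> C * (\<bar>u z\<bar> * tail_weight \<alpha> z)" for z
      using mult_left_mono[OF C(2)[of z], of "\<bar>u z\<bar>"] by (simp add: mult_ac)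
    then show "AE z in lborel. norm (\<bar>u z\<bar> * tail_weight \<alpha> ((z - x0) /\<^sub>R R)) \<le> norm (C * (\<bar>u z\<bar> * tail_weight \<alpha> z))"
      using C(1) by (intro AE_I2) (simp add: abs_mult)
  qed measurable
  from lborel_integrable_affine[OF this, of R x0] assms
  show "integrable lborel (\<lambda>x. \<bar>u (x0 + R *\<^sub>R x)\<bar> * tail_weight \<alpha> x)" by simp
qed (use \<alpha> \<sigma> in auto)

text \<open>Substituting R y for y, the volume element contributes R^n and the kernel R^(-(n +
  \<alpha>)).\<close>

lemma sym_frac_lap_rescale:
  assumes "0 < R"
  shows "sym_frac_lap \<alpha> (\<lambda>x. u (x0 + R *\<^sub>R x)) x = R powr \<alpha> * sym_frac_lap \<alpha> u (x0 + R *\<^sub>R x)"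
proof -
  have "sym_frac_lap \<alpha> u (x0 + R *\<^sub>R x) = R ^ DIM('a) * (\<integral>y. sdiff u (x0 + R *\<^sub>R x) (0 + R *\<^sub>R y) * riesz \<alpha> (0 + R *\<^sub>R y :: 'a) \<partial>lborel)"
    unfolding sym_frac_lap_def using assms by (subst lborel_integral_affine[of _ R 0]) auto
  also have "(\<lambda>y. sdiff u (x0 + R *\<^sub>R x) (0 + R *\<^sub>R y) * riesz \<alpha> (0 + R *\<^sub>R y :: 'a)) =
     (\<lambda>y. R powr - (real DIM('a) + \<alpha>) * (sdiff (\<lambda>x. u (x0 + R *\<^sub>R x)) x y * riesz \<alpha> y))"
    using assms by (auto simp: sdiff_def riesz_def scaleR_add_right scaleR_diff_right powr_mult add.assoc diff_add_eq add_diff_eq simp del: minus_add_distrib)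
  also have "R ^ DIM('a) * (\<integral>y. R powr - (real DIM('a) + \<alpha>) * (sdiff (\<lambda>x. u (x0 + R *\<^sub>R x)) x y * riesz \<alpha> y) \<partial>lborel)
     = (R ^ DIM('a) * R powr - (real DIM('a) + \<alpha>)) * sym_frac_lap \<alpha> (\<lambda>x. u (x0 + R *\<^sub>R x)) x"
    by (simp add: sym_frac_lap_def)
  also have "R ^ DIM('a) * R powr - (real DIM('a) + \<alpha>) = R powr - \<alpha>"
    using assms by (simp add: powr_add[symmetric] powr_realpow[symmetric])
  finally show ?thesis using assms by (simp add: powr_minus field_simps)
qed

text \<open>The duality bound is applied to the rescaled function. The factor R^\<alpha> of the
  operator reappears on the right when the weighted norm is carried back to the original variable,
  and cancels. The remaining integrand tends to 0 pointwise and, for R \<ge> 1, is dominated by a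
  multiple of |u| times the weight.\<close>

lemma sym_frac_lap_average_tendsto_0:
  assumes n: "2 \<le> real DIM('a) + \<alpha>" and [measurable]: "b \<in> borel_measurable borel"
    and b: "\<And>x. 1 \<le> norm x \<Longrightarrow> b x = 0" "\<And>x. \<bar>b x\<bar> \<le> 1"
    and C: "\<And>x y. norm x \<le> 2 \<Longrightarrow> \<bar>sdiff b x y\<bar> \<le> C * norm y ^ 2"
  shows "((\<lambda>R. \<integral>x. sym_frac_lap \<alpha> u (x0 + R *\<^sub>R x) * b x \<partial>lborel) \<longlongrightarrow> 0) at_top"
proof -
  define p where "p = real DIM('a) + \<alpha>"
  have p: "0 < p" using \<alpha> by (simp add: p_def add_nonneg_pos)
  obtain K where K: "0 \<le> K" "\<And>x. integrable lborel (\<lambda>y. \<bar>sdiff b x y\<bar> * riesz \<alpha> y)"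
     "\<And>x. (\<integral>y. \<bar>sdiff b x y\<bar> * riesz \<alpha> y \<partial>lborel) \<le> K * tail_weight \<alpha> x"
    using sdiff_bump_integral_bound[OF \<alpha> n assms(2) b C] by blast
  \<comment> \<open>|u z| times the weight of (z - x0) / R, multiplied by R^(-p).\<close>
  define h where "h R z = \<bar>u z\<bar> * (1 / (R powr p + norm (z - x0) powr p))" for R z
  have [measurable]: "h R \<in> borel_measurable borel" for R unfolding h_def by measurable
  have bd: "\<bar>\<integral>x. sym_frac_lap \<alpha> u (x0 + R *\<^sub>R x) * b x \<partial>lborel\<bar> \<le> K * (\<integral>z. h R z \<partial>lborel)" if "0 < R" for R
  proof -
    interpret R: frac_admissible \<alpha> \<sigma> "\<lambda>x. u (x0 + R *\<^sub>R x)" by (rule rescale[OF that])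
    have "R powr \<alpha> * \<bar>\<integral>x. sym_frac_lap \<alpha> u (x0 + R *\<^sub>R x) * b x \<partial>lborel\<bar> = \<bar>\<integral>x. R powr \<alpha> * (sym_frac_lap \<alpha> u (x0 + R *\<^sub>R x) * b x) \<partial>lborel\<bar>"
      by (simp add: abs_mult)
    also have "\<dots> \<le> K * (\<integral>x. \<bar>u (x0 + R *\<^sub>R x)\<bar> * tail_weight \<alpha> x \<partial>lborel)"
      using R.sym_frac_lap_bump_weak[OF n assms(2) b K] by (simp add: sym_frac_lap_rescale[OF that] mult.assoc)
    also have "(\<integral>x. \<bar>u (x0 + R *\<^sub>R x)\<bar> * tail_weight \<alpha> x \<partial>lborel) = R powr \<alpha> * (\<integral>z. h R z \<partial>lborel)"
    proof -
      have "(\<integral>z. h R z \<partial>lborel) = R ^ DIM('a) * (\<integral>x. h R (x0 + R *\<^sub>R x) \<partial>lborel)"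
        using that by (subst lborel_integral_affine[of _ R x0]) (auto simp: h_def)
      also have "(\<lambda>x. h R (x0 + R *\<^sub>R x)) = (\<lambda>x. R powr - p * (\<bar>u (x0 + R *\<^sub>R x)\<bar> * tail_weight \<alpha> x))"
      proof
        fix x :: 'a
        have "R powr p + norm (R *\<^sub>R x) powr p = R powr p * (1 + norm x powr p)"
          using that by (simp add: powr_mult distrib_left)
        then show "h R (x0 + R *\<^sub>R x) = R powr - p * (\<bar>u (x0 + R *\<^sub>R x)\<bar> * tail_weight \<alpha> x)"
          unfolding h_def tail_weight_def p_def[symmetric] powr_minus by (simp add: divide_simps)
      qed
      also have "R ^ DIM('a) * (\<integral>x. R powr - p * (\<bar>u (x0 + R *\<^sub>R x)\<bar> * tail_weight \<alpha> x) \<partial>lborel) =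
        (R ^ DIM('a) * R powr - p) * (\<integral>x. \<bar>u (x0 + R *\<^sub>R x)\<bar> * tail_weight \<alpha> x \<partial>lborel)" by simp
      also have "R ^ DIM('a) * R powr - p = R powr - \<alpha>"
        using that by (simp add: p_def powr_add[symmetric] powr_realpow[symmetric])
      finally show ?thesis using that by (simp add: powr_minus field_simps)
    qed
    finally have "R powr \<alpha> * \<bar>\<integral>x. sym_frac_lap \<alpha> u (x0 + R *\<^sub>R x) * b x \<partial>lborel\<bar> \<le> R powr \<alpha> * (K * (\<integral>z. h R z \<partial>lborel))"
      by (simp add: mult_ac)
    then show ?thesis using that by simp
  qed
  obtain D where D: "D > 0" "\<And>z. tail_weight \<alpha> (z - x0) \<le> D * tail_weight \<alpha> z"
    using tail_weight_translate_le[OF \<alpha>(1), of "norm x0"] by blast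
  have "((\<lambda>R. \<integral>z. h R z \<partial>lborel) \<longlongrightarrow> (\<integral>(z::'a). 0 \<partial>lborel)) at_top"
  proof (rule integral_dominated_convergence_at_top)
    show "integrable lborel (\<lambda>z. D * (\<bar>u z\<bar> * tail_weight \<alpha> z))" using L by simp
    have "\<bar>h R z\<bar> \<le> D * (\<bar>u z\<bar> * tail_weight \<alpha> z)" if "1 \<le> R" for R z
    proof -
      have "1 \<le> R powr p" using p that by (intro ge_one_powr_ge_zero) auto
      then have "1 / (R powr p + norm (z - x0) powr p) \<le> tail_weight \<alpha> (z - x0)"
        unfolding tail_weight_def p_def[symmetric] by (intro frac_le add_pos_nonneg) auto
      also have "\<dots> \<le> D * tail_weight \<alpha> z" by (rule D)
      finally have "h R z \<le> \<bar>u z\<bar> * (D * tail_weight \<alpha> z)" unfolding h_def by (rule mult_left_mono) simp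
      moreover have "0 \<le> h R z" by (simp add: h_def)
      ultimately show ?thesis by (simp add: mult_ac)
    qed
    then show "\<forall>\<^sub>F R in at_top. AE z in lborel. norm (h R z) \<le> D * (\<bar>u z\<bar> * tail_weight \<alpha> z)"
      by (intro eventually_mono[OF eventually_ge_at_top[of 1]] AE_I2) simp
    have "((\<lambda>R. h R z) \<longlongrightarrow> 0) at_top" for z
    proof -
      have lim: "((\<lambda>R. \<bar>u z\<bar> * R powr - p) \<longlongrightarrow> 0) at_top"
        using p by (intro tendsto_mult_right_zero tendsto_neg_powr filterlim_ident) auto
      have le: "norm (h R z) \<le> \<bar>u z\<bar> * R powr - p" if "1 \<le> R" for R
        using that unfolding h_def powr_minus_divide by (auto simp: abs_mult intro!: mult_left_mono frac_le)
      show ?thesis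
        by (rule Lim_null_comparison[OF eventually_mono[OF eventually_ge_at_top[of 1]] lim]) (rule le)
    qed
    then show "AE z in lborel. ((\<lambda>R. h R z) \<longlongrightarrow> 0) at_top" by simp
  qed (auto simp: h_def)
  then have "((\<lambda>R. K * (\<integral>z. h R z \<partial>lborel)) \<longlongrightarrow> 0) at_top"
    using tendsto_mult_right_zero[of _ at_top K] by simp
  then show ?thesis
    by (rule Lim_null_comparison[rotated])
       (use bd in \<open>auto intro!: eventually_mono[OF eventually_gt_at_top[of 0]]\<close>)
qed

end

section \<open>The logarithm as comparison function\<close>

definition ln_riesz_integral :: "'a::euclidean_space itself \<Rightarrow> real \<Rightarrow> real" where
  "ln_riesz_integral _ \<alpha> = (\<integral>(y::'a). 2 * ln (1 + norm y ^ 2) * riesz \<alpha> y \<partial>lborel)"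

text \<open>Near 0, ln (1 + t) \<le> t supplies the |y|^2 that compensates the kernel; at infinity
  the logarithm is absorbed by |y|^(\<alpha>/2), which uses up half of the decay beyond order
  n.\<close>

lemma integrable_ln_riesz:
  assumes \<alpha>: "0 < \<alpha>" "\<alpha> < 2" "2 \<le> real DIM('a) + \<alpha>"
  shows "integrable lborel (\<lambda>y::'a::euclidean_space. 2 * ln (1 + norm y ^ 2) * riesz \<alpha> y)"
proof -
  define near where "near y = indicator (ball 0 1) y * norm y powr (2 - \<alpha> - real DIM('a))" for y :: 'a
  define far where "far y = indicator (- ball 0 1) y * norm y powr - (real DIM('a) + \<alpha> / 2)" for y :: 'a
  have near: "integrable lborel near"
    unfolding near_def using integrable_norm_powr_inside[of "2 - \<alpha>", where 'a='a] \<alpha> by simp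
  have far: "integrable lborel far"
    unfolding far_def using integrable_norm_powr_outside[of "\<alpha> / 2", where 'a='a] \<alpha> by simp
  have nn: "0 \<le> near y" "0 \<le> far y" for y by (auto simp: near_def far_def)
  have le: "2 * ln (1 + norm y ^ 2) * riesz \<alpha> y \<le> 2 * near y + 2 * (1 + 4 / \<alpha>) * far y" for y :: 'a
  proof (cases "norm y < 1")
    case True
    have "ln (1 + norm y ^ 2) * riesz \<alpha> y \<le> norm y ^ 2 * riesz \<alpha> y"
      by (intro mult_right_mono ln_add_one_self_le_self) auto
    also have "\<dots> = near y"
    proof (cases "y = 0")
      case False
      then have "norm y powr 2 * norm y powr - (real DIM('a) + \<alpha>) = norm y powr (2 - \<alpha> - real DIM('a))"
        by (simp only: powr_add[symmetric]) (simp add: algebra_simps)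
      moreover have sq: "norm y ^ 2 = norm y powr 2" using False by simp
      ultimately have "norm y ^ 2 * riesz \<alpha> y = norm y powr (2 - \<alpha> - real DIM('a))"
        unfolding riesz_def sq by simp
      then show ?thesis using True by (simp add: near_def)
    qed (simp add: near_def)
    finally show ?thesis using mult_nonneg_nonneg[OF _ nn(2)[of y], of "2 * (1 + 4 / \<alpha>)"] \<alpha> by simp
  next
    case False
    have "ln (1 + norm y ^ 2) \<le> ln (2 * norm y ^ 2)" using False by (subst ln_le_cancel_iff) (auto simp: add_pos_nonneg)
    also have "\<dots> = ln 2 + 2 * ln (norm y)" using False by (subst ln_mult) (auto simp: ln_realpow)
    also have "\<dots> \<le> 1 + 2 * (norm y powr (\<alpha> / 2) / (\<alpha> / 2))"
      using False \<alpha> ln_powr_bound[of "norm y" "\<alpha> / 2"] ln_2_less_1 by (intro add_mono mult_left_mono) auto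
    also have "\<dots> \<le> (1 + 4 / \<alpha>) * norm y powr (\<alpha> / 2)"
      using False \<alpha> ge_one_powr_ge_zero[of "norm y" "\<alpha> / 2"] by (simp add: distrib_right)
    finally have "ln (1 + norm y ^ 2) * riesz \<alpha> y \<le> ((1 + 4 / \<alpha>) * norm y powr (\<alpha> / 2)) * riesz \<alpha> y"
      by (rule mult_right_mono) simp
    also have "\<dots> = (1 + 4 / \<alpha>) * far y"
      using False by (simp add: far_def riesz_def powr_add[symmetric] mult.assoc add.commute)
    finally show ?thesis using nn(1)[of y] unfolding mult.assoc by linarith
  qed
  show ?thesis
  proof (rule integrable_dominated)
    show "integrable lborel (\<lambda>y. 2 * near y + 2 * (1 + 4 / \<alpha>) * far y)" using near far by simp
    show "\<bar>2 * ln (1 + norm y ^ 2) * riesz \<alpha> y\<bar> \<le> 2 * near y + 2 * (1 + 4 / \<alpha>) * far y" for y :: 'a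
      using le[of y] by (simp add: abs_mult)
  qed measurable
qed

text \<open>The logarithm depends on |y| / \<rho> only, so substituting \<rho> y for y leaves the
  single factor \<rho>^(-\<alpha>), as for the operator itself.\<close>

lemma ln_riesz_integral_scale:
  assumes "0 < \<rho>"
  shows "(\<integral>(y::'a::euclidean_space). 2 * ln (1 + norm y ^ 2 / \<rho> ^ 2) * riesz \<alpha> y \<partial>lborel) = \<rho> powr - \<alpha> * ln_riesz_integral TYPE('a) \<alpha>"
    and "0 < \<alpha> \<Longrightarrow> \<alpha> < 2 \<Longrightarrow> 2 \<le> real DIM('a) + \<alpha> \<Longrightarrow> integrable lborel (\<lambda>y::'a. 2 * ln (1 + norm y ^ 2 / \<rho> ^ 2) * riesz \<alpha> y)"
proof -
  have eq: "2 * ln (1 + norm (0 + \<rho> *\<^sub>R y) ^ 2 / \<rho> ^ 2) * riesz \<alpha> (0 + \<rho> *\<^sub>R y)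
      = \<rho> powr - (real DIM('a) + \<alpha>) * (2 * ln (1 + norm y ^ 2) * riesz \<alpha> y)" for y :: 'a
    using assms by (simp add: riesz_def powr_mult power_mult_distrib del: minus_add_distrib)
  have "(\<integral>(y::'a). 2 * ln (1 + norm y ^ 2 / \<rho> ^ 2) * riesz \<alpha> y \<partial>lborel)
     = \<rho> ^ DIM('a) * (\<integral>(y::'a). 2 * ln (1 + norm (0 + \<rho> *\<^sub>R y) ^ 2 / \<rho> ^ 2) * riesz \<alpha> (0 + \<rho> *\<^sub>R y) \<partial>lborel)"
    using assms by (subst lborel_integral_affine[of _ \<rho> 0]) auto
  also have "\<dots> = (\<rho> ^ DIM('a) * \<rho> powr - (real DIM('a) + \<alpha>)) * ln_riesz_integral TYPE('a) \<alpha>"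
    unfolding eq by (simp add: ln_riesz_integral_def)
  also have "\<rho> ^ DIM('a) * \<rho> powr - (real DIM('a) + \<alpha>) = \<rho> powr - \<alpha>"
    using assms by (simp add: powr_add[symmetric] powr_realpow[symmetric])
  finally show "(\<integral>(y::'a::euclidean_space). 2 * ln (1 + norm y ^ 2 / \<rho> ^ 2) * riesz \<alpha> y \<partial>lborel) = \<rho> powr - \<alpha> * ln_riesz_integral TYPE('a) \<alpha>" .
  assume \<alpha>: "0 < \<alpha>" "\<alpha> < 2" "2 \<le> real DIM('a) + \<alpha>"
  have "integrable lborel (\<lambda>y::'a. \<rho> powr - (real DIM('a) + \<alpha>) * (2 * ln (1 + norm (0 + (1/\<rho>) *\<^sub>R y) ^ 2) * riesz \<alpha> (0 + (1/\<rho>) *\<^sub>R y)))"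
    using assms lborel_integrable_affine[OF integrable_ln_riesz[OF \<alpha>], of "1/\<rho>" 0] by simp
  then show "integrable lborel (\<lambda>y::'a. 2 * ln (1 + norm y ^ 2 / \<rho> ^ 2) * riesz \<alpha> y)"
    using assms unfolding eq[symmetric] by simp
qed

text \<open>This rests on \<open>(1 + |z + y|\<^sup>2) (1 + |z - y|\<^sup>2) \<le> (1 + |z|\<^sup>2 + |y|\<^sup>2)\<^sup>2\<close>.\<close>

lemma sdiff_ln_bound:
  fixes x y :: "'a::euclidean_space"
  shows "- sdiff (\<lambda>x. ln (1 + norm (x - x0) ^ 2)) x y \<le> 2 * ln (1 + norm y ^ 2 / (1 + norm (x - x0) ^ 2))"
proof -
  define z where "z = x - x0"
  have pos: "0 < 1 + norm w ^ 2" for w :: 'a by (simp add: add_pos_nonneg)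
  have "(1 + norm (z + y) ^ 2) * (1 + norm (z - y) ^ 2) = (1 + norm z ^ 2 + norm y ^ 2) ^ 2 - 4 * (z \<bullet> y) ^ 2"
    by (simp add: power2_norm_eq_inner inner_add_left inner_add_right inner_diff_left inner_diff_right inner_commute)
       (simp add: algebra_simps power2_eq_square)
  also have "\<dots> \<le> (1 + norm z ^ 2 + norm y ^ 2) ^ 2" by simp
  finally have "ln ((1 + norm (z + y) ^ 2) * (1 + norm (z - y) ^ 2)) \<le> ln ((1 + norm z ^ 2 + norm y ^ 2) ^ 2)"
    using pos by (intro ln_mono) auto
  then have 1: "ln (1 + norm (z + y) ^ 2) + ln (1 + norm (z - y) ^ 2) \<le> 2 * ln (1 + norm z ^ 2 + norm y ^ 2)"
    using pos[of "z + y"] pos[of "z - y"] pos[of z] by (subst (asm) ln_mult) (auto simp: ln_realpow add_pos_nonneg)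
  have "1 + norm y ^ 2 / (1 + norm z ^ 2) = (1 + norm z ^ 2 + norm y ^ 2) / (1 + norm z ^ 2)"
    using pos[of z] by (simp add: field_simps)
  then have 2: "ln (1 + norm y ^ 2 / (1 + norm z ^ 2)) = ln (1 + norm z ^ 2 + norm y ^ 2) - ln (1 + norm z ^ 2)"
  proof -
    have "0 < 1 + norm z ^ 2 + norm y ^ 2" using pos[of z] by (intro add_pos_nonneg) auto
    then show ?thesis using pos[of z] unfolding \<open>1 + _ / _ = _\<close> by (simp add: ln_divide_pos)
  qed
  have e: "x + y - x0 = z + y" "x - y - x0 = z - y" by (auto simp: z_def)
  show ?thesis using 1 2 unfolding sdiff_def e z_def[symmetric] by simp
qed

text \<open>At a minimum of \<open>g\<close> the second differences of \<open>g\<close> are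
  nonpositive, so those of \<open>u\<close> are at most \<kappa> times the negated ones of the
  logarithm. By \<open>sdiff_ln_bound\<close> the operator on \<open>u\<close> is then at most
  \<kappa> C \<rho>^(-\<alpha>) with \<rho>^2 = 1 + |xs - x0|^2, the same power as in the assumed
  lower bound. The position of the minimum therefore does not matter, only \<kappa> C < c.\<close>

lemma (in frac_admissible) sym_frac_lap_not_bounded_below:
  assumes n: "2 \<le> real DIM('a) + \<alpha>" and u0: "\<And>x. 0 \<le> u x"
    and c: "0 < c" "\<And>x. c * (1 + norm (x - x0) ^ 2) powr (- \<alpha> / 2) \<le> sym_frac_lap \<alpha> u x"
  shows False
proof -
  define C where "C = ln_riesz_integral TYPE('a) \<alpha>"
  have C: "0 \<le> C" unfolding C_def ln_riesz_integral_def by (intro Bochner_Integration.integral_nonneg) simp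
  \<comment> \<open>Adding 1 to \<open>C\<close> avoids division by 0 and makes
    \<open>\<kappa> * C < c\<close> strict.\<close>
  define \<kappa> where "\<kappa> = c / (C + 1)"
  have \<kappa>: "0 < \<kappa>" "\<kappa> * C < c" using c C by (auto simp: \<kappa>_def divide_less_eq)
  define l where "l x = ln (1 + norm (x - x0) ^ 2)" for x
  define g where "g x = u x + \<kappa> * l x" for x
  have pos: "1 + norm w ^ 2 \<noteq> 0" for w :: 'a by (smt (verit) zero_le_power2)
  have gc: "continuous_on UNIV g"
    unfolding g_def l_def using pos by (intro continuous_intros cont) auto
  \<comment> \<open>Outside this radius \<kappa> l alone is at least \<open>u x0\<close>, the value
    of \<open>g\<close> at the centre, so the minimum over the ball is global.\<close>
  define r where "r = sqrt (exp (u x0 / \<kappa>))"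
  have r: "0 \<le> r" "r ^ 2 = exp (u x0 / \<kappa>)" by (auto simp: r_def)
  obtain xs where xs: "xs \<in> cball x0 r" "\<And>x. x \<in> cball x0 r \<Longrightarrow> g xs \<le> g x"
    using continuous_attains_inf[of "cball x0 r" g] r(1) continuous_on_subset[OF gc] by (auto simp: Ball_def)
  have min: "g xs \<le> g x" for x
  proof (cases "x \<in> cball x0 r")
    case False
    then have "r < norm (x - x0)" by (simp add: dist_norm norm_minus_commute)
    then have "r ^ 2 \<le> norm (x - x0) ^ 2" using r(1) by (intro power_mono) auto
    then have "exp (u x0 / \<kappa>) \<le> 1 + norm (x - x0) ^ 2" using r(2) by simp
    then have "u x0 / \<kappa> \<le> l x" unfolding l_def
      by (subst ln_ge_iff) (auto simp: add_pos_nonneg)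
    then have "u x0 \<le> \<kappa> * l x" using \<kappa> by (simp add: divide_le_eq mult.commute)
    moreover have "g xs \<le> g x0" using xs(2)[of x0] r by simp
    moreover have "g x0 = u x0" by (simp add: g_def l_def)
    moreover have "\<kappa> * l x \<le> g x" using u0[of x] by (simp add: g_def)
    ultimately show ?thesis by linarith
  qed (use xs in auto)
  define \<rho> where "\<rho> = sqrt (1 + norm (xs - x0) ^ 2)"
  have \<rho>: "0 < \<rho>" "\<rho> ^ 2 = 1 + norm (xs - x0) ^ 2" by (auto simp: \<rho>_def add_pos_nonneg)
  have le: "sdiff u xs y * riesz \<alpha> y \<le> \<kappa> * (2 * ln (1 + norm y ^ 2 / \<rho> ^ 2) * riesz \<alpha> y)" for y
  proof -
    have "sdiff g xs y \<le> 0" using min[of "xs + y"] min[of "xs - y"] by (simp add: sdiff_def)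
    moreover have "sdiff g xs y = sdiff u xs y + \<kappa> * sdiff l xs y" by (simp add: sdiff_def g_def algebra_simps)
    moreover have "- sdiff l xs y \<le> 2 * ln (1 + norm y ^ 2 / \<rho> ^ 2)"
      using sdiff_ln_bound[of x0 xs y] \<rho>(2) by (simp add: l_def[abs_def])
    then have "\<kappa> * (- sdiff l xs y) \<le> \<kappa> * (2 * ln (1 + norm y ^ 2 / \<rho> ^ 2))" using \<kappa> by (intro mult_left_mono) auto
    ultimately have "sdiff u xs y \<le> \<kappa> * (2 * ln (1 + norm y ^ 2 / \<rho> ^ 2))" by simp
    from mult_right_mono[OF this, of "riesz \<alpha> y"] show ?thesis by (simp add: mult.assoc)
  qed
  have "sym_frac_lap \<alpha> u xs \<le> (\<integral>(y::'a). \<kappa> * (2 * ln (1 + norm y ^ 2 / \<rho> ^ 2) * riesz \<alpha> y) \<partial>lborel)"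
    unfolding sym_frac_lap_def
  proof (rule integral_mono[OF integrable_sdiff])
    show "integrable lborel (\<lambda>y::'a. \<kappa> * (2 * ln (1 + norm y ^ 2 / \<rho> ^ 2) * riesz \<alpha> y))"
      using ln_riesz_integral_scale(2)[OF \<rho>(1) \<alpha> n] by (rule integrable_mult_right)
  qed (rule le)
  also have "\<dots> = \<kappa> * C * \<rho> powr - \<alpha>"
    using ln_riesz_integral_scale(1)[OF \<rho>(1), of \<alpha>, where 'a='a] by (simp add: C_def)
  finally have "c * (1 + norm (xs - x0) ^ 2) powr (- \<alpha> / 2) \<le> \<kappa> * C * \<rho> powr - \<alpha>" using c(2)[of xs] by simp
  moreover have "(1 + norm (xs - x0) ^ 2) powr (- \<alpha> / 2) = \<rho> powr - \<alpha>"
  proof -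
    have "1 + norm (xs - x0) ^ 2 = \<rho> powr 2" using \<rho> by simp
    then show ?thesis by (simp only: powr_powr) simp
  qed
  ultimately have "c * \<rho> powr - \<alpha> \<le> \<kappa> * C * \<rho> powr - \<alpha>" by simp
  then show False using \<kappa>(2) \<rho>(1) by simp
qed

section \<open>Regularity of the fractional Laplacian\<close>

text \<open>Asserts existence together with the value at every point, whereas
  \<open>partial_deriv\<close> is total and arbitrary where the derivative fails to exist.\<close>

definition has_partial :: "'n::finite \<Rightarrow> (real^'n \<Rightarrow> real) \<Rightarrow> (real^'n \<Rightarrow> real) \<Rightarrow> bool" where
  "has_partial i w w' \<longleftrightarrow> (\<forall>x. ((\<lambda>t. w (x + t *\<^sub>R axis i 1)) has_real_derivative w' x) (at 0))"

lemma has_partial_at: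
  assumes "has_partial i w w'"
  shows "((\<lambda>t. w (x + t *\<^sub>R axis i 1)) has_real_derivative w' (x + s *\<^sub>R axis i 1)) (at s)"
proof -
  have "((\<lambda>t. w ((x + s *\<^sub>R axis i 1) + t *\<^sub>R axis i 1)) has_real_derivative w' (x + s *\<^sub>R axis i 1)) (at 0)"
    using assms by (simp add: has_partial_def)
  then have "((\<lambda>t. w (x + (t + s) *\<^sub>R axis i 1)) has_real_derivative w' (x + s *\<^sub>R axis i 1)) (at 0)"
    by (simp add: scaleR_add_left add_ac)
  then show ?thesis using DERIV_shift[of "\<lambda>t. w (x + t *\<^sub>R axis i 1)" _ 0 s] by simp
qed

lemma has_partial_partial: "has_partial i w w' \<Longrightarrow> partial_deriv i w = w'"
  by (auto simp: has_partial_def partial_deriv_def fun_eq_iff intro!: DERIV_imp_deriv)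

lemma has_partial_const: "has_partial i (\<lambda>x. c) (\<lambda>x. 0)"
  by (simp add: has_partial_def)

lemma has_partial_add: "has_partial i v v' \<Longrightarrow> has_partial i w w' \<Longrightarrow> has_partial i (\<lambda>x. v x + w x) (\<lambda>x. v' x + w' x)"
  by (auto simp: has_partial_def intro!: derivative_intros)

lemma has_partial_mult: "has_partial i v v' \<Longrightarrow> has_partial i w w' \<Longrightarrow> has_partial i (\<lambda>x. v x * w x) (\<lambda>x. v' x * w x + v x * w' x)"
  unfolding has_partial_def
proof
  fix x assume "\<forall>x. ((\<lambda>t. v (x + t *\<^sub>R axis i 1)) has_real_derivative v' x) (at 0)"
     "\<forall>x. ((\<lambda>t. w (x + t *\<^sub>R axis i 1)) has_real_derivative w' x) (at 0)"
  then have "((\<lambda>t. v (x + t *\<^sub>R axis i 1)) has_real_derivative v' x) (at 0)"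
     "((\<lambda>t. w (x + t *\<^sub>R axis i 1)) has_real_derivative w' x) (at 0)" by auto
  from DERIV_mult[OF this] show "((\<lambda>t. v (x + t *\<^sub>R axis i 1) * w (x + t *\<^sub>R axis i 1)) has_real_derivative v' x * w x + v x * w' x) (at 0)"
    by (simp add: mult.commute)
qed

lemma has_partial_coord: "has_partial i (\<lambda>x. x $ j) (\<lambda>x. if i = j then 1 else 0)"
  by (auto simp: has_partial_def axis_def intro!: derivative_eq_intros)

lemma has_partial_norm2: "has_partial i (\<lambda>x. norm (x - a) ^ 2) (\<lambda>x. 2 * (x - a) $ i)"
proof -
  have "norm (x + t *\<^sub>R axis i 1 - a) ^ 2 = norm (x - a) ^ 2 + 2 * t * (x - a) $ i + t ^ 2" for x and t
  proof -
    have "x + t *\<^sub>R axis i 1 - a = (x - a) + t *\<^sub>R axis i 1" by simp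
    then show ?thesis
      by (simp only: power2_norm_eq_inner inner_add_left inner_add_right inner_scaleR_left inner_scaleR_right)
         (simp add: inner_axis inner_commute[of "axis i 1"] power2_eq_square inner_real_def algebra_simps)
  qed
  then show ?thesis
    by (auto simp: has_partial_def intro!: derivative_eq_intros)
qed

lemma has_partial_chain:
  assumes "has_partial i w w'" "\<And>x. (g has_real_derivative g' (w x)) (at (w x))"
  shows "has_partial i (\<lambda>x. g (w x)) (\<lambda>x. g' (w x) * w' x)"
  unfolding has_partial_def
proof
  fix x
  have "((\<lambda>t. w (x + t *\<^sub>R axis i 1)) has_real_derivative w' x) (at 0)" using assms(1) by (simp add: has_partial_def)
  moreover have "(g has_real_derivative g' (w x)) (at (w (x + 0 *\<^sub>R axis i 1)))" using assms(2)[of x] by simp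
  ultimately show "((\<lambda>t. g (w (x + t *\<^sub>R axis i 1))) has_real_derivative g' (w x) * w' x) (at 0)"
    by (rule DERIV_chain2[rotated])
qed

text \<open>Derivatives are taken along the axes, unlike in \<open>C_k\<close>: these are what
  differentiation under an integral sign provides and what \<open>neg_laplacian\<close>
  consumes.\<close>

primrec partial_C :: "nat \<Rightarrow> (real^'n::finite \<Rightarrow> real) \<Rightarrow> bool" where
  "partial_C 0 w \<longleftrightarrow> continuous_on UNIV w"
| "partial_C (Suc k) w \<longleftrightarrow> continuous_on UNIV w \<and> (\<forall>i. \<exists>w'. has_partial i w w' \<and> partial_C k w')"

lemma partial_C_continuous: "partial_C k w \<Longrightarrow> continuous_on UNIV w"
  by (cases k) auto

lemma partial_C_SucD: "partial_C (Suc k) w \<Longrightarrow> partial_C k w"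
  by (induction k arbitrary: w) (auto, blast)

lemma partial_C_mono: "partial_C k w \<Longrightarrow> j \<le> k \<Longrightarrow> partial_C j w"
proof (induction k)
  case (Suc k)
  then show ?case using partial_C_SucD[of k w] by (cases "j = Suc k") auto
qed simp

lemma partial_C_const: "partial_C k (\<lambda>x. c)"
  by (induction k arbitrary: c) (auto intro: has_partial_const)

lemma partial_C_add: "partial_C k v \<Longrightarrow> partial_C k w \<Longrightarrow> partial_C k (\<lambda>x. v x + w x)"
proof (induction k arbitrary: v w)
  case (Suc k)
  show ?case unfolding partial_C.simps
  proof (intro conjI allI)
    show "continuous_on UNIV (\<lambda>x. v x + w x)" using Suc.prems by (auto intro!: continuous_intros)
    fix i
    from Suc.prems obtain v' w' where "has_partial i v v'" "partial_C k v'" "has_partial i w w'" "partial_C k w'"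
      unfolding partial_C.simps by metis
    then show "\<exists>w'. has_partial i (\<lambda>x. v x + w x) w' \<and> partial_C k w'" using Suc.IH has_partial_add by blast
  qed
qed (auto intro!: continuous_intros)

lemma partial_C_cmult: "partial_C k v \<Longrightarrow> partial_C k (\<lambda>x. c * v x)"
proof (induction k arbitrary: v)
  case (Suc k)
  show ?case unfolding partial_C.simps
  proof (intro conjI allI)
    show "continuous_on UNIV (\<lambda>x. c * v x)" using Suc.prems by (auto intro!: continuous_intros)
    fix i
    from Suc.prems obtain v' where v': "has_partial i v v'" "partial_C k v'" unfolding partial_C.simps by metis
    have "has_partial i (\<lambda>x. c * v x) (\<lambda>x. c * v' x)"
      using has_partial_mult[OF has_partial_const v'(1), of c] by simp
    then show "\<exists>w'. has_partial i (\<lambda>x. c * v x) w' \<and> partial_C k w'" using Suc.IH v' by blast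
  qed
qed (auto intro!: continuous_intros)

lemma partial_C_sum: "finite A \<Longrightarrow> (\<And>i. i \<in> A \<Longrightarrow> partial_C k (v i)) \<Longrightarrow> partial_C k (\<lambda>x. \<Sum>i\<in>A. v i x)"
  by (induction A rule: finite_induct) (auto intro: partial_C_const partial_C_add)

lemma partial_C_partial:
  assumes "partial_C (Suc k) w"
  shows "has_partial i w (partial_deriv i w)" "partial_C k (partial_deriv i w)"
proof -
  obtain w' where "has_partial i w w'" "partial_C k w'" using assms unfolding partial_C.simps by blast
  then show "has_partial i w (partial_deriv i w)" "partial_C k (partial_deriv i w)" using has_partial_partial by metis+
qed

lemma partial_C_neg_laplacian:
  assumes "partial_C (Suc (Suc k)) w"
  shows "partial_C k (neg_laplacian w)"
proof -
  have "partial_C k (\<lambda>x. - 1 * (\<Sum>i\<in>UNIV. partial_deriv i (partial_deriv i w) x))"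
    by (intro partial_C_cmult partial_C_sum) (auto intro: partial_C_partial assms)
  then show ?thesis by (simp add: neg_laplacian_def[abs_def])
qed

lemma partial_C_neg_laplacian_iter: "partial_C (2 * j + k) w \<Longrightarrow> partial_C k ((neg_laplacian ^^ j) w)"
proof (induction j arbitrary: k)
  case (Suc j)
  then have "partial_C (Suc (Suc k)) ((neg_laplacian ^^ j) w)" using Suc.IH[of "Suc (Suc k)"] Suc.prems by simp
  then show ?case using partial_C_neg_laplacian by simp
qed simp

lemma C_k_has_partial:
  assumes "\<And>x. u differentiable (at x)"
  shows "has_partial i u (partial_deriv i u)"
proof -
  have "\<exists>d. ((\<lambda>t. u (x + t *\<^sub>R axis i 1)) has_real_derivative d) (at 0)" for x
  proof -
    obtain D where "(u has_derivative D) (at (x + 0 *\<^sub>R axis i 1))" using assms by (auto simp: differentiable_def)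
    moreover have "((\<lambda>t. x + t *\<^sub>R axis i 1) has_derivative (\<lambda>t. t *\<^sub>R axis i 1)) (at 0)"
      by (auto intro!: derivative_eq_intros)
    ultimately have "((\<lambda>t. u (x + t *\<^sub>R axis i 1)) has_derivative (\<lambda>t. D (t *\<^sub>R axis i 1))) (at 0)"
      using has_derivative_compose by blast
    then have "((\<lambda>t. u (x + t *\<^sub>R axis i 1)) differentiable at 0)" by (auto simp: differentiable_def)
    then show ?thesis by (simp add: real_differentiable_def)
  qed
  then show ?thesis
    unfolding has_partial_def partial_deriv_def by (metis DERIV_imp_deriv)
qed

text \<open>Unlike in the usual symbol classes, derivatives need not decay faster than the function.\<close>

definition order_bounded :: "real \<Rightarrow> (real^'n::finite \<Rightarrow> real) \<Rightarrow> bool" where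
  "order_bounded q a \<longleftrightarrow> continuous_on UNIV a \<and> (\<exists>C\<ge>0. \<forall>x. \<bar>a x\<bar> \<le> C * (1 + norm x) powr q)"

primrec symbol :: "nat \<Rightarrow> real \<Rightarrow> (real^'n::finite \<Rightarrow> real) \<Rightarrow> bool" where
  "symbol 0 q a \<longleftrightarrow> order_bounded q a"
| "symbol (Suc k) q a \<longleftrightarrow> order_bounded q a \<and> (\<forall>i. \<exists>a'. has_partial i a a' \<and> symbol k q a')"

lemma order_bounded_weaken: "order_bounded q a \<Longrightarrow> q \<le> r \<Longrightarrow> order_bounded r a"
  unfolding order_bounded_def by (meson add_increasing2 le_add_same_cancel1 mult_left_mono norm_ge_zero order_trans powr_mono)

lemma order_bounded_add:
  assumes "order_bounded q a" "order_bounded q b"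
  shows "order_bounded q (\<lambda>x. a x + b x)"
proof -
  obtain A B where AB: "0 \<le> A" "0 \<le> B" "\<And>x. \<bar>a x\<bar> \<le> A * (1 + norm x) powr q" "\<And>x. \<bar>b x\<bar> \<le> B * (1 + norm x) powr q"
    using assms by (auto simp: order_bounded_def)
  have "\<bar>a x + b x\<bar> \<le> (A + B) * (1 + norm x) powr q" for x
    using AB(3,4)[of x] by (simp add: distrib_right)
  then show ?thesis using assms AB by (auto simp: order_bounded_def intro!: continuous_intros exI[of _ "A + B"])
qed

lemma order_bounded_mult:
  assumes "order_bounded q a" "order_bounded r b"
  shows "order_bounded (q + r) (\<lambda>x. a x * b x)"
proof -
  obtain A B where AB: "0 \<le> A" "0 \<le> B" "\<And>x. \<bar>a x\<bar> \<le> A * (1 + norm x) powr q" "\<And>x. \<bar>b x\<bar> \<le> B * (1 + norm x) powr r"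
    using assms by (auto simp: order_bounded_def)
  have "\<bar>a x * b x\<bar> \<le> (A * B) * (1 + norm x) powr (q + r)" for x
  proof -
    have "\<bar>a x\<bar> * \<bar>b x\<bar> \<le> (A * (1 + norm x) powr q) * (B * (1 + norm x) powr r)"
      using AB(3,4)[of x] AB(1,2) by (intro mult_mono) auto
    then show ?thesis by (simp add: abs_mult powr_add mult_ac)
  qed
  then show ?thesis using assms AB by (auto simp: order_bounded_def intro!: continuous_intros exI[of _ "A * B"])
qed

lemma symbol_order_bounded: "symbol k q a \<Longrightarrow> order_bounded q a"
  by (cases k) auto

lemma symbol_SucD: "symbol (Suc k) q a \<Longrightarrow> symbol k q a"
  by (induction k arbitrary: a) (auto, blast)

lemma symbol_weaken: "symbol k q a \<Longrightarrow> q \<le> r \<Longrightarrow> symbol k r a"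
  by (induction k arbitrary: a) (auto intro: order_bounded_weaken, blast intro: order_bounded_weaken)

lemma symbol_add: "symbol k q a \<Longrightarrow> symbol k q b \<Longrightarrow> symbol k q (\<lambda>x. a x + b x)"
proof (induction k arbitrary: a b)
  case (Suc k)
  have "\<exists>c. has_partial i (\<lambda>x. a x + b x) c \<and> symbol k q c" for i
  proof -
    obtain a' b' where "has_partial i a a'" "symbol k q a'" "has_partial i b b'" "symbol k q b'"
      using Suc.prems unfolding symbol.simps by metis
    then show ?thesis using Suc.IH has_partial_add by blast
  qed
  then show ?case using order_bounded_add Suc.prems by auto
qed (auto intro: order_bounded_add)

lemma symbol_mult: "symbol k q a \<Longrightarrow> symbol k r b \<Longrightarrow> symbol k (q + r) (\<lambda>x. a x * b x)"
proof (induction k arbitrary: a b)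
  case (Suc k)
  have "\<exists>c. has_partial i (\<lambda>x. a x * b x) c \<and> symbol k (q + r) c" for i
  proof -
    obtain a' b' where *: "has_partial i a a'" "symbol k q a'" "has_partial i b b'" "symbol k r b'"
      using Suc.prems unfolding symbol.simps by metis
    moreover have "symbol k q a" "symbol k r b" using Suc.prems symbol_SucD by blast+
    ultimately have "symbol k (q + r) (\<lambda>x. a' x * b x + a x * b' x)"
      using Suc.IH by (intro symbol_add) auto
    then show ?thesis using has_partial_mult[OF *(1,3)] by blast
  qed
  then show ?case using order_bounded_mult Suc.prems by auto
qed (auto intro: order_bounded_mult)

lemma order_bounded_const: "order_bounded 0 (\<lambda>x. c)"
proof -
  have "1 + norm x \<noteq> 0" for x :: "real^'a" by (smt (verit) norm_ge_zero)
  then show ?thesis by (auto simp: order_bounded_def intro!: exI[of _ "\<bar>c\<bar>"])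
qed

lemma symbol_const: "symbol k 0 (\<lambda>x. c)"
  by (induction k arbitrary: c) (auto intro: has_partial_const order_bounded_const)

lemma symbol_coord: "symbol k 1 (\<lambda>x. x $ i)"
proof -
  have 0: "order_bounded 1 (\<lambda>x. x $ i)"
    unfolding order_bounded_def
  proof (intro conjI exI[of _ 1] allI)
    show "\<bar>x $ i\<bar> \<le> 1 * (1 + norm x) powr 1" for x :: "real^'a"
      using component_le_norm_cart[of x i] by simp
  qed (auto intro!: continuous_intros)
  show ?thesis
  proof (cases k)
    case (Suc j)
    have "symbol j 1 (\<lambda>x. if l = i then 1 else 0)" for l
      by (rule symbol_weaken[of j 0]) (auto intro: symbol_const)
    then show ?thesis using 0 has_partial_coord unfolding Suc symbol.simps(2) by blast
  qed (use 0 in simp)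
qed

text \<open>On either side the difference quotient of the glued function is that of one piece. Used
  at the junction of the kernel profile at 1 and of the bumps at 0.\<close>

lemma has_real_derivative_glue:
  assumes "(f has_real_derivative D) (at a)" "(g has_real_derivative D) (at a)" "f a = g a"
  shows "((\<lambda>s. if a \<le> s then f s else g s) has_real_derivative D) (at a)"
proof -
  have "((\<lambda>y. if a \<le> y then (f y - f a) / (y - a) else (g y - g a) / (y - a)) \<longlongrightarrow> D) (at a)"
    using assms(1,2) unfolding has_field_derivative_iff
    by (intro filterlim_If) (auto elim: filterlim_mono[OF _ order_refl inf_le1])
  moreover have "(\<lambda>y. if a \<le> y then (f y - f a) / (y - a) else (g y - g a) / (y - a)) =
     (\<lambda>y. ((if a \<le> y then f y else g y) - (if a \<le> a then f a else g a)) / (y - a))"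
    using assms(3) by auto
  ultimately show ?thesis unfolding has_field_derivative_iff by simp
qed

text \<open>
  The profile is \<open>s\<^sup>-\<^sup>\<beta>\<close> for \<open>s \<ge> 1\<close>, continued by its Taylor polynomial at \<open>1\<close> of order \<open>N\<close>, and \<open>l\<close>
  counts derivatives. For \<open>\<beta> = (n + \<alpha>) / 2\<close> and \<open>s = |y|\<^sup>2\<close> this splits the singular kernel into a
  smooth part and a part supported in the unit ball, which only sees \<open>u\<close> locally.
\<close>

definition powr_deriv_coeff :: "real \<Rightarrow> nat \<Rightarrow> real" where
  "powr_deriv_coeff \<beta> l = (\<Prod>j<l. - (\<beta> + real j))"

definition taylor_profile :: "real \<Rightarrow> nat \<Rightarrow> nat \<Rightarrow> real \<Rightarrow> real" where
  "taylor_profile \<beta> N l s = (\<Sum>j\<le>N - l. powr_deriv_coeff \<beta> (l + j) * (s - 1) ^ j / fact j)"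

definition kernel_profile :: "real \<Rightarrow> nat \<Rightarrow> nat \<Rightarrow> real \<Rightarrow> real" where
  "kernel_profile \<beta> N l s = (if 1 \<le> s then powr_deriv_coeff \<beta> l * s powr - (\<beta> + real l) else taylor_profile \<beta> N l s)"

lemma taylor_profile_1: "taylor_profile \<beta> N l 1 = powr_deriv_coeff \<beta> l"
  unfolding taylor_profile_def by (subst sum.atMost_shift) simp

text \<open>The polynomial with index \<open>l\<close> is cut at degree \<open>N - l\<close>, so
  differentiation lowers the degree and raises the index together: the profile with index
  \<open>l\<close> really is the \<open>l\<close>-th derivative of one Taylor polynomial.\<close>

lemma taylor_profile_deriv:
  assumes "l < N"
  shows "(taylor_profile \<beta> N l has_real_derivative taylor_profile \<beta> N (Suc l) s) (at s)"
proof -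
  obtain M where M: "N - l = Suc M" "N - Suc l = M" using assms by (metis Suc_diff_Suc)
  have "(taylor_profile \<beta> N l has_real_derivative (\<Sum>j\<le>Suc M. powr_deriv_coeff \<beta> (l + j) * (real j * (s - 1) ^ (j - 1)) / fact j)) (at s)"
    unfolding taylor_profile_def[abs_def] M by (intro DERIV_sum) (auto intro!: derivative_eq_intros)
  also have "(\<Sum>j\<le>Suc M. powr_deriv_coeff \<beta> (l + j) * (real j * (s - 1) ^ (j - 1)) / fact j) =
     (\<Sum>j\<le>M. powr_deriv_coeff \<beta> (l + Suc j) * (real (Suc j) * (s - 1) ^ j) / fact (Suc j))"
    by (subst sum.atMost_Suc_shift) simp
  also have "\<dots> = taylor_profile \<beta> N (Suc l) s"
    unfolding taylor_profile_def M
    by (intro sum.cong) (auto simp: field_simps simp del: of_nat_Suc)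
  finally show ?thesis .
qed

lemma kernel_profile_powr_deriv:
  assumes "0 < s"
  shows "((\<lambda>s. powr_deriv_coeff \<beta> l * s powr - (\<beta> + real l)) has_real_derivative powr_deriv_coeff \<beta> (Suc l) * s powr - (\<beta> + real (Suc l))) (at s)"
proof -
  have "- (\<beta> + real l) - 1 = - (\<beta> + real (Suc l))" by simp
  with DERIV_cmult[OF has_real_derivative_powr[OF assms, of "- (\<beta> + real l)"], of "powr_deriv_coeff \<beta> l"]
  show ?thesis by (simp only: powr_deriv_coeff_def prod.lessThan_Suc mult.assoc)
qed

text \<open>At the junction both pieces take the value \<open>powr_deriv_coeff \<beta> l\<close> and
  have the same derivative, as long as the Taylor polynomial still has a term of the next
  order.\<close>

lemma kernel_profile_deriv:
  assumes "l < N"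
  shows "(kernel_profile \<beta> N l has_real_derivative kernel_profile \<beta> N (Suc l) s) (at s)"
proof (cases s "1::real" rule: linorder_cases)
  case less
  show ?thesis
  proof (rule has_field_derivative_transform_within_open[where S="{..<1}"])
    show "(taylor_profile \<beta> N l has_real_derivative kernel_profile \<beta> N (Suc l) s) (at s)"
      using taylor_profile_deriv[OF assms, of \<beta> s] less by (simp add: kernel_profile_def)
  qed (use less in \<open>auto simp: kernel_profile_def\<close>)
next
  case greater
  show ?thesis
  proof (rule has_field_derivative_transform_within_open[where S="{1<..}"])
    show "((\<lambda>s. powr_deriv_coeff \<beta> l * s powr - (\<beta> + real l)) has_real_derivative kernel_profile \<beta> N (Suc l) s) (at s)"
      using kernel_profile_powr_deriv[of s \<beta> l] greater by (simp add: kernel_profile_def)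
  qed (use greater in \<open>auto simp: kernel_profile_def\<close>)
next
  case equal
  have "((\<lambda>s. if 1 \<le> s then powr_deriv_coeff \<beta> l * s powr - (\<beta> + real l) else taylor_profile \<beta> N l s) has_real_derivative powr_deriv_coeff \<beta> (Suc l)) (at 1)"
    using kernel_profile_powr_deriv[of 1 \<beta> l] taylor_profile_deriv[OF assms, of \<beta> 1]
    by (intro has_real_derivative_glue) (auto simp: taylor_profile_1)
  then show ?thesis using equal by (simp add: kernel_profile_def[abs_def])
qed

text \<open>For s \<ge> 1 one has 1 + s \<le> 2 s; for 0 \<le> s < 1 the profile is bounded by
  compactness and 1 + s \<le> 2. The factor 2^q covers both ranges.\<close>

lemma kernel_profile_bound:
  assumes "l < N" "0 < \<beta>"
  obtains C where "0 \<le> C" "\<And>s. 0 \<le> s \<Longrightarrow> \<bar>kernel_profile \<beta> N l s\<bar> \<le> C * (1 + s) powr - (\<beta> + real l)"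
proof -
  define q where "q = \<beta> + real l"
  have q: "0 < q" using assms by (simp add: q_def)
  have "continuous_on {0..1} (taylor_profile \<beta> N l)"
    unfolding taylor_profile_def[abs_def] by (intro continuous_intros) auto
  then have "compact (taylor_profile \<beta> N l ` {0..1})" by (intro compact_continuous_image) auto
  then obtain M where M: "\<And>s. 0 \<le> s \<Longrightarrow> s \<le> 1 \<Longrightarrow> \<bar>taylor_profile \<beta> N l s\<bar> \<le> M"
    by (force simp: bounded_iff dest!: compact_imp_bounded)
  have M0: "0 \<le> M" using M[of 0] by simp
  show ?thesis
  proof (rule that[of "(\<bar>powr_deriv_coeff \<beta> l\<bar> + M) * 2 powr q"])
    fix s :: real assume s: "0 \<le> s"
    show "\<bar>kernel_profile \<beta> N l s\<bar> \<le> (\<bar>powr_deriv_coeff \<beta> l\<bar> + M) * 2 powr q * (1 + s) powr - (\<beta> + real l)"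
    proof (cases "1 \<le> s")
      case True
      have "s powr - q = 2 powr q * (2 * s) powr - q"
        using True by (simp add: powr_mult powr_add[symmetric] flip: mult.assoc)
      also have "\<dots> \<le> 2 powr q * (1 + s) powr - q"
        using True q by (intro mult_left_mono powr_mono2') auto
      finally have "\<bar>powr_deriv_coeff \<beta> l\<bar> * s powr - q \<le> (\<bar>powr_deriv_coeff \<beta> l\<bar> + M) * (2 powr q * (1 + s) powr - q)"
        using M0 by (intro mult_mono) auto
      then show ?thesis using True unfolding kernel_profile_def q_def[symmetric] by (simp add: abs_mult mult.assoc)
    next
      case False
      have "1 = 2 powr q * 2 powr - q" by (simp flip: powr_add)
      also have "\<dots> \<le> 2 powr q * (1 + s) powr - q"
        using False s q by (intro mult_left_mono powr_mono2') auto
      finally have "M * 1 \<le> (\<bar>powr_deriv_coeff \<beta> l\<bar> + M) * (2 powr q * (1 + s) powr - q)"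
        using M0 by (intro mult_mono) auto
      then show ?thesis using False M[OF s] unfolding kernel_profile_def q_def[symmetric] by (simp add: mult.assoc)
    qed
  qed (use M0 in auto)
qed

text \<open>Each axis derivative produces the next profile times 2 x_i: two orders of decay are
  gained and one is lost. The remaining gain is given away, so that every derivative carries the
  same order.\<close>

lemma symbol_kernel_profile:
  assumes "k + l < N" "0 < \<beta>"
  shows "symbol k (- 2 * (\<beta> + real l)) (\<lambda>x::real^'n::finite. kernel_profile \<beta> N l (norm x ^ 2))"
  using assms(1)
proof (induction k arbitrary: l)
  case (0 l)
  obtain C where C: "0 \<le> C" "\<And>s. 0 \<le> s \<Longrightarrow> \<bar>kernel_profile \<beta> N l s\<bar> \<le> C * (1 + s) powr - (\<beta> + real l)"
    using kernel_profile_bound[of l N \<beta>] 0 assms by auto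
  define q where "q = \<beta> + real l"
  have q: "0 < q" using assms by (simp add: q_def)
  have "\<bar>kernel_profile \<beta> N l (norm x ^ 2)\<bar> \<le> (C * 2 powr q) * (1 + norm x) powr (- 2 * q)" for x :: "real^'n"
  proof -
    \<comment> \<open>From (1 + t)^2 \<le> 2 (1 + t^2) with t = |x|.\<close>
    have "(1 + norm x ^ 2) powr - q \<le> ((1 + norm x) ^ 2 / 2) powr - q"
      using q sum_squares_bound[of 1 "norm x"] 
      by (intro powr_mono2') (auto simp: power2_sum add_pos_nonneg)
    also have "\<dots> = 2 powr q * ((1 + norm x) powr 2) powr - q"
      by (simp add: powr_divide powr_minus divide_simps add_pos_nonneg)
    also have "\<dots> = 2 powr q * (1 + norm x) powr (- 2 * q)"
      unfolding powr_powr by simp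
    finally have "C * (1 + norm x ^ 2) powr - q \<le> C * (2 powr q * (1 + norm x) powr (- 2 * q))"
      using C(1) by (rule mult_left_mono)
    then show ?thesis using C(2)[of "norm x ^ 2"] by (simp add: q_def mult.assoc)
  qed
  moreover have "continuous_on UNIV (\<lambda>x::real^'n. kernel_profile \<beta> N l (norm x ^ 2))"
  proof (rule continuous_on_compose2[where g="kernel_profile \<beta> N l" and t=UNIV])
    show "continuous_on UNIV (kernel_profile \<beta> N l)"
      using kernel_profile_deriv[of l N \<beta>] 0 by (intro DERIV_continuous_on) (auto intro: DERIV_subset)
  qed (auto intro!: continuous_intros)
  ultimately show ?case using C(1) by (auto simp: order_bounded_def q_def intro!: exI[of _ "C * 2 powr q"])
next
  case (Suc k l)
  have 1: "symbol k (- 2 * (\<beta> + real l)) (\<lambda>x::real^'n. kernel_profile \<beta> N l (norm x ^ 2))"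
    using Suc.IH[of l] Suc.prems by simp
  have "\<exists>a'. has_partial i (\<lambda>x::real^'n. kernel_profile \<beta> N l (norm x ^ 2)) a' \<and> symbol k (- 2 * (\<beta> + real l)) a'" for i
  proof -
    have "has_partial i (\<lambda>x::real^'n. norm x ^ 2) (\<lambda>x. 2 * x $ i)"
      using has_partial_norm2[of i 0] by simp
    from has_partial_chain[OF this kernel_profile_deriv[of l N \<beta>]] Suc.prems
    have "has_partial i (\<lambda>x::real^'n. kernel_profile \<beta> N l (norm x ^ 2)) (\<lambda>x. kernel_profile \<beta> N (Suc l) (norm x ^ 2) * (2 * x $ i))" by simp
    moreover have "symbol k (- 2 * (\<beta> + real (Suc l)) + (0 + 1)) (\<lambda>x::real^'n. kernel_profile \<beta> N (Suc l) (norm x ^ 2) * (2 * x $ i))"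
      using Suc.IH[of "Suc l"] Suc.prems by (intro symbol_mult symbol_const symbol_coord) auto
    then have "symbol k (- 2 * (\<beta> + real l)) (\<lambda>x::real^'n. kernel_profile \<beta> N (Suc l) (norm x ^ 2) * (2 * x $ i))"
      by (rule symbol_weaken) simp
    ultimately show ?thesis by blast
  qed
  then show ?case using symbol_order_bounded[OF 1] by simp
qed

section \<open>The smooth far part of the kernel\<close>

lemma order_bounded_tail_weight:
  assumes "order_bounded (- (real CARD('n) + \<alpha>)) (K :: real^'n::finite \<Rightarrow> real)" "0 < \<alpha>"
  obtains C where "0 \<le> C" "\<And>x. \<bar>K x\<bar> \<le> C * tail_weight \<alpha> x"
proof -
  define p where "p = real CARD('n) + \<alpha>"
  have p: "0 < p" using assms by (simp add: p_def add_nonneg_pos)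
  obtain C where C: "0 \<le> C" "\<And>x. \<bar>K x\<bar> \<le> C * (1 + norm x) powr - p"
    using assms by (auto simp: order_bounded_def p_def)
  have le: "(1 + norm x) powr - p \<le> 2 * tail_weight \<alpha> x" for x :: "real^'n"
  proof -
    have "0 < 1 + norm x" by (simp add: add_pos_nonneg)
    then have pos: "1 + norm x \<noteq> 0" by linarith
    have "1 \<le> (1 + norm x) powr p" using p by (intro ge_one_powr_ge_zero) auto
    moreover have "norm x powr p \<le> (1 + norm x) powr p" using p by (intro powr_mono2) auto
    ultimately have "1 + norm x powr p \<le> 2 * (1 + norm x) powr p" by simp
    moreover have "0 < 1 + norm x powr p" "0 < (1 + norm x) powr p" by (simp_all add: add_pos_nonneg pos)
    moreover have "1 / b \<le> 2 / a" if "a \<le> 2 * b" "0 < a" "0 < b" for a b :: real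
      using that by (simp add: divide_simps)
    ultimately have "1 / (1 + norm x) powr p \<le> 2 / (1 + norm x powr p)" by blast
    then show ?thesis unfolding powr_minus_divide tail_weight_def by (simp add: p_def)
  qed
  have "\<bar>K x\<bar> \<le> (C * 2) * tail_weight \<alpha> x" for x
    using C(2)[of x] mult_left_mono[OF le[of x] C(1)] unfolding mult.assoc by linarith
  then show ?thesis using C(1) by (intro that[of "C * 2"]) auto
qed

lemma tail_weight_minus [simp]: "tail_weight \<alpha> (- x) = tail_weight \<alpha> x"
  by (simp add: tail_weight_def)

text \<open>All derivatives fall on the kernel, so integrability of \<open>u\<close> against the
  weight suffices. Each derivative of \<open>K\<close> is again bounded by the weight, and for
  \<open>x\<close> in a bounded set its translates are dominated by a multiple of the weight at
  \<open>y\<close>.\<close>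

lemma tail_partial_C:
  fixes u :: "real^'n::finite \<Rightarrow> real"
  assumes "0 < \<alpha>" and [measurable]: "u \<in> borel_measurable borel"
    and L: "integrable lborel (\<lambda>x. \<bar>u x\<bar> * tail_weight \<alpha> x)"
  shows "symbol k (- (real CARD('n) + \<alpha>)) K \<Longrightarrow> partial_C k (\<lambda>x. \<integral>y. u y * K (x - y) \<partial>lborel)"
proof (induction k arbitrary: K)
  case base: (0 K)
  show ?case unfolding partial_C.simps
  proof (rule continuous_on_integral)
    have [measurable]: "K \<in> borel_measurable borel"
      using base by (auto simp: order_bounded_def intro: borel_measurable_continuous_onI)
    show "(\<lambda>y. u y * K (x - y)) \<in> borel_measurable lborel" for x by measurable
    show "continuous_on UNIV (\<lambda>x. u y * K (x - y))" for y
      using base by (auto simp: order_bounded_def intro!: continuous_intros continuous_on_compose2[of UNIV K])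
    fix x0 :: "real^'n"
    obtain C where C: "0 \<le> C" "\<And>x. \<bar>K x\<bar> \<le> C * tail_weight \<alpha> x" using order_bounded_tail_weight[OF base[unfolded symbol.simps] assms(1)] by blast
    obtain D where D: "0 < D" "\<And>a x. norm a \<le> norm x0 + 1 \<Longrightarrow> tail_weight \<alpha> (x - a) \<le> D * tail_weight \<alpha> (x :: real^'n)"
      using tail_weight_translate_le[OF assms(1), of "norm x0 + 1"] by blast
    show "\<exists>g. integrable lborel g \<and> (\<forall>x y. dist x x0 < 1 \<longrightarrow> y \<in> space lborel \<longrightarrow> \<bar>u y * K (x - y)\<bar> \<le> g y)"
    proof (intro exI[of _ "\<lambda>y. (C * D) * (\<bar>u y\<bar> * tail_weight \<alpha> y)"] conjI allI impI)
      fix x y assume "dist x x0 < 1"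
      then have "norm x \<le> norm x0 + 1" using norm_triangle_sub[of x x0] by (simp add: dist_norm)
      then have "tail_weight \<alpha> (x - y) \<le> D * tail_weight \<alpha> y" using D(2)[of x y] tail_weight_minus[of \<alpha> "y - x"] by simp
      then have "C * tail_weight \<alpha> (x - y) \<le> C * (D * tail_weight \<alpha> y)" using C(1) by (rule mult_left_mono)
      then have "\<bar>K (x - y)\<bar> \<le> C * (D * tail_weight \<alpha> y)" using C(2)[of "x - y"] by simp
      then have "\<bar>u y\<bar> * \<bar>K (x - y)\<bar> \<le> \<bar>u y\<bar> * (C * (D * tail_weight \<alpha> y))" by (intro mult_left_mono) auto
      then show "\<bar>u y * K (x - y)\<bar> \<le> (C * D) * (\<bar>u y\<bar> * tail_weight \<alpha> y)" by (simp add: abs_mult mult_ac)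
    qed (use L in simp)
  qed
next
  case (Suc k K)
  have 1: "partial_C k (\<lambda>x. \<integral>y. u y * K (x - y) \<partial>lborel)" using Suc.IH[OF symbol_SucD[OF Suc.prems]] .
  have "\<exists>w'. has_partial i (\<lambda>x. \<integral>y. u y * K (x - y) \<partial>lborel) w' \<and> partial_C k w'" for i
  proof -
    obtain K' where K': "has_partial i K K'" "symbol k (- (real CARD('n) + \<alpha>)) K'" using Suc.prems by auto
    have mK[measurable]: "K \<in> borel_measurable borel" "K' \<in> borel_measurable borel"
      using symbol_order_bounded[OF K'(2)] symbol_order_bounded[OF Suc.prems] unfolding order_bounded_def by (simp_all add: borel_measurable_continuous_onI)
    obtain C where C: "0 \<le> C" "\<And>x. \<bar>K x\<bar> \<le> C * tail_weight \<alpha> x" using order_bounded_tail_weight[OF symbol_order_bounded[OF Suc.prems] assms(1)] by blast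
    obtain C' where C': "0 \<le> C'" "\<And>x. \<bar>K' x\<bar> \<le> C' * tail_weight \<alpha> x" using order_bounded_tail_weight[OF symbol_order_bounded[OF K'(2)] assms(1)] by blast
    have "has_partial i (\<lambda>x. \<integral>y. u y * K (x - y) \<partial>lborel) (\<lambda>x. \<integral>y. u y * K' (x - y) \<partial>lborel)"
      unfolding has_partial_def
    proof
      fix x :: "real^'n"
      have bnd: "\<exists>g. integrable lborel g \<and> (\<forall>t y. \<bar>t\<bar> \<le> r \<longrightarrow> \<bar>u y * K (x + t *\<^sub>R axis i 1 - y)\<bar> \<le> g y)"
        if "0 \<le> C" "\<And>x. \<bar>K x\<bar> \<le> C * tail_weight \<alpha> x" for C K r
      proof -
        obtain D where D: "0 < D" "\<And>a z. norm a \<le> norm x + r \<Longrightarrow> tail_weight \<alpha> (z - a) \<le> D * tail_weight \<alpha> (z :: real^'n)"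
          using tail_weight_translate_le[OF assms(1), of "norm x + r"] by blast
        show ?thesis
        proof (intro exI[of _ "\<lambda>y. (C * D) * (\<bar>u y\<bar> * tail_weight \<alpha> y)"] conjI allI impI)
          fix t y assume "\<bar>t\<bar> \<le> r"
          then have "norm (x + t *\<^sub>R axis i 1) \<le> norm x + r"
            using norm_triangle_ineq[of x "t *\<^sub>R axis i (1::real)"] by (simp add: norm_axis_1)
          then have "tail_weight \<alpha> (x + t *\<^sub>R axis i 1 - y) \<le> D * tail_weight \<alpha> y"
            using D(2)[of "x + t *\<^sub>R axis i 1" y] tail_weight_minus[of \<alpha> "y - (x + t *\<^sub>R axis i 1)"] by (simp only: minus_diff_eq)
          then have "C * tail_weight \<alpha> (x + t *\<^sub>R axis i 1 - y) \<le> C * (D * tail_weight \<alpha> y)" using that(1) by (rule mult_left_mono)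
          then have "\<bar>K (x + t *\<^sub>R axis i 1 - y)\<bar> \<le> C * (D * tail_weight \<alpha> y)"
            using that(2)[of "x + t *\<^sub>R axis i 1 - y"] by linarith
          then have "\<bar>u y\<bar> * \<bar>K (x + t *\<^sub>R axis i 1 - y)\<bar> \<le> \<bar>u y\<bar> * (C * (D * tail_weight \<alpha> y))" by (intro mult_left_mono) auto
          then show "\<bar>u y * K (x + t *\<^sub>R axis i 1 - y)\<bar> \<le> (C * D) * (\<bar>u y\<bar> * tail_weight \<alpha> y)" by (simp add: abs_mult mult_ac)
        qed (use L in simp)
      qed
      obtain g where g: "integrable lborel g" "\<And>t y. \<bar>t\<bar> \<le> 1 \<Longrightarrow> \<bar>u y * K' (x + t *\<^sub>R axis i 1 - y)\<bar> \<le> g y"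
        using bnd[OF C', of 1] by blast
      have "((\<lambda>t. \<integral>y. u y * K (x + t *\<^sub>R axis i 1 - y) \<partial>lborel) has_real_derivative
          (\<integral>y. u y * K' (x + 0 *\<^sub>R axis i 1 - y) \<partial>lborel)) (at 0)"
      proof (rule has_real_derivative_integral[where d=1])
        show "integrable lborel (\<lambda>y. u y * K (x + t *\<^sub>R axis i 1 - y))" for t
        proof -
          obtain h where h: "integrable lborel h" "\<And>y. \<bar>u y * K (x + t *\<^sub>R axis i 1 - y)\<bar> \<le> h y"
            using bnd[OF C, of "\<bar>t\<bar>"] by blast
          show ?thesis by (rule integrable_dominated[OF h(1) _ h(2)]) measurable
        qed
        show "((\<lambda>t. u y * K (x + t *\<^sub>R axis i 1 - y)) has_real_derivative u y * K' (x + t *\<^sub>R axis i 1 - y)) (at t)" for t y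
          using DERIV_cmult[OF has_partial_at[OF K'(1), of "x - y" t], of "u y"] by (simp add: algebra_simps)
        show "\<bar>u y * K' (x + t *\<^sub>R axis i 1 - y)\<bar> \<le> g y" if "\<bar>t - 0\<bar> < 1" for t y
          by (rule g(2)) (use that in simp)
        show "integrable lborel g" by (rule g(1))
        show "(\<lambda>y. u y * K' (x + 0 *\<^sub>R axis i 1 - y)) \<in> borel_measurable lborel" by measurable
      qed simp
      then show "((\<lambda>t. \<integral>y. u y * K (x + t *\<^sub>R axis i 1 - y) \<partial>lborel) has_real_derivative
          (\<integral>y. u y * K' (x - y) \<partial>lborel)) (at 0)" by simp
    qed
    with Suc.IH[OF K'(2)] show ?thesis by (intro exI conjI)
  qed
  with partial_C_continuous[OF 1] show ?case by simp
qed

section \<open>The singular near part of the kernel\<close>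

definition second_holder :: "real \<Rightarrow> (real^'n::finite \<Rightarrow> real) \<Rightarrow> bool" where
  "second_holder \<sigma> u \<longleftrightarrow> continuous_on UNIV u \<and>
    (\<forall>r. \<exists>C. \<forall>x y. norm x \<le> r \<longrightarrow> norm y \<le> r \<longrightarrow> \<bar>sdiff u x y\<bar> \<le> C * norm y powr \<sigma>)"

text \<open>Differentiating the singular part puts the derivative on \<open>u\<close>, so the
  derivatives up to order \<open>k\<close> have to obey the same second order bound as
  \<open>u\<close> itself.\<close>

primrec second_holder_C :: "real \<Rightarrow> nat \<Rightarrow> (real^'n::finite \<Rightarrow> real) \<Rightarrow> bool" where
  "second_holder_C \<sigma> 0 u \<longleftrightarrow> second_holder \<sigma> u"
| "second_holder_C \<sigma> (Suc k) u \<longleftrightarrow> second_holder \<sigma> u \<and> (\<forall>i. \<exists>w. has_partial i u w \<and> second_holder_C \<sigma> k w)"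

lemma second_holder_C_base: "second_holder_C \<sigma> k u \<Longrightarrow> second_holder \<sigma> u"
  by (cases k) auto

lemma second_holder_C_partial_C: "second_holder_C \<sigma> k u \<Longrightarrow> partial_C k u"
proof (induction k arbitrary: u)
  case (Suc k)
  then show ?case by (auto simp: second_holder_def, blast)
qed (simp add: second_holder_def)

locale near_kernel =
  fixes \<alpha> \<sigma> C0 :: real and k0 :: "real^'n::finite \<Rightarrow> real"
  assumes \<sigma>: "\<alpha> < \<sigma>" "\<sigma> \<le> \<alpha> + real CARD('n)"
    and mk[measurable]: "k0 \<in> borel_measurable borel"
    and k0: "\<And>y. \<bar>k0 y\<bar> \<le> C0 * (indicator (ball 0 1) y * norm y powr - (real CARD('n) + \<alpha>))"
begin

text \<open>The orders combine to |y|^(\<sigma> - \<alpha> - n) on the unit ball, integrable since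
  \<sigma> > \<alpha>. One majorant for all \<open>x\<close> of a ball serves both continuity and
  differentiation under the integral.\<close>

lemma majorant:
  assumes "second_holder \<sigma> u"
  shows "\<exists>g. integrable lborel g \<and> (\<forall>x y. norm x \<le> r \<longrightarrow> \<bar>sdiff u x y * k0 y\<bar> \<le> g y)"
proof -
  obtain C where C: "\<And>x y. norm x \<le> max r 1 \<Longrightarrow> norm y \<le> max r 1 \<Longrightarrow> \<bar>sdiff u x y\<bar> \<le> C * norm y powr \<sigma>"
    using \<open>second_holder \<sigma> u\<close> unfolding second_holder_def by meson
  define g where "g y = (\<bar>C\<bar> * \<bar>C0\<bar>) * (indicator (ball 0 1) y * norm y powr (\<sigma> - \<alpha> - real CARD('n)))" for y :: "real^'n"
  have "integrable lborel g"
    unfolding g_def using integrable_norm_powr_inside[of "\<sigma> - \<alpha>", where 'a="real^'n"] \<sigma> by simp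
  moreover have "\<bar>sdiff u x y * k0 y\<bar> \<le> g y" if "norm x \<le> r" for x y
  proof (cases "norm y < 1")
    case True
    have "\<bar>sdiff u x y\<bar> \<le> C * norm y powr \<sigma>" using C[of x y] that True by simp
    also have "\<dots> \<le> \<bar>C\<bar> * norm y powr \<sigma>" by (intro mult_right_mono) auto
    finally have 1: "\<bar>sdiff u x y\<bar> \<le> \<bar>C\<bar> * norm y powr \<sigma>" .
    have "\<bar>k0 y\<bar> \<le> C0 * norm y powr - (real CARD('n) + \<alpha>)" using k0[of y] True by simp
    also have "\<dots> \<le> \<bar>C0\<bar> * norm y powr - (real CARD('n) + \<alpha>)" by (intro mult_right_mono) auto
    finally have "\<bar>k0 y\<bar> \<le> \<bar>C0\<bar> * norm y powr - (real CARD('n) + \<alpha>)" .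
    with 1 have "\<bar>sdiff u x y\<bar> * \<bar>k0 y\<bar> \<le> (\<bar>C\<bar> * norm y powr \<sigma>) * (\<bar>C0\<bar> * norm y powr - (real CARD('n) + \<alpha>))"
      by (intro mult_mono) auto
    also have "\<dots> = (\<bar>C\<bar> * \<bar>C0\<bar>) * (norm y powr \<sigma> * norm y powr - (real CARD('n) + \<alpha>))" by (simp only: mult_ac)
    also have "norm y powr \<sigma> * norm y powr - (real CARD('n) + \<alpha>) = norm y powr (\<sigma> - \<alpha> - real CARD('n))"
      unfolding powr_add[symmetric] by (simp add: algebra_simps)
    finally show ?thesis using True by (simp add: g_def abs_mult)
  next
    case False
    then show ?thesis using k0[of y] by (simp add: g_def)
  qed
  ultimately show ?thesis by blast
qed

lemma near_integrable:
  assumes "second_holder \<sigma> u"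
  shows "integrable lborel (\<lambda>y. sdiff u x y * k0 y)"
proof -
  have [measurable]: "u \<in> borel_measurable borel" using assms by (simp add: second_holder_def borel_measurable_continuous_onI)
  obtain h where h: "integrable lborel h" "\<And>z y. norm z \<le> norm x \<Longrightarrow> \<bar>sdiff u z y * k0 y\<bar> \<le> h y"
    using majorant[OF assms] by blast
  show ?thesis
  proof (rule integrable_dominated[OF h(1) _ h(2)[OF order_refl]])
    show "(\<lambda>y. sdiff u x y * k0 y) \<in> borel_measurable lborel"
      unfolding sdiff_def by measurable
  qed
qed

lemma near_continuous:
  assumes "second_holder \<sigma> u"
  shows "continuous_on UNIV (\<lambda>x. \<integral>y. sdiff u x y * k0 y \<partial>lborel)"
proof (rule continuous_on_integral)
  show "(\<lambda>y. sdiff u x y * k0 y) \<in> borel_measurable lborel" for x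
    using near_integrable[OF assms] by (rule borel_measurable_integrable)
  have c: "continuous_on UNIV u" using assms by (simp add: second_holder_def)
  show "continuous_on UNIV (\<lambda>x. sdiff u x y * k0 y)" for y
    unfolding sdiff_def by (intro continuous_intros continuous_on_compose2[OF c]) auto
  fix x0 :: "real^'n"
  obtain g where g: "integrable lborel g" "\<And>x y. norm x \<le> norm x0 + 1 \<Longrightarrow> \<bar>sdiff u x y * k0 y\<bar> \<le> g y"
    using majorant[OF assms] by blast
  have "norm x \<le> norm x0 + 1" if "dist x x0 < 1" for x
    using norm_triangle_sub[of x x0] that by (simp add: dist_norm)
  with g show "\<exists>g. integrable lborel g \<and> (\<forall>x y. dist x x0 < 1 \<longrightarrow> y \<in> space lborel \<longrightarrow> \<bar>sdiff u x y * k0 y\<bar> \<le> g y)"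
    by blast
qed

text \<open>The derivative acts on \<open>x\<close> alone and so commutes with the second
  difference; the majorant for \<open>w\<close> then justifies differentiation under the
  integral.\<close>

lemma near_has_partial:
  assumes "has_partial i u w" "second_holder \<sigma> u" "second_holder \<sigma> w"
  shows "has_partial i (\<lambda>x. \<integral>y. sdiff u x y * k0 y \<partial>lborel) (\<lambda>x. \<integral>y. sdiff w x y * k0 y \<partial>lborel)"
  unfolding has_partial_def
proof
  fix x :: "real^'n"
  have nx: "norm (x + t *\<^sub>R axis i 1) \<le> norm x + \<bar>t\<bar>" for t
    using norm_triangle_ineq[of x "t *\<^sub>R axis i (1::real)"] by simp
  obtain g where g: "integrable lborel g" "\<And>z y. norm z \<le> norm x + 1 \<Longrightarrow> \<bar>sdiff w z y * k0 y\<bar> \<le> g y"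
    using majorant[OF assms(3)] by blast
  have "((\<lambda>t. \<integral>y. sdiff u (x + t *\<^sub>R axis i 1) y * k0 y \<partial>lborel) has_real_derivative
      (\<integral>y. sdiff w (x + 0 *\<^sub>R axis i 1) y * k0 y \<partial>lborel)) (at 0)"
  proof (rule has_real_derivative_integral[where d=1])
    show "integrable lborel (\<lambda>y. sdiff u (x + t *\<^sub>R axis i 1) y * k0 y)" for t
      by (rule near_integrable[OF assms(2)])
    show "((\<lambda>t. sdiff u (x + t *\<^sub>R axis i 1) y * k0 y) has_real_derivative sdiff w (x + t *\<^sub>R axis i 1) y * k0 y) (at t)" for t y
    proof -
      have "((\<lambda>t. (2 * u (x + t *\<^sub>R axis i 1) - u ((x + y) + t *\<^sub>R axis i 1) - u ((x - y) + t *\<^sub>R axis i 1)) * k0 y)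
        has_real_derivative (2 * w (x + t *\<^sub>R axis i 1) - w ((x + y) + t *\<^sub>R axis i 1) - w ((x - y) + t *\<^sub>R axis i 1)) * k0 y) (at t)"
        by (intro DERIV_cmult_right DERIV_diff DERIV_cmult has_partial_at[OF assms(1)])
      then show ?thesis unfolding sdiff_def by (simp add: algebra_simps)
    qed
    show "\<bar>sdiff w (x + t *\<^sub>R axis i 1) y * k0 y\<bar> \<le> g y" if "\<bar>t - 0\<bar> < 1" for t y
      by (rule g(2)) (use that nx[of t] in simp)
    show "integrable lborel g" by (rule g(1))
    show "(\<lambda>y. sdiff w (x + 0 *\<^sub>R axis i 1) y * k0 y) \<in> borel_measurable lborel"
      by (rule borel_measurable_integrable[OF near_integrable[OF assms(3)]])
  qed simp
  then show "((\<lambda>t. \<integral>y. sdiff u (x + t *\<^sub>R axis i 1) y * k0 y \<partial>lborel) has_real_derivative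
      (\<integral>y. sdiff w x y * k0 y \<partial>lborel)) (at 0)" by simp
qed

lemma near_partial_C: "second_holder_C \<sigma> k u \<Longrightarrow> partial_C k (\<lambda>x. \<integral>y. sdiff u x y * k0 y \<partial>lborel)"
proof (induction k arbitrary: u)
  case (Suc k u)
  have "\<exists>w'. has_partial i (\<lambda>x. \<integral>y. sdiff u x y * k0 y \<partial>lborel) w' \<and> partial_C k w'" for i
  proof -
    obtain w where w: "has_partial i u w" "second_holder_C \<sigma> k w" using Suc.prems by auto
    from near_has_partial[OF w(1) second_holder_C_base[OF Suc.prems] second_holder_C_base[OF w(2)]] Suc.IH[OF w(2)]
    show ?thesis by (intro exI conjI)
  qed
  with near_continuous[OF second_holder_C_base[OF Suc.prems]] show ?case by simp
qed (simp add: near_continuous)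

end

text \<open>Away from 0 the kernel is \<open>k0 + K\<close>. The part with \<open>k0\<close> stays a
  second difference integral over the unit ball. Against the smooth, even and integrable
  \<open>K\<close> the second difference may be expanded, which leaves 2 u times the integral of
  \<open>K\<close> minus twice the convolution of \<open>u\<close> with \<open>K\<close>.\<close>

lemma sym_frac_lap_partial_C:
  fixes u :: "real^'n::finite \<Rightarrow> real"
  assumes "frac_admissible \<alpha> \<sigma> u" "second_holder_C \<sigma> k u"
  shows "partial_C k (sym_frac_lap \<alpha> u)"
proof -
  interpret frac_admissible \<alpha> \<sigma> u by fact
  define \<beta> where "\<beta> = (real CARD('n) + \<alpha>) / 2"
  have \<beta>: "0 < \<beta>" using \<alpha> by (simp add: \<beta>_def add_nonneg_pos)
  \<comment> \<open>The Taylor order \<open>Suc k\<close> is the least for which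
    \<open>symbol_kernel_profile\<close> yields \<open>k\<close> derivatives.\<close>
  define K where "K y = kernel_profile \<beta> (Suc k) 0 (norm y ^ 2)" for y :: "real^'n"
  \<comment> \<open>At 0 the power majorant evaluates to 0 by the convention for
    \<open>powr\<close>, so \<open>k0\<close> must be 0 there; \<open>riesz \<alpha> 0 - K 0\<close>
    would be \<open>- K 0\<close>.\<close>
  define k0 where "k0 y = (if y = 0 then 0 else riesz \<alpha> y - K y)" for y
  have "- 2 * (\<beta> + real 0) = - (real CARD('n) + \<alpha>)" by (simp add: \<beta>_def)
  with symbol_kernel_profile[of k 0 "Suc k" \<beta>, where 'n='n] \<beta> have sK: "symbol k (- (real CARD('n) + \<alpha>)) K"
    unfolding K_def[abs_def] by simp
  have oK: "order_bounded (- (real CARD('n) + \<alpha>)) K" using symbol_order_bounded[OF sK] .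
  have mK[measurable]: "K \<in> borel_measurable borel"
    using oK unfolding order_bounded_def by (simp add: borel_measurable_continuous_onI)
  have mk0[measurable]: "k0 \<in> borel_measurable borel" unfolding k0_def[abs_def] by measurable
  have Kfar: "K y = riesz \<alpha> y" if "1 \<le> norm y" for y
  proof -
    have "1 \<le> norm y ^ 2" using that by simp
    then have "K y = (norm y powr 2) powr - \<beta>" using that by (auto simp: K_def kernel_profile_def powr_deriv_coeff_def)
    moreover have e: "2 * - \<beta> = - (real CARD('n) + \<alpha>)" by (simp add: \<beta>_def field_simps)
    have "(norm y powr 2) powr - \<beta> = riesz \<alpha> y" unfolding powr_powr riesz_def e by simp
    ultimately show ?thesis by simp
  qed
  obtain M where M: "0 \<le> M" "\<And>x. \<bar>K x\<bar> \<le> M * tail_weight \<alpha> x" using order_bounded_tail_weight[OF oK \<alpha>(1)] by blast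
  have k0: "\<bar>k0 y\<bar> \<le> (1 + M) * (indicator (ball 0 1) y * norm y powr - (real CARD('n) + \<alpha>))" for y
  proof (cases "y = 0 \<or> 1 \<le> norm y")
    case True
    then show ?thesis using Kfar[of y] by (auto simp: k0_def)
  next
    case False
    have p: "0 < real CARD('n) + \<alpha>" using \<alpha> by (simp add: add_nonneg_pos)
    have "tail_weight \<alpha> y \<le> 1" by (simp add: tail_weight_def add_pos_nonneg)
    then have "\<bar>K y\<bar> \<le> M * 1" using M mult_left_mono order_trans by blast
    moreover have "1 \<le> norm y powr - (real CARD('n) + \<alpha>)"
      using powr_mono2'[of "- (real CARD('n) + \<alpha>)" "norm y" 1] p False by auto
    then have "M * 1 \<le> M * norm y powr - (real CARD('n) + \<alpha>)" using M(1) by (rule mult_left_mono)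
    ultimately have "\<bar>K y\<bar> \<le> M * norm y powr - (real CARD('n) + \<alpha>)" by linarith
    moreover have "riesz \<alpha> y = norm y powr - (real CARD('n) + \<alpha>)" by (simp add: riesz_def)
    ultimately have "\<bar>riesz \<alpha> y - K y\<bar> \<le> (1 + M) * norm y powr - (real CARD('n) + \<alpha>)"
      unfolding distrib_right using riesz_nonneg[of \<alpha> y] by linarith
    then show ?thesis using False by (simp add: k0_def)
  qed
  interpret N: near_kernel \<alpha> \<sigma> "1 + M" k0
    by unfold_locales (use \<sigma> mk0 k0 in auto)
  have iK: "integrable lborel K"
    by (rule integrable_dominated[OF integrable_mult_right[OF integrable_tail_weight[OF \<alpha>(1)]] _ M(2)]) measurable
  have iuK: "integrable lborel (\<lambda>y. u y * K (x - y))" for x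
  proof -
    obtain D where D: "0 < D" "\<And>z. tail_weight \<alpha> (z - x) \<le> D * tail_weight \<alpha> z"
      using tail_weight_translate_le[OF \<alpha>(1), of "norm x", where 'a="real^'n"] by blast
    show ?thesis
    proof (rule integrable_dominated)
      show "integrable lborel (\<lambda>y. (M * D) * (\<bar>u y\<bar> * tail_weight \<alpha> y))" using L by simp
      show "\<bar>u y * K (x - y)\<bar> \<le> (M * D) * (\<bar>u y\<bar> * tail_weight \<alpha> y)" for y
      proof -
        have "\<bar>K (x - y)\<bar> \<le> M * tail_weight \<alpha> (x - y)" by (rule M)
        also have "tail_weight \<alpha> (x - y) = tail_weight \<alpha> (y - x)" using tail_weight_minus[of \<alpha> "x - y"] by simp
        also have "M * tail_weight \<alpha> (y - x) \<le> M * (D * tail_weight \<alpha> y)" using D(2) M(1) by (rule mult_left_mono)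
        finally have "\<bar>u y\<bar> * \<bar>K (x - y)\<bar> \<le> \<bar>u y\<bar> * (M * (D * tail_weight \<alpha> y))" by (rule mult_left_mono) simp
        then show ?thesis by (simp add: abs_mult mult_ac)
      qed
    qed measurable
  qed
  have Keven: "K (- y) = K y" for y by (simp add: K_def)
  have eq: "sym_frac_lap \<alpha> u x = (\<integral>y. sdiff u x y * k0 y \<partial>lborel) + (2 * integral\<^sup>L lborel K * u x + (- 2) * (\<integral>y. u y * K (x - y) \<partial>lborel))" for x
  proof -
    have a1: "integrable lborel (\<lambda>y. u (x + y) * K y)"
      using lborel_integrable_translate(2)[OF iuK[of x], of x] by (simp add: Keven)
    have a2: "integrable lborel (\<lambda>y. u (x - y) * K y)"
      using lborel_integrable_translate(3)[OF iuK[of x], of x] by simp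
    have b1: "(\<integral>y. u (x + y) * K y \<partial>lborel) = (\<integral>y. u y * K (x - y) \<partial>lborel)"
      using lborel_integral_translate(2)[of "\<lambda>y. u y * K (x - y)" x] by (simp add: Keven)
    have b2: "(\<integral>y. u (x - y) * K y \<partial>lborel) = (\<integral>y. u y * K (x - y) \<partial>lborel)"
      using lborel_integral_translate(3)[of "\<lambda>y. u y * K (x - y)" x] by simp
    have e: "sdiff u x y * K y = 2 * u x * K y - u (x + y) * K y - u (x - y) * K y" for y
      by (simp add: sdiff_def algebra_simps)
    have c1: "integrable lborel (\<lambda>y. sdiff u x y * K y)"
      unfolding e using iK a1 a2 by simp
    have c2: "(\<integral>y. sdiff u x y * K y \<partial>lborel) = 2 * integral\<^sup>L lborel K * u x + (- 2) * (\<integral>y. u y * K (x - y) \<partial>lborel)"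
      unfolding e using iK a1 a2 b1 b2 by simp
    have e2: "sdiff u x y * k0 y = sdiff u x y * riesz \<alpha> y - sdiff u x y * K y" for y
      by (cases "y = 0") (auto simp: k0_def algebra_simps)
    have "(\<integral>y. sdiff u x y * k0 y \<partial>lborel) = sym_frac_lap \<alpha> u x - (\<integral>y. sdiff u x y * K y \<partial>lborel)"
      unfolding e2 sym_frac_lap_def using integrable_sdiff[of x] c1 by simp
    then show ?thesis using c2 by simp
  qed
  have "partial_C k (\<lambda>x. (\<integral>y. sdiff u x y * k0 y \<partial>lborel) + (2 * integral\<^sup>L lborel K * u x + (- 2) * (\<integral>y. u y * K (x - y) \<partial>lborel)))"
    using N.near_partial_C[OF assms(2)] tail_partial_C[OF \<alpha>(1) meas L sK]
    by (intro partial_C_add partial_C_cmult second_holder_C_partial_C[OF assms(2)]) auto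
  moreover have "sym_frac_lap \<alpha> u = (\<lambda>x. (\<integral>y. sdiff u x y * k0 y \<partial>lborel) + (2 * integral\<^sup>L lborel K * u x + (- 2) * (\<integral>y. u y * K (x - y) \<partial>lborel)))"
    using eq by (rule ext)
  ultimately show ?thesis by (simp only:)
qed

section \<open>From Hoelder classes to second differences\<close>

lemma directional_derivative:
  fixes w :: "real^'n::finite \<Rightarrow> real"
  assumes "\<And>x. w differentiable (at x)"
  shows "((\<lambda>t. w (x + t *\<^sub>R h)) has_real_derivative (\<Sum>i\<in>UNIV. h $ i * partial_deriv i w (x + t *\<^sub>R h))) (at t)"
proof -
  let ?z = "x + t *\<^sub>R h"
  obtain D where D: "(w has_derivative D) (at ?z)" using assms by (auto simp: differentiable_def)
  have lin: "linear D" using D has_derivative_linear by blast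
  have line: "((\<lambda>s. w (z + s *\<^sub>R k)) has_real_derivative D k) (at s)" if "z + s *\<^sub>R k = ?z" for z k s
  proof -
    have "((\<lambda>s. z + s *\<^sub>R k) has_derivative (\<lambda>s. s *\<^sub>R k)) (at s)"
      by (auto intro!: derivative_eq_intros)
    moreover have "(w has_derivative D) (at (z + s *\<^sub>R k))" using D that by simp
    ultimately have "((\<lambda>s. w (z + s *\<^sub>R k)) has_derivative (\<lambda>s. D (s *\<^sub>R k))) (at s)"
      by (rule has_derivative_compose)
    moreover have "(\<lambda>s. D (s *\<^sub>R k)) = (*) (D k)"
      using lin by (simp add: fun_eq_iff linear_cmul mult.commute)
    ultimately show ?thesis unfolding has_field_derivative_def by simp
  qed
  have "partial_deriv i w ?z = D (axis i 1)" for i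
    unfolding partial_deriv_def using line[of ?z 0 "axis i 1"] by (intro DERIV_imp_deriv) simp
  moreover have "D h = (\<Sum>i\<in>UNIV. h $ i * D (axis i 1))"
  proof -
    have "h = (\<Sum>i\<in>UNIV. h $ i *\<^sub>R axis i 1)"
      using basis_expansion[of h] by (simp add: scalar_mult_eq_scaleR)
    then have "D h = D (\<Sum>i\<in>UNIV. h $ i *\<^sub>R axis i 1)" by simp
    also have "\<dots> = (\<Sum>i\<in>UNIV. D (h $ i *\<^sub>R axis i 1))" using lin by (rule linear_sum)
    finally show ?thesis using lin by (simp add: linear_cmul)
  qed
  ultimately show ?thesis using line[of x t h] by simp
qed

lemma C_k_SucD: "C_k (Suc k) u \<Longrightarrow> C_k k u"
proof (induction k arbitrary: u)
  case 0
  then show ?case by (auto simp: differentiable_imp_continuous_within continuous_on_eq_continuous_within)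
qed auto

lemma C_k_continuous: "C_k k u \<Longrightarrow> continuous_on UNIV u"
  by (induction k) (simp, blast dest: C_k_SucD)

lemma C_k_iter_partial: "C_k (length is + j) u \<Longrightarrow> C_k j (iter_partial is u)"
proof (induction "is" arbitrary: u rule: rev_induct)
  case (snoc i js)
  then show ?case by (simp add: iter_partial_def)
qed (simp add: iter_partial_def)

text \<open>Mean value theorem along the segment, which stays in the ball by convexity; the
  dimension counts the summands of the directional derivative.\<close>

lemma bounded_partial_lipschitz:
  fixes w :: "real^'n::finite \<Rightarrow> real"
  assumes "\<And>x. w differentiable (at x)" "\<And>i x. norm x \<le> r \<Longrightarrow> \<bar>partial_deriv i w x\<bar> \<le> B"
    and "norm x \<le> r" "norm y \<le> r"
  shows "\<bar>w x - w y\<bar> \<le> real CARD('n) * B * norm (x - y)"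
proof -
  let ?d = "\<lambda>t. \<Sum>i\<in>UNIV. (x - y) $ i * partial_deriv i w (y + t *\<^sub>R (x - y))"
  have "\<exists>z>0. z < 1 \<and> w (y + 1 *\<^sub>R (x - y)) - w (y + 0 *\<^sub>R (x - y)) = (1 - 0) * ?d z"
    by (rule MVT2) (use directional_derivative[OF assms(1), of y "x - y"] in auto)
  then obtain t where t: "0 < t" "t < 1" "w x - w y = ?d t" by auto
  have "y + t *\<^sub>R (x - y) = (1 - t) *\<^sub>R y + t *\<^sub>R x" by (simp add: algebra_simps)
  then have nr: "norm (y + t *\<^sub>R (x - y)) \<le> r"
    using assms(3,4) t convexD[OF convex_cball[of 0 r], of y x "1 - t" t] by simp
  have "\<bar>?d t\<bar> \<le> (\<Sum>i\<in>(UNIV::'n set). norm (x - y) * B)"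
  proof (rule order_trans[OF sum_abs sum_mono])
    fix i
    show "\<bar>(x - y) $ i * partial_deriv i w (y + t *\<^sub>R (x - y))\<bar> \<le> norm (x - y) * B"
      unfolding abs_mult using component_le_norm_cart[of "x - y" i] assms(2)[OF nr, of i] by (intro mult_mono) auto
  qed
  then show ?thesis using t(3) by (simp add: mult_ac)
qed

lemma locally_holder_ball:
  assumes "locally_holder \<gamma> v"
  shows "\<exists>C. \<forall>x y. norm x \<le> r \<longrightarrow> norm y \<le> r \<longrightarrow> \<bar>v x - v y\<bar> \<le> C * dist x y powr \<gamma>"
proof -
  obtain C where "\<forall>x\<in>cball 0 r. \<forall>y\<in>cball 0 r. \<bar>v x - v y\<bar> \<le> C * dist x y powr \<gamma>"
    using assms compact_cball unfolding locally_holder_def by blast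
  then show ?thesis by (intro exI[of _ C]) simp
qed

text \<open>On a bounded set |x - y| is the product of |x - y|^(1 - \<gamma>), which is bounded, and
  |x - y|^\<gamma>.\<close>

lemma C1_locally_holder:
  assumes "C_k 1 w" "0 < \<gamma>" "\<gamma> \<le> 1"
  shows "locally_holder \<gamma> (w :: real^'n::finite \<Rightarrow> real)"
  unfolding locally_holder_def
proof (intro allI impI)
  fix K :: "(real^'n) set" assume K: "compact K"
  obtain r where r: "\<And>x. x \<in> K \<Longrightarrow> norm x \<le> r" using compact_imp_bounded[OF K] unfolding bounded_iff by blast
  have d: "w differentiable (at x)" "continuous_on UNIV (partial_deriv i w)" for x i using assms(1) by auto
  have "\<exists>B. \<forall>x. norm x \<le> r \<longrightarrow> \<bar>partial_deriv i w x\<bar> \<le> B" for i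
    using continuous_bounded_cball[OF d(2)[of i], of 0 r] by (metis dist_0_norm)
  then obtain B where B: "\<And>i x. norm x \<le> r \<Longrightarrow> \<bar>partial_deriv i w x\<bar> \<le> B i" by metis
  have BM: "\<bar>partial_deriv i w x\<bar> \<le> (\<Sum>i\<in>UNIV. \<bar>B i\<bar>)" if "norm x \<le> r" for i x
  proof -
    have "\<bar>B i\<bar> \<le> (\<Sum>i\<in>UNIV. \<bar>B i\<bar>)" by (rule member_le_sum) auto
    then show ?thesis using B[OF that, of i] by linarith
  qed
  let ?M = "real CARD('n) * (\<Sum>i\<in>UNIV. \<bar>B i\<bar>)"
  show "\<exists>C. \<forall>x\<in>K. \<forall>y\<in>K. \<bar>w x - w y\<bar> \<le> C * dist x y powr \<gamma>"
  proof (intro exI[of _ "?M * (2 * \<bar>r\<bar>) powr (1 - \<gamma>)"] ballI)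
    fix x y assume xy: "x \<in> K" "y \<in> K"
    have "norm (x - y) \<le> 2 * \<bar>r\<bar>" using norm_triangle_ineq4[of x y] r[OF xy(1)] r[OF xy(2)] by linarith
    then have "norm (x - y) powr (1 - \<gamma>) \<le> (2 * \<bar>r\<bar>) powr (1 - \<gamma>)" using assms by (intro powr_mono2) auto
    moreover have "norm (x - y) = norm (x - y) powr (1 - \<gamma>) * norm (x - y) powr \<gamma>"
      by (simp flip: powr_add)
    ultimately have "norm (x - y) \<le> (2 * \<bar>r\<bar>) powr (1 - \<gamma>) * norm (x - y) powr \<gamma>"
      by (metis mult_right_mono powr_ge_zero)
    then have "?M * norm (x - y) \<le> ?M * ((2 * \<bar>r\<bar>) powr (1 - \<gamma>) * norm (x - y) powr \<gamma>)"
      by (intro mult_left_mono) (auto intro!: sum_nonneg)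
    moreover have "\<bar>w x - w y\<bar> \<le> ?M * norm (x - y)"
      by (rule bounded_partial_lipschitz[OF d(1) BM]) (use r xy in auto)
    ultimately show "\<bar>w x - w y\<bar> \<le> ?M * (2 * \<bar>r\<bar>) powr (1 - \<gamma>) * dist x y powr \<gamma>"
      unfolding dist_norm mult.assoc by linarith
  qed
qed

text \<open>The class restricts the Hoelder modulus at the top order only, so the order below has to
  be recovered from its continuous derivatives through \<open>C1_locally_holder\<close>.\<close>

lemma C_holder_loc_SucD:
  assumes "u \<in> C_holder_loc (Suc k) \<gamma>" "0 < \<gamma>" "\<gamma> \<le> 1"
  shows "u \<in> C_holder_loc k \<gamma>"
  unfolding C_holder_loc_def
proof (intro CollectI conjI allI impI)
  have C: "C_k (Suc k) u" using assms by (simp add: C_holder_loc_def)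
  then show "C_k k u" by (rule C_k_SucD)
  fix "is" :: "'a list" assume "length is = k"
  then have "C_k 1 (iter_partial is u)" using C by (intro C_k_iter_partial) simp
  then show "locally_holder \<gamma> (iter_partial is u)" using assms by (intro C1_locally_holder)
qed

lemma C_holder_loc_partial:
  assumes "u \<in> C_holder_loc (Suc k) \<gamma>"
  shows "partial_deriv i u \<in> C_holder_loc k \<gamma>" "has_partial i u (partial_deriv i u)"
proof -
  have u: "C_k (Suc k) u" "\<And>is. length is = Suc k \<Longrightarrow> locally_holder \<gamma> (iter_partial is u)"
    using assms by (auto simp: C_holder_loc_def)
  have "locally_holder \<gamma> (iter_partial is (partial_deriv i u))" if "length is = k" for "is"
    \<comment> \<open>\<open>iter_partial\<close> folds from the right, so the appended coordinate
      is the one differentiated first.\<close>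
    using u(2)[of "is @ [i]"] that by (simp add: iter_partial_def)
  then show "partial_deriv i u \<in> C_holder_loc k \<gamma>" using u(1) by (simp add: C_holder_loc_def)
  show "has_partial i u (partial_deriv i u)" using u(1) by (intro C_k_has_partial) simp
qed

lemma C_holder_loc_mono:
  assumes "u \<in> C_holder_loc (k + j) \<gamma>" "0 < \<gamma>" "\<gamma> \<le> 1"
  shows "u \<in> C_holder_loc j \<gamma>"
  using assms by (induction k) (auto dest: C_holder_loc_SucD)

lemma C_holder_loc_0_second_holder:
  assumes "u \<in> C_holder_loc 0 \<gamma>"
  shows "second_holder \<gamma> u"
  unfolding second_holder_def
proof (intro conjI allI)
  have u: "C_k 0 u" "locally_holder \<gamma> u" using assms by (auto simp: C_holder_loc_def iter_partial_def)
  then show "continuous_on UNIV u" by simp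
  fix r :: real
  obtain C where C: "\<And>x y. norm x \<le> 2 * r \<Longrightarrow> norm y \<le> 2 * r \<Longrightarrow> \<bar>u x - u y\<bar> \<le> C * dist x y powr \<gamma>"
    using locally_holder_ball[OF u(2), of "2 * r"] by blast
  show "\<exists>C. \<forall>x y. norm x \<le> r \<longrightarrow> norm y \<le> r \<longrightarrow> \<bar>sdiff u x y\<bar> \<le> C * norm y powr \<gamma>"
  proof (intro exI[of _ "2 * C"] allI impI)
    fix x y :: "real^'a" assume xy: "norm x \<le> r" "norm y \<le> r"
    have "norm (x + y) \<le> 2 * r" "norm (x - y) \<le> 2 * r" "norm x \<le> 2 * r"
      using norm_triangle_ineq[of x y] norm_triangle_ineq4[of x y] xy norm_ge_zero[of x] by linarith+
    then have "\<bar>u x - u (x + y)\<bar> \<le> C * norm y powr \<gamma>" "\<bar>u x - u (x - y)\<bar> \<le> C * norm y powr \<gamma>"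
      using C[of x "x + y"] C[of x "x - y"] by (simp_all add: dist_norm)
    then show "\<bar>sdiff u x y\<bar> \<le> 2 * C * norm y powr \<gamma>" unfolding sdiff_def by linarith
  qed
qed

text \<open>The mean value theorem for u(x + t y) + u(x - t y) as a function of t expresses the
  second difference through \<open>y\<close> times the difference of the gradients at x + t y and x
  - t y, two points at distance at most 2 |y|.\<close>

lemma C_holder_loc_1_second_holder:
  assumes "u \<in> C_holder_loc 1 \<gamma>" "0 < \<gamma>"
  shows "second_holder (1 + \<gamma>) (u :: real^'n::finite \<Rightarrow> real)"
  unfolding second_holder_def
proof (intro conjI allI)
  have u: "C_k 1 u" "\<And>i. locally_holder \<gamma> (partial_deriv i u)"
  proof -
    show "C_k 1 u" using assms by (simp add: C_holder_loc_def)
    fix i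
    have "locally_holder \<gamma> (iter_partial [i] u)" using assms unfolding C_holder_loc_def by fastforce
    then show "locally_holder \<gamma> (partial_deriv i u)" by (simp add: iter_partial_def)
  qed
  then have d: "u differentiable (at x)" for x by simp
  show "continuous_on UNIV u" using u(1) by (rule C_k_continuous)
  fix r :: real
  have "\<exists>C. \<forall>x y. norm x \<le> 2 * r \<longrightarrow> norm y \<le> 2 * r \<longrightarrow> \<bar>partial_deriv i u x - partial_deriv i u y\<bar> \<le> C * dist x y powr \<gamma>" for i
    by (rule locally_holder_ball[OF u(2)])
  then obtain C where C: "\<And>i x y. norm x \<le> 2 * r \<Longrightarrow> norm y \<le> 2 * r \<Longrightarrow> \<bar>partial_deriv i u x - partial_deriv i u y\<bar> \<le> C i * dist x y powr \<gamma>"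
    by metis
  show "\<exists>C. \<forall>x y. norm x \<le> r \<longrightarrow> norm y \<le> r \<longrightarrow> \<bar>sdiff u x y\<bar> \<le> C * norm y powr (1 + \<gamma>)"
  proof (intro exI[of _ "(\<Sum>i\<in>UNIV. \<bar>C i\<bar>) * 2 powr \<gamma>"] allI impI)
    fix x y :: "real^'n" assume xy: "norm x \<le> r" "norm y \<le> r"
    let ?h = "\<lambda>t. u (x + t *\<^sub>R y) + u (x + t *\<^sub>R (- y))"
    let ?d = "\<lambda>t. (\<Sum>i\<in>UNIV. y $ i * partial_deriv i u (x + t *\<^sub>R y)) + (\<Sum>i\<in>UNIV. (- y) $ i * partial_deriv i u (x + t *\<^sub>R (- y)))"
    have "\<exists>z>0. z < 1 \<and> ?h 1 - ?h 0 = (1 - 0) * ?d z"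
      by (rule MVT2) (simp, intro DERIV_add directional_derivative d)
    then obtain t where t: "0 < t" "t < 1" "?h 1 - ?h 0 = ?d t" by auto
    have "sdiff u x y = - ?d t" using t(3) by (simp add: sdiff_def)
    also have "\<dots> = - (\<Sum>i\<in>UNIV. y $ i * (partial_deriv i u (x + t *\<^sub>R y) - partial_deriv i u (x + t *\<^sub>R (- y))))"
      by (simp add: right_diff_distrib sum_subtractf sum_negf)
    finally have "\<bar>sdiff u x y\<bar> \<le> (\<Sum>i\<in>UNIV. \<bar>y $ i * (partial_deriv i u (x + t *\<^sub>R y) - partial_deriv i u (x + t *\<^sub>R (- y)))\<bar>)"
      by simp
    also have "\<dots> \<le> (\<Sum>i\<in>UNIV. norm y * (\<bar>C i\<bar> * (2 * norm y) powr \<gamma>))"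
    proof (rule sum_mono)
      fix i
      have ty: "norm (t *\<^sub>R y) \<le> norm y" using t by (simp add: mult_left_le_one_le)
      have "norm (x + t *\<^sub>R y) \<le> 2 * r" "norm (x + t *\<^sub>R (- y)) \<le> 2 * r"
        using norm_triangle_ineq[of x "t *\<^sub>R y"] norm_triangle_ineq[of x "t *\<^sub>R (- y)"] ty xy by (simp_all)
      then have "\<bar>partial_deriv i u (x + t *\<^sub>R y) - partial_deriv i u (x + t *\<^sub>R (- y))\<bar> \<le> C i * dist (x + t *\<^sub>R y) (x + t *\<^sub>R (- y)) powr \<gamma>"
        by (rule C)
      also have "\<dots> \<le> \<bar>C i\<bar> * (2 * norm y) powr \<gamma>"
      proof (rule mult_mono)
        have "dist (x + t *\<^sub>R y) (x + t *\<^sub>R (- y)) = norm (2 *\<^sub>R (t *\<^sub>R y))"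
          unfolding dist_norm by (rule arg_cong[where f=norm]) (simp only: scaleR_2, simp)
        also have "\<dots> \<le> 2 * norm y" using ty by simp
        finally show "dist (x + t *\<^sub>R y) (x + t *\<^sub>R (- y)) powr \<gamma> \<le> (2 * norm y) powr \<gamma>"
          using assms(2) by (intro powr_mono2) auto
      qed auto
      finally have "\<bar>partial_deriv i u (x + t *\<^sub>R y) - partial_deriv i u (x + t *\<^sub>R (- y))\<bar> \<le> \<bar>C i\<bar> * (2 * norm y) powr \<gamma>" .
      then show "\<bar>y $ i * (partial_deriv i u (x + t *\<^sub>R y) - partial_deriv i u (x + t *\<^sub>R (- y)))\<bar> \<le> norm y * (\<bar>C i\<bar> * (2 * norm y) powr \<gamma>)"
        unfolding abs_mult using component_le_norm_cart[of y i] by (intro mult_mono) auto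
    qed
    also have "\<dots> = (\<Sum>i\<in>UNIV. \<bar>C i\<bar>) * 2 powr \<gamma> * (norm y * norm y powr \<gamma>)"
      by (simp add: sum_distrib_left sum_distrib_right powr_mult mult_ac)
    also have "norm y * norm y powr \<gamma> = norm y powr (1 + \<gamma>)" by (simp add: powr_add)
    finally show "\<bar>sdiff u x y\<bar> \<le> (\<Sum>i\<in>UNIV. \<bar>C i\<bar>) * 2 powr \<gamma> * norm y powr (1 + \<gamma>)" .
  qed
qed

text \<open>\<open>j\<close> stands for [\<alpha>], which is 0 or 1: the modulus is imposed on the
  function itself or on its gradient.\<close>

lemma C_holder_loc_second_holder_C:
  assumes "j \<le> 1" "0 < \<gamma>" "\<gamma> \<le> 1"
  shows "u \<in> C_holder_loc (k + j) \<gamma> \<Longrightarrow> second_holder_C (real j + \<gamma>) k u"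
proof (induction k arbitrary: u)
  case 0
  then show ?case using assms C_holder_loc_0_second_holder[of u \<gamma>] C_holder_loc_1_second_holder[of u \<gamma>] by (cases j) auto
next
  case (Suc k)
  have "u \<in> C_holder_loc j \<gamma>" using C_holder_loc_mono[OF Suc.prems] assms by simp
  then have "second_holder (real j + \<gamma>) u" using assms C_holder_loc_0_second_holder[of u \<gamma>] C_holder_loc_1_second_holder[of u \<gamma>] by (cases j) auto
  moreover have "\<exists>w. has_partial i u w \<and> second_holder_C (real j + \<gamma>) k w" for i
    using C_holder_loc_partial[of u "k + j" \<gamma> i] Suc by auto
  ultimately show ?case by simp
qed

section \<open>Normalisation and admissibility of the solution\<close>

lemma frac_laplacian_eq_sym_frac_lap:
  fixes u :: "real^'n::finite \<Rightarrow> real"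
  assumes "frac_admissible \<alpha> \<sigma> u"
  shows "frac_laplacian \<alpha> u x = frac_lap_const CARD('n) \<alpha> / 2 * sym_frac_lap \<alpha> u x"
proof -
  interpret frac_admissible \<alpha> \<sigma> u by fact
  show ?thesis using tendsto_Lim[OF _ pv_limit[of x]] by (simp add: frac_laplacian_def)
qed

lemma frac_lap_const_pos:
  assumes "0 < \<alpha>" "\<alpha> < 2"
  shows "0 < frac_lap_const n \<alpha>"
  unfolding frac_lap_const_def using assms
  by (intro divide_pos_pos mult_pos_pos Gamma_real_pos) auto

text \<open>The orders add up: [\<alpha>] + ({\<alpha>} + \<epsilon>) = \<alpha> + \<epsilon>, which
  becomes the exponent \<sigma>. Since \<epsilon> < 1, it also stays below \<alpha> + n.\<close>

lemma frac_admissibleI: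
  fixes u :: "real^'n::finite \<Rightarrow> real"
  assumes "0 < \<alpha>" "\<alpha> < 2" "0 < \<epsilon>" "frac \<alpha> + \<epsilon> < 1"
    and "u \<in> C_holder_loc (k + nat \<lfloor>\<alpha>\<rfloor>) (frac \<alpha> + \<epsilon>)" "u \<in> L_space \<alpha>"
  shows "frac_admissible \<alpha> (\<alpha> + \<epsilon>) u" "second_holder_C (\<alpha> + \<epsilon>) k u"
proof -
  have fl: "0 \<le> \<lfloor>\<alpha>\<rfloor>" "\<lfloor>\<alpha>\<rfloor> < 2" using assms by (auto simp: floor_less_iff)
  have \<gamma>: "0 < frac \<alpha> + \<epsilon>" "\<epsilon> < 1" using assms frac_ge_0[of \<alpha>] by linarith+
  have e: "real (nat \<lfloor>\<alpha>\<rfloor>) + (frac \<alpha> + \<epsilon>) = \<alpha> + \<epsilon>" using fl by (simp add: frac_def)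
  have n1: "nat \<lfloor>\<alpha>\<rfloor> \<le> 1" using fl by linarith
  show second_holder_C: "second_holder_C (\<alpha> + \<epsilon>) k u"
    using C_holder_loc_second_holder_C[OF n1 \<gamma>(1) _ assms(5)] assms(4) unfolding e by simp
  have sd: "second_holder (\<alpha> + \<epsilon>) u" using second_holder_C_base[OF second_holder_C] .
  have "1 \<le> real CARD('n)" by (simp add: Suc_leI)
  then have c: "\<epsilon> \<le> real CARD('n)" using \<gamma>(2) by linarith
  show "frac_admissible \<alpha> (\<alpha> + \<epsilon>) u"
    by unfold_locales (use assms sd \<gamma> c in \<open>auto simp: second_holder_def L_space_def tail_weight_def divide_inverse\<close>)
qed

section \<open>Integration by parts for compact supports\<close>

lemma integrable_compact_support:
  fixes f :: "'a::euclidean_space \<Rightarrow> real"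
  assumes "continuous_on UNIV f" "\<And>x. r \<le> norm x \<Longrightarrow> f x = 0"
  shows "integrable lborel f"
proof -
  have "integrable lborel (\<lambda>x. f x * indicator (ball 0 r) x)"
    by (rule integrable_continuous_bump[OF assms(1), of _ r 1])
       (auto simp: indicator_def intro!: borel_measurable_indicator)
  moreover have "(\<lambda>x. f x * indicator (ball 0 r) x) = f"
    using assms(2) by (auto simp: indicator_def fun_eq_iff)
  ultimately show ?thesis by simp
qed

text \<open>The integral of the translate of \<open>F\<close> by t along the axis does not depend on
  t, while its derivative at 0 is the integral of \<open>D\<close>. Translation invariance thus
  takes the place of Fubini and the fundamental theorem.\<close>

lemma integral_partial_zero:
  fixes F D :: "real^'n::finite \<Rightarrow> real"
  assumes "has_partial i F D" "continuous_on UNIV F" "continuous_on UNIV D"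
    and F0: "\<And>x. r \<le> norm x \<Longrightarrow> F x = 0" and D0: "\<And>x. r \<le> norm x \<Longrightarrow> D x = 0"
  shows "integral\<^sup>L lborel D = 0"
proof -
  have [measurable]: "F \<in> borel_measurable borel" "D \<in> borel_measurable borel"
    using assms by (simp_all add: borel_measurable_continuous_onI)
  obtain M where M: "\<And>x. norm x \<le> r \<Longrightarrow> \<bar>D x\<bar> \<le> M"
    using continuous_bounded_cball[OF assms(3), of 0 r] by auto
  have MD: "\<bar>D x\<bar> \<le> \<bar>M\<bar>" for x
    using M[of x] D0[of x] by (cases "norm x \<le> r") auto
  let ?e = "axis i 1 :: real^'n"
  have "((\<lambda>t. \<integral>x. F (x + t *\<^sub>R ?e) \<partial>lborel) has_real_derivative (\<integral>x. D (x + 0 *\<^sub>R ?e) \<partial>lborel)) (at 0)"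
  proof (rule has_real_derivative_integral[where d=1])
    show "integrable lborel (\<lambda>x. F (x + t *\<^sub>R ?e))" for t
      using lborel_integrable_translate(1)[OF integrable_compact_support[OF assms(2) F0]] by simp
    show "((\<lambda>t. F (x + t *\<^sub>R ?e)) has_real_derivative D (x + t *\<^sub>R ?e)) (at t)" for t x
      by (rule has_partial_at[OF assms(1)])
    show "integrable lborel (\<lambda>x::real^'n. \<bar>M\<bar> * indicator (cball 0 (\<bar>r\<bar> + 1)) x)"
      by (intro integrable_mult_right integrable_real_indicator emeasure_lborel_cball_finite) auto
    show "\<bar>D (x + t *\<^sub>R ?e)\<bar> \<le> \<bar>M\<bar> * indicator (cball 0 (\<bar>r\<bar> + 1)) x" if "\<bar>t - 0\<bar> < 1" for t x
    proof (cases "norm x \<le> \<bar>r\<bar> + 1")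
      case True
      then show ?thesis using MD by simp
    next
      case False
      have "norm x \<le> norm (x + t *\<^sub>R ?e) + norm (t *\<^sub>R ?e)"
        using norm_triangle_ineq4[of "x + t *\<^sub>R ?e" "t *\<^sub>R ?e"] by simp
      then have "r \<le> norm (x + t *\<^sub>R ?e)" using that False by simp
      then show ?thesis using D0 by simp
    qed
  qed (use assms in \<open>simp_all add: borel_measurable_continuous_onI\<close>)
  moreover have "(\<integral>x. F (x + t *\<^sub>R ?e) \<partial>lborel) = integral\<^sup>L lborel F" for t
    by (rule lborel_integral_translate(1)) measurable
  ultimately have "((\<lambda>t::real. integral\<^sup>L lborel F) has_real_derivative integral\<^sup>L lborel D) (at 0)" by simp
  from DERIV_unique[OF this DERIV_const] show ?thesis .
qed

section \<open>Averages of superharmonic functions\<close>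

text \<open>
  Truncated powers of \<open>R\<^sup>2 - |z|\<^sup>2\<close> are used as bumps because the Laplacian and the derivative in \<open>R\<close> of
  one of them are again combinations of such powers.
\<close>

definition bump :: "nat \<Rightarrow> real \<Rightarrow> real" where
  "bump k s = max 0 s ^ k"

lemma bump_nonneg [simp]: "0 \<le> bump k s"
  by (simp add: bump_def)

lemma bump_eq_0: "s \<le> 0 \<Longrightarrow> 0 < k \<Longrightarrow> bump k s = 0"
  by (simp add: bump_def max_def)

lemma bump_Suc: "0 < k \<Longrightarrow> bump (Suc k) s = s * bump k s"
  by (simp add: bump_def max_def)

lemma bump_le_1: "s \<le> 1 \<Longrightarrow> bump k s \<le> 1"
  by (simp add: bump_def power_le_one)

text \<open>For \<open>2 \<le> k\<close> the power s^k and the zero function agree at the junction 0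
  in value and derivative.\<close>

lemma bump_deriv:
  assumes "2 \<le> k"
  shows "(bump k has_real_derivative real k * bump (k - 1) s) (at s)"
proof (cases s "0::real" rule: linorder_cases)
  case less
  show ?thesis
  proof (rule has_field_derivative_transform_within_open[where S="{..<0}" and f="\<lambda>_. 0"])
    show "((\<lambda>_. 0) has_real_derivative real k * bump (k - 1) s) (at s)"
      using less assms by (simp add: bump_eq_0)
  qed (use less assms in \<open>auto simp: bump_eq_0\<close>)
next
  case greater
  show ?thesis
  proof (rule has_field_derivative_transform_within_open[where S="{0<..}" and f="\<lambda>s. s ^ k"])
    show "((\<lambda>s. s ^ k) has_real_derivative real k * bump (k - 1) s) (at s)"
      using greater assms by (auto simp: bump_def intro!: derivative_eq_intros)
  qed (use greater in \<open>auto simp: bump_def\<close>)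
next
  case equal
  have "((\<lambda>s. if 0 \<le> s then s ^ k else 0) has_real_derivative 0) (at (0::real))"
    by (rule has_real_derivative_glue) (use assms in \<open>auto intro!: derivative_eq_intros\<close>)
  moreover have "(\<lambda>s. if 0 \<le> s then s ^ k else 0) = bump k"
    using assms by (auto simp: bump_def fun_eq_iff max_def)
  ultimately show ?thesis using equal assms by (simp add: bump_eq_0)
qed

lemma continuous_bump [continuous_intros]:
  "continuous_on S f \<Longrightarrow> continuous_on S (\<lambda>x. bump k (f x))"
  unfolding bump_def by (intro continuous_intros)

lemma bump_lipschitz:
  assumes "2 \<le> k" "a \<le> 1" "b \<le> 1"
  shows "\<bar>bump k a - bump k b\<bar> \<le> real k * \<bar>a - b\<bar>"
proof -
  have "norm (bump k a - bump k b) \<le> real k * norm (a - b)"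
  proof (rule field_differentiable_bound[of "{..1}"])
    show "(bump k has_real_derivative real k * bump (k - 1) z) (at z within {..1})" for z
      using bump_deriv[OF assms(1)] by (rule has_field_derivative_at_within)
    show "norm (real k * bump (k - 1) z) \<le> real k" if "z \<in> {..1}" for z
      using bump_le_1[of z "k - 1"] that by (simp add: abs_mult mult_left_le)
  qed (use assms in auto)
  then show ?thesis by simp
qed

text \<open>Mean value bound for \<open>bump k (a + t * s) + bump k (a - t * s)\<close> in t: the
  derivative is k s times a difference of bumps with exponent k - 1, to which the Lipschitz bound
  applies because k - 1 \<ge> 2.\<close>

lemma bump_second_diff:
  assumes "3 \<le> k" "a + s \<le> 1" "a - s \<le> 1"
  shows "\<bar>bump k (a + s) + bump k (a - s) - 2 * bump k a\<bar> \<le> 2 * real k * real (k - 1) * s ^ 2"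
proof -
  let ?G = "\<lambda>t. bump k (a + t * s) + bump k (a - t * s)"
  let ?G' = "\<lambda>t. real k * bump (k - 1) (a + t * s) * s + real k * bump (k - 1) (a - t * s) * (- s)"
  have "norm (?G 1 - ?G 0) \<le> (2 * real k * real (k - 1) * s ^ 2) * norm (1 - 0 :: real)"
  proof (rule field_differentiable_bound[of "{0..1}" ?G ?G'])
    fix t :: real assume t: "t \<in> {0..1}"
    show "(?G has_real_derivative ?G' t) (at t within {0..1})"
    proof (rule has_field_derivative_at_within, rule DERIV_add)
      show "((\<lambda>t. bump k (a + t * s)) has_real_derivative real k * bump (k - 1) (a + t * s) * s) (at t)"
        using assms(1) by (intro DERIV_chain2[OF bump_deriv]) (auto intro!: derivative_eq_intros)
      show "((\<lambda>t. bump k (a - t * s)) has_real_derivative real k * bump (k - 1) (a - t * s) * (- s)) (at t)"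
        using assms(1) by (intro DERIV_chain2[OF bump_deriv]) (auto intro!: derivative_eq_intros)
    qed
    have ts: "\<bar>t * s\<bar> \<le> \<bar>s\<bar>" using t by (simp add: abs_mult mult_left_le_one_le)
    then have "a + t * s \<le> 1" "a - t * s \<le> 1" using assms by linarith+
    then have "\<bar>bump (k - 1) (a + t * s) - bump (k - 1) (a - t * s)\<bar> \<le> real (k - 1) * \<bar>(a + t * s) - (a - t * s)\<bar>"
      using assms(1) by (intro bump_lipschitz) auto
    moreover have "\<bar>(a + t * s) - (a - t * s)\<bar> \<le> 2 * \<bar>s\<bar>" using ts by linarith
    then have "real (k - 1) * \<bar>(a + t * s) - (a - t * s)\<bar> \<le> real (k - 1) * (2 * \<bar>s\<bar>)" by (rule mult_left_mono) simp
    ultimately have "\<bar>bump (k - 1) (a + t * s) - bump (k - 1) (a - t * s)\<bar> \<le> real (k - 1) * (2 * \<bar>s\<bar>)" by linarith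
    then have "\<bar>real k * s\<bar> * \<bar>bump (k - 1) (a + t * s) - bump (k - 1) (a - t * s)\<bar> \<le> \<bar>real k * s\<bar> * (real (k - 1) * (2 * \<bar>s\<bar>))"
      by (rule mult_left_mono) simp
    also have "\<dots> = 2 * real k * real (k - 1) * s ^ 2"
      by (simp add: abs_mult power2_eq_square abs_mult_self_eq)
    finally show "norm (?G' t) \<le> 2 * real k * real (k - 1) * s ^ 2"
      by (simp add: abs_mult[symmetric] algebra_simps)
  qed auto
  then show ?thesis by simp
qed

text \<open>Expanding |x + y|^2 and |x - y|^2 puts the two outer arguments symmetrically about
  \<open>a\<close>, at distance |s|, and the central one at a + |y|^2. A one-dimensional second
  difference plus a Lipschitz correction is therefore enough; 32 is 2 * 16, with 16 from |s| \<le> 4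
  |y|.\<close>

lemma sdiff_bump_bound:
  fixes x y :: "'a::euclidean_space"
  assumes "3 \<le> k" "norm x \<le> 2"
  shows "\<bar>sdiff (\<lambda>x. bump k (1 - norm x ^ 2)) x y\<bar> \<le> (32 * real k * real (k - 1) + 2 * real k) * norm y ^ 2"
proof -
  define a where "a = 1 - norm x ^ 2 - norm y ^ 2"
  define s where "s = 2 * (x \<bullet> y)"
  have e: "1 - norm (x + y) ^ 2 = a - s" "1 - norm (x - y) ^ 2 = a + s" "1 - norm x ^ 2 = a + norm y ^ 2"
    by (simp_all add: a_def s_def power2_norm_eq_inner inner_add_left inner_add_right inner_diff_left inner_diff_right inner_commute)
  have le: "a - s \<le> 1" "a + s \<le> 1" "a + norm y ^ 2 \<le> 1" "a \<le> 1"
    using e[symmetric] by (simp_all add: a_def)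
  have "\<bar>s\<bar> \<le> 2 * (norm x * norm y)" unfolding s_def using Cauchy_Schwarz_ineq2[of x y] by simp
  also have "\<dots> \<le> 2 * (2 * norm y)" using assms(2) by (intro mult_left_mono mult_right_mono) auto
  finally have "\<bar>s\<bar> ^ 2 \<le> (4 * norm y) ^ 2" by (intro power_mono) auto
  then have s2: "s ^ 2 \<le> 16 * norm y ^ 2" by (simp add: power_mult_distrib)
  have 1: "\<bar>bump k (a + s) + bump k (a - s) - 2 * bump k a\<bar> \<le> 2 * real k * real (k - 1) * (16 * norm y ^ 2)"
    using bump_second_diff[OF assms(1) le(2,1)] mult_left_mono[OF s2, of "2 * real k * real (k - 1)"] by simp
  have 2: "\<bar>bump k (a + norm y ^ 2) - bump k a\<bar> \<le> real k * norm y ^ 2"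
    using bump_lipschitz[of k "a + norm y ^ 2" a] assms(1) le by simp
  have "sdiff (\<lambda>x. bump k (1 - norm x ^ 2)) x y = 2 * (bump k (a + norm y ^ 2) - bump k a) - (bump k (a + s) + bump k (a - s) - 2 * bump k a)"
    by (simp add: sdiff_def e)
  then show ?thesis using 1 2 by (simp add: distrib_right)
qed

definition bump_integral :: "real^'n::finite \<Rightarrow> nat \<Rightarrow> real \<Rightarrow> (real^'n \<Rightarrow> real) \<Rightarrow> real" where
  "bump_integral x0 k R w = (\<integral>z. w z * bump k (R ^ 2 - norm (z - x0) ^ 2) \<partial>lborel)"

lemma bump_ball_eq_0:
  assumes "0 < k" "norm x0 + \<bar>R\<bar> \<le> norm z"
  shows "bump k (R ^ 2 - norm (z - x0) ^ 2) = 0"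
proof -
  have "\<bar>R\<bar> \<le> norm (z - x0)" using assms norm_triangle_sub[of z x0] by linarith
  then have "\<bar>R\<bar> ^ 2 \<le> norm (z - x0) ^ 2" by (intro power_mono) auto
  then show ?thesis using assms by (intro bump_eq_0) auto
qed

lemma integrable_bump_integral:
  assumes "continuous_on UNIV w" "0 < k"
  shows "integrable lborel (\<lambda>z. w z * bump k (R ^ 2 - norm (z - x0) ^ 2))"
  by (rule integrable_compact_support[where r="norm x0 + \<bar>R\<bar>"])
     (use assms bump_ball_eq_0 in \<open>auto intro!: continuous_intros\<close>)

lemma has_partial_bump:
  assumes "2 \<le> k"
  shows "has_partial i (\<lambda>z. bump k (R ^ 2 - norm (z - x0) ^ 2))
     (\<lambda>z. real k * bump (k - 1) (R ^ 2 - norm (z - x0) ^ 2) * (- 2 * (z - x0) $ i))"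
proof (rule has_partial_chain)
  show "has_partial i (\<lambda>z. R ^ 2 - norm (z - x0) ^ 2) (\<lambda>z. - 2 * (z - x0) $ i)"
    using has_partial_add[OF has_partial_const has_partial_mult[OF has_partial_const has_partial_norm2], of i "R^2" "-1" x0] by simp
qed (rule bump_deriv[OF assms])

text \<open>Green's identity, by two integrations by parts in each coordinate. The Laplacian of the
  bump contains |z - x0|^2 times the bump of exponent k - 2; writing R^2 - q for |z - x0|^2 leaves
  the exponents k - 2 and k - 1 only. With 3 \<le> k all these bumps are continuous and vanish on
  the sphere of radius |R|.\<close>

lemma bump_integral_green:
  fixes w :: "real^'n::finite \<Rightarrow> real"
  assumes w: "partial_C 2 w" and k: "3 \<le> k"
  shows "bump_integral x0 k R (neg_laplacian w) =
     2 * real k * (real CARD('n) + 2 * real k - 2) * bump_integral x0 (k - 1) R w - 4 * real k * real (k - 1) * R ^ 2 * bump_integral x0 (k - 2) R w"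
proof -
  define q where "q z = R ^ 2 - norm (z - x0) ^ 2" for z
  define B where "B z = bump k (q z)" for z
  define B1 where "B1 i z = real k * bump (k - 1) (q z) * (- 2 * (z - x0) $ i)" for i z
  define B2 where "B2 i z = (4 * real k * real (k - 1) * ((z - x0) $ i) ^ 2) * bump (k - 2) (q z) - 2 * real k * bump (k - 1) (q z)" for i z
  define w1 where "w1 i = partial_deriv i w" for i
  define w2 where "w2 i = partial_deriv i (w1 i)" for i
  have p2: "partial_C (Suc (Suc 0)) w" using w by (simp add: numeral_2_eq_2)
  have w1: "has_partial i w (w1 i)" "partial_C (Suc 0) (w1 i)" for i using partial_C_partial[OF p2, of i] by (auto simp: w1_def)
  have w2: "has_partial i (w1 i) (w2 i)" "partial_C 0 (w2 i)" for i using partial_C_partial[OF w1(2)[of i], of i] by (auto simp: w2_def)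
  have cw: "continuous_on UNIV w" "continuous_on UNIV (w1 i)" "continuous_on UNIV (w2 i)" for i
    using p2 w1(2) w2(2) partial_C_continuous by blast+
  have cq: "continuous_on UNIV q" unfolding q_def by (intro continuous_intros)
  have cB: "continuous_on UNIV B" "continuous_on UNIV (B1 i)" "continuous_on UNIV (B2 i)" for i
    unfolding B_def B1_def B2_def by (intro continuous_intros cq)+
  have z: "bump j (q z) = 0" if "0 < j" "norm x0 + \<bar>R\<bar> \<le> norm z" for j z
    unfolding q_def by (rule bump_ball_eq_0[OF that])
  have B1: "has_partial i B (B1 i)" for i
    unfolding B_def B1_def q_def using k by (intro has_partial_bump) simp
  have B2: "has_partial i (B1 i) (B2 i)" for i
  proof -
    have h1: "has_partial i (\<lambda>z. bump (k - 1) (q z)) (\<lambda>z. real (k - 1) * bump (k - 1 - 1) (q z) * (- 2 * (z - x0) $ i))"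
      unfolding q_def using k by (intro has_partial_bump) simp
    have h2: "has_partial i (\<lambda>z. - 2 * (z - x0) $ i) (\<lambda>z. - 2)"
      using has_partial_add[OF has_partial_mult[OF has_partial_const has_partial_coord] has_partial_const, of i "-2" i "2 * x0 $ i"] by (simp add: algebra_simps)
    have "has_partial i (\<lambda>z. real k * bump (k - 1) (q z) * (- 2 * (z - x0) $ i))
      (\<lambda>z. (0 * bump (k - 1) (q z) + real k * (real (k - 1) * bump (k - 1 - 1) (q z) * (- 2 * (z - x0) $ i))) * (- 2 * (z - x0) $ i)
         + real k * bump (k - 1) (q z) * (- 2))"
      by (intro has_partial_mult has_partial_const h1 h2)
    moreover have "k - 1 - 1 = k - 2" by simp
    ultimately show ?thesis
      unfolding B1_def[abs_def] B2_def[abs_def] by (simp add: power2_eq_square algebra_simps)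
  qed
  have i1: "integrable lborel (\<lambda>z. w2 i z * B z)" "integrable lborel (\<lambda>z. w z * B2 i z)" for i
    by (rule integrable_compact_support[where r="norm x0 + \<bar>R\<bar>"]; use k z cw cB cq in \<open>auto simp: B_def B2_def intro!: continuous_intros\<close>)+
  have eq: "(\<integral>z. w2 i z * B z \<partial>lborel) = (\<integral>z. w z * B2 i z \<partial>lborel)" for i
  proof -
    \<comment> \<open>The antisymmetric combination w1 B - w B1 is differentiated, so that the mixed
      terms cancel.\<close>
    have "has_partial i (\<lambda>z. w1 i z * B z + (- 1 * w z) * B1 i z)
      (\<lambda>z. (w2 i z * B z + w1 i z * B1 i z) + ((0 * w z + - 1 * w1 i z) * B1 i z + (- 1 * w z) * B2 i z))"
      by (intro has_partial_add has_partial_mult has_partial_const w1 w2 B1 B2)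
    then have "has_partial i (\<lambda>z. w1 i z * B z - w z * B1 i z) (\<lambda>z. w2 i z * B z - w z * B2 i z)"
      by simp
    then have "(\<integral>z. w2 i z * B z - w z * B2 i z \<partial>lborel) = 0"
      by (rule integral_partial_zero[where r="norm x0 + \<bar>R\<bar>"])
         (use k z cw cB cq in \<open>auto simp: B_def B1_def B2_def intro!: continuous_intros\<close>)
    then show ?thesis using i1 by simp
  qed
  have sumB2: "(\<Sum>i\<in>UNIV. B2 i z) = 4 * real k * real (k - 1) * R ^ 2 * bump (k - 2) (q z) - 2 * real k * (real CARD('n) + 2 * real k - 2) * bump (k - 1) (q z)" for z
  proof -
    have n2: "(\<Sum>i\<in>UNIV. ((z - x0) $ i) ^ 2) = norm (z - x0) ^ 2"
      by (simp add: norm_vec_def L2_set_def sum_nonneg)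
    have "(\<Sum>i\<in>UNIV. B2 i z) = (4 * real k * real (k - 1) * (\<Sum>i\<in>UNIV. ((z - x0) $ i) ^ 2)) * bump (k - 2) (q z) - real CARD('n) * (2 * real k * bump (k - 1) (q z))"
      by (simp add: B2_def sum_subtractf sum_distrib_left sum_distrib_right)
    also have "(\<Sum>i\<in>UNIV. ((z - x0) $ i) ^ 2) = R ^ 2 - q z" unfolding n2 by (simp add: q_def)
    also have "(4 * real k * real (k - 1) * (R ^ 2 - q z)) * bump (k - 2) (q z) =
       4 * real k * real (k - 1) * R ^ 2 * bump (k - 2) (q z) - 4 * real k * real (k - 1) * (q z * bump (k - 2) (q z))"
      by (simp add: algebra_simps)
    also have "q z * bump (k - 2) (q z) = bump (k - 1) (q z)"
      using bump_Suc[of "k - 2" "q z"] k by (simp add: Suc_diff_Suc numeral_2_eq_2)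
    finally show ?thesis using k by (simp add: of_nat_diff algebra_simps)
  qed
  have "bump_integral x0 k R (neg_laplacian w) = - (\<integral>z. (\<Sum>i\<in>UNIV. w2 i z * B z) \<partial>lborel)"
    unfolding bump_integral_def neg_laplacian_def w2_def w1_def B_def q_def
    by (simp add: sum_distrib_right)
  also have "(\<integral>z. (\<Sum>i\<in>UNIV. w2 i z * B z) \<partial>lborel) = (\<Sum>i\<in>UNIV. \<integral>z. w2 i z * B z \<partial>lborel)"
    using i1 by (intro Bochner_Integration.integral_sum) auto
  also have "\<dots> = (\<Sum>i\<in>UNIV. \<integral>z. w z * B2 i z \<partial>lborel)" by (simp only: eq)
  also have "\<dots> = (\<integral>z. (\<Sum>i\<in>UNIV. w z * B2 i z) \<partial>lborel)"
    using i1 by (intro Bochner_Integration.integral_sum[symmetric]) auto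
  also have "\<dots> = (\<integral>z. (4 * real k * real (k - 1) * R ^ 2) * (w z * bump (k - 2) (q z)) - (2 * real k * (real CARD('n) + 2 * real k - 2)) * (w z * bump (k - 1) (q z)) \<partial>lborel)"
    by (simp add: sum_distrib_left[symmetric] sumB2 algebra_simps)
  also have "\<dots> = (4 * real k * real (k - 1) * R ^ 2) * bump_integral x0 (k - 2) R w - (2 * real k * (real CARD('n) + 2 * real k - 2)) * bump_integral x0 (k - 1) R w"
    unfolding bump_integral_def q_def using integrable_bump_integral[OF cw(1), of "k - 2" R x0] integrable_bump_integral[OF cw(1), of "k - 1" R x0] k
    by (subst Bochner_Integration.integral_diff) auto
  finally show ?thesis by simp
qed

lemma bump_integral_deriv:
  fixes w :: "real^'n::finite \<Rightarrow> real"
  assumes w: "continuous_on UNIV w" and k: "2 \<le> k"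
  shows "((\<lambda>R. bump_integral x0 k R w) has_real_derivative 2 * real k * R * bump_integral x0 (k - 1) R w) (at R)"
proof -
  let ?q = "\<lambda>t z. t ^ 2 - norm (z - x0) ^ 2"
  let ?f' = "\<lambda>t z. w z * (real k * bump (k - 1) (?q t z) * (2 * t))"
  let ?S = "\<bar>R\<bar> + 1"
  let ?M = "real k * (?S ^ 2) ^ (k - 1) * (2 * ?S)"
  have "((\<lambda>t. \<integral>z. w z * bump k (?q t z) \<partial>lborel) has_real_derivative integral\<^sup>L lborel (?f' R)) (at R)"
  proof (rule has_real_derivative_integral[where d=1])
    show "integrable lborel (\<lambda>z. w z * bump k (?q t z))" for t
      using integrable_bump_integral[OF w] k by simp
    show "((\<lambda>t. w z * bump k (?q t z)) has_real_derivative ?f' t z) (at t)" for t z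
      using k by (intro DERIV_cmult DERIV_chain2[OF bump_deriv]) (auto intro!: derivative_eq_intros)
    show "integrable lborel (\<lambda>z. \<bar>w z\<bar> * (?M * indicator (cball 0 (norm x0 + ?S)) z))"
      by (rule integrable_continuous_bump[where r="norm x0 + ?S + 1" and B="\<bar>?M\<bar>"])
         (use w in \<open>auto simp: indicator_def intro!: continuous_intros borel_measurable_times borel_measurable_indicator\<close>)
    show "\<bar>?f' t z\<bar> \<le> \<bar>w z\<bar> * (?M * indicator (cball 0 (norm x0 + ?S)) z)" if "\<bar>t - R\<bar> < 1" for t z
    proof -
      have t: "\<bar>t\<bar> \<le> ?S" using that by linarith
      have "real k * bump (k - 1) (?q t z) * (2 * \<bar>t\<bar>) \<le> ?M * indicator (cball 0 (norm x0 + ?S)) z"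
      proof (cases "norm z \<le> norm x0 + ?S")
        case True
        have "\<bar>t\<bar> ^ 2 \<le> ?S ^ 2" using t by (intro power_mono) auto
        then have "?q t z \<le> ?S ^ 2" using zero_le_power2[of "norm (z - x0)"] unfolding power2_abs by linarith
        then have "max 0 (?q t z) \<le> ?S ^ 2" by (simp only: max.bounded_iff) simp
        then have "bump (k - 1) (?q t z) \<le> (?S ^ 2) ^ (k - 1)"
          unfolding bump_def by (intro power_mono) auto
        then have "real k * bump (k - 1) (?q t z) * (2 * \<bar>t\<bar>) \<le> ?M"
          using t by (intro mult_mono) auto
        then show ?thesis using True by simp
      next
        case False
        then have "norm x0 + \<bar>t\<bar> \<le> norm z" using t by linarith
        then show ?thesis using False bump_ball_eq_0[of "k - 1" x0 t z] k by simp
      qed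
      then have "\<bar>w z\<bar> * (real k * bump (k - 1) (?q t z) * (2 * \<bar>t\<bar>)) \<le> \<bar>w z\<bar> * (?M * indicator (cball 0 (norm x0 + ?S)) z)"
        by (rule mult_left_mono) simp
      then show ?thesis by (simp add: abs_mult)
    qed
    have "continuous_on UNIV (?f' R)" using w by (intro continuous_intros)
    then show "?f' R \<in> borel_measurable lborel" by (simp add: borel_measurable_continuous_onI)
  qed simp
  moreover have "integral\<^sup>L lborel (?f' R) = 2 * real k * R * bump_integral x0 (k - 1) R w"
  proof -
    have "?f' R = (\<lambda>z. (2 * real k * R) * (w z * bump (k - 1) (?q R z)))" by (auto simp: fun_eq_iff)
    then show ?thesis unfolding bump_integral_def by simp
  qed
  ultimately show ?thesis by (simp add: bump_integral_def)
qed

text \<open>The divisor is the power by which the mass of the bump scales, not the mass itself; the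
  missing constant factor affects neither signs nor monotonicity nor limits equal to 0.\<close>

definition bump_average :: "real^'n::finite \<Rightarrow> nat \<Rightarrow> real \<Rightarrow> (real^'n \<Rightarrow> real) \<Rightarrow> real" where
  "bump_average x0 k R w = bump_integral x0 k R w / R ^ (CARD('n) + 2 * k)"

text \<open>The quotient rule produces 2 k R^2 I_(k-1) - (n + 2 k) I_k, where I_j is the bump
  integral of exponent j. This is exactly \<open>bump_integral_green\<close> at exponent k + 1,
  divided by - 2 (k + 1), and it makes the average monotone for superharmonic
  \<open>w\<close>.\<close>

lemma bump_average_deriv:
  fixes w :: "real^'n::finite \<Rightarrow> real"
  assumes w: "partial_C 2 w" and k: "2 \<le> k" and R: "0 < R"
  shows "((\<lambda>R. bump_average x0 k R w) has_real_derivative - bump_integral x0 (Suc k) R (neg_laplacian w) / (2 * real (Suc k) * R ^ (CARD('n) + 2 * k + 1))) (at R)"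
proof -
  let ?m = "CARD('n) + 2 * k"
  have cw: "continuous_on UNIV w" using w by (rule partial_C_continuous)
  have "((\<lambda>R. bump_average x0 k R w) has_real_derivative
    ((2 * real k * R * bump_integral x0 (k - 1) R w) * R ^ ?m - bump_integral x0 k R w * (real ?m * R ^ (?m - 1))) / (R ^ ?m * R ^ ?m)) (at R)"
    unfolding bump_average_def using R
    by (intro DERIV_divide bump_integral_deriv[OF cw k]) (auto intro!: derivative_eq_intros)
  moreover have "((2 * real k * R * bump_integral x0 (k - 1) R w) * R ^ ?m - bump_integral x0 k R w * (real ?m * R ^ (?m - 1))) / (R ^ ?m * R ^ ?m)
     = (2 * real k * R ^ 2 * bump_integral x0 (k - 1) R w - real ?m * bump_integral x0 k R w) / R ^ (?m + 1)"
  proof -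
    have "R ^ ?m = R * R ^ (?m - 1)" by (simp add: power_eq_if)
    then have "((2 * real k * R * bump_integral x0 (k - 1) R w) * R ^ ?m - bump_integral x0 k R w * (real ?m * R ^ (?m - 1)))
      = (2 * real k * R ^ 2 * bump_integral x0 (k - 1) R w - real ?m * bump_integral x0 k R w) * R ^ (?m - 1)"
      by (simp add: power2_eq_square algebra_simps)
    moreover have "R ^ ?m * R ^ ?m = R ^ (?m + 1) * R ^ (?m - 1)"
    proof -
      have "?m + ?m = (?m + 1) + (?m - 1)" using k by simp
      then have "R ^ (?m + ?m) = R ^ ((?m + 1) + (?m - 1))" by (rule arg_cong)
      then show ?thesis by (simp only: power_add)
    qed
    ultimately show ?thesis using R by simp
  qed
  moreover have "bump_integral x0 (Suc k) R (neg_laplacian w) = - (2 * real (Suc k)) * (2 * real k * R ^ 2 * bump_integral x0 (k - 1) R w - real ?m * bump_integral x0 k R w)"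
    using bump_integral_green[OF w, of "Suc k" x0 R] k by (simp add: algebra_simps)
  moreover have "- (- c * X) / (c * P) = X / P" if "c \<noteq> 0" for c X P :: real
    using that by simp
  then have "- (- (2 * real (Suc k)) * X) / (2 * real (Suc k) * P) = X / P" for X P :: real
    by (metis mult_eq_0_iff of_nat_eq_0_iff old.nat.distinct(2) zero_neq_numeral)
  ultimately show ?thesis by (simp only:)
qed

lemma bump_integral_neg:
  fixes w :: "real^'n::finite \<Rightarrow> real"
  assumes "continuous_on UNIV w" "0 < r" "0 < \<delta>" "\<And>z. norm (z - x0) < r \<Longrightarrow> w z \<le> - \<delta>" "0 < k"
  shows "bump_integral x0 k r w < 0"
proof -
  let ?b = "\<lambda>z. bump k (r ^ 2 - norm (z - x0) ^ 2)"
  \<comment> \<open>On the ball of half the radius the argument r^2 - |z - x0|^2 is at least 3/4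
    r^2.\<close>
  let ?c = "(3 / 4 * r ^ 2) ^ k"
  have ib: "integrable lborel ?b"
    using integrable_bump_integral[of "\<lambda>_. 1" k r x0] assms by simp
  have "?c * measure lborel (ball x0 (r / 2)) = (\<integral>z. ?c * indicator (ball x0 (r / 2)) z \<partial>lborel)"
    by simp
  also have "\<dots> \<le> integral\<^sup>L lborel ?b"
  proof (rule integral_mono)
    show "integrable lborel (\<lambda>z. ?c * indicator (ball x0 (r / 2)) z)"
      by (intro integrable_mult_right integrable_real_indicator emeasure_lborel_ball_finite) auto
    show "?c * indicator (ball x0 (r / 2)) z \<le> ?b z" for z
    proof (cases "dist x0 z < r / 2")
      case True
      then have "norm (z - x0) ^ 2 \<le> (r / 2) ^ 2" by (intro power_mono) (auto simp: dist_norm norm_minus_commute)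
      then have "3 / 4 * r ^ 2 \<le> max 0 (r ^ 2 - norm (z - x0) ^ 2)"
        by (intro order_trans[OF _ max.cobounded2]) (simp add: power_divide)
      then have "?c \<le> ?b z" unfolding bump_def using assms by (intro power_mono) auto
      then show ?thesis using True by simp
    qed simp
  qed (rule ib)
  finally have "?c * measure lborel (ball x0 (r / 2)) \<le> integral\<^sup>L lborel ?b" .
  moreover have "0 < ?c * measure lborel (ball x0 (r / 2))"
    using assms content_ball_pos[of "r / 2" x0] by simp
  ultimately have pos: "0 < integral\<^sup>L lborel ?b" by linarith
  have "bump_integral x0 k r w \<le> (\<integral>z. - \<delta> * ?b z \<partial>lborel)"
    unfolding bump_integral_def
  proof (rule integral_mono)
    show "integrable lborel (\<lambda>z. w z * ?b z)" using assms by (intro integrable_bump_integral) auto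
    show "integrable lborel (\<lambda>z. - \<delta> * ?b z)" using ib by simp
    show "w z * ?b z \<le> - \<delta> * ?b z" for z
    proof (cases "norm (z - x0) < r")
      case True
      then show ?thesis using assms(4) by (intro mult_right_mono) auto
    next
      case False
      then have "r ^ 2 \<le> norm (z - x0) ^ 2" using assms by (intro power_mono) auto
      then show ?thesis using assms by (simp add: bump_eq_0)
    qed
  qed
  also have "\<dots> = - (\<delta> * integral\<^sup>L lborel ?b)" by simp
  also have "\<dots> < 0" using pos assms by simp
  finally show ?thesis .
qed

text \<open>If \<open>w\<close> were negative at x0, it would be negative on a small ball, and so
  would be the average at that radius. By monotonicity the averages at larger radii stay below this
  negative number and cannot tend to 0.\<close>

lemma superharmonic_nonneg:
  fixes w :: "real^'n::finite \<Rightarrow> real"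
  assumes w: "partial_C 2 w" and sup: "\<And>x. 0 \<le> neg_laplacian w x" and k: "2 \<le> k"
    and lim: "((\<lambda>R. bump_average x0 k R w) \<longlongrightarrow> 0) at_top"
  shows "0 \<le> w x0"
proof (rule ccontr)
  assume "\<not> 0 \<le> w x0"
  then have neg: "w x0 < 0" by simp
  have cw: "continuous_on UNIV w" using w by (rule partial_C_continuous)
  then have "isCont w x0" by (simp add: continuous_on_eq_continuous_at)
  then obtain r where r: "0 < r" "\<And>z. dist z x0 < r \<Longrightarrow> dist (w z) (w x0) < - w x0 / 2"
    using neg unfolding continuous_at_eps_delta by (metis divide_pos_pos neg_0_less_iff_less zero_less_numeral)
  have "w z \<le> - (- w x0 / 2)" if "norm (z - x0) < r" for z
    using r(2)[of z] that by (simp add: dist_norm)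
  then have "bump_integral x0 k r w < 0"
    using neg k by (intro bump_integral_neg[OF cw r(1), where \<delta>="- w x0 / 2"]) auto
  then have Mr: "bump_average x0 k r w < 0" using r by (simp add: bump_average_def divide_neg_pos)
  have "bump_average x0 k R w \<le> bump_average x0 k r w" if "r \<le> R" for R
  proof (rule DERIV_nonpos_imp_nonincreasing[OF that])
    fix t assume t: "r \<le> t" "t \<le> R"
    have "0 \<le> bump_integral x0 (Suc k) t (neg_laplacian w)"
      unfolding bump_integral_def using sup by (intro Bochner_Integration.integral_nonneg) auto
    then have "- bump_integral x0 (Suc k) t (neg_laplacian w) / (2 * real (Suc k) * t ^ (CARD('n) + 2 * k + 1)) \<le> 0"
      using t r by (intro divide_nonpos_nonneg mult_nonneg_nonneg) auto
    then show "\<exists>y. ((\<lambda>R. bump_average x0 k R w) has_real_derivative y) (at t) \<and> y \<le> 0"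
      using bump_average_deriv[OF w k, of t x0] t r by (intro exI conjI) auto
  qed
  then have "eventually (\<lambda>R. bump_average x0 k R w \<le> bump_average x0 k r w) at_top"
    by (intro eventually_mono[OF eventually_ge_at_top[of r]])
  with lim have "0 \<le> bump_average x0 k r w" by (intro tendsto_upperbound) auto
  then show False using Mr by simp
qed

text \<open>Divided by R^(n + 2 k), Green's identity expresses the average as R^(-2) times a
  combination of the averages of \<open>w\<close> with exponents k - 1 and k - 2. Every Laplacian
  thus costs two exponents.\<close>

lemma bump_average_neg_laplacian_tendsto:
  fixes w :: "real^'n::finite \<Rightarrow> real"
  assumes w: "partial_C 2 w" and k: "3 \<le> k"
    and lim: "((\<lambda>R. bump_average x0 (k - 1) R w) \<longlongrightarrow> 0) at_top" "((\<lambda>R. bump_average x0 (k - 2) R w) \<longlongrightarrow> 0) at_top"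
  shows "((\<lambda>R. bump_average x0 k R (neg_laplacian w)) \<longlongrightarrow> 0) at_top"
proof -
  let ?a = "2 * real k * (real CARD('n) + 2 * real k - 2)" and ?b = "4 * real k * real (k - 1)"
  have inv: "((\<lambda>R::real. inverse (R ^ 2)) \<longlongrightarrow> 0) at_top"
    by (intro tendsto_inverse_0_at_top filterlim_pow_at_top filterlim_ident) auto
  have "((\<lambda>R. inverse (R ^ 2) * (?a * bump_average x0 (k - 1) R w - ?b * bump_average x0 (k - 2) R w)) \<longlongrightarrow> 0 * (?a * 0 - ?b * 0)) at_top"
    by (intro tendsto_intros inv lim)
  moreover have "eventually (\<lambda>R. inverse (R ^ 2) * (?a * bump_average x0 (k - 1) R w - ?b * bump_average x0 (k - 2) R w) = bump_average x0 k R (neg_laplacian w)) at_top"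
    using eventually_gt_at_top[of 0]
  proof eventually_elim
    fix R :: real assume R: "0 < R"
    define j where "j = k - 2"
    then have j: "k = j + 2" using k by simp
    have e: "R ^ (CARD('n) + 2 * k) = R ^ 2 * R ^ (CARD('n) + 2 * (k - 1))" "R ^ (CARD('n) + 2 * k) = R ^ 2 * (R ^ 2 * R ^ (CARD('n) + 2 * (k - 2)))"
      by (simp_all add: j flip: power_add)
    have 1: "bump_average x0 (k - 1) R w = R ^ 2 * bump_integral x0 (k - 1) R w / R ^ (CARD('n) + 2 * k)"
      unfolding bump_average_def e(1) using R by simp
    have 2: "bump_average x0 (k - 2) R w = R ^ 2 * (R ^ 2 * bump_integral x0 (k - 2) R w) / R ^ (CARD('n) + 2 * k)"
      unfolding bump_average_def e(2) using R by simp
    have alg: "inverse S * (a * (S * A / P) - b * (S * (S * B) / P)) = (a * A - b * S * B) / P"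
      if "S \<noteq> 0" "P \<noteq> 0" for S P A B a b :: real
      using that by (simp add: field_simps)
    show "inverse (R ^ 2) * (?a * bump_average x0 (k - 1) R w - ?b * bump_average x0 (k - 2) R w) = bump_average x0 k R (neg_laplacian w)"
      unfolding 1 2 bump_average_def[of x0 k R "neg_laplacian w"] bump_integral_green[OF w k]
      by (rule alg) (use R in auto)
  qed
  ultimately show ?thesis by (simp add: Lim_transform_eventually)
qed

text \<open>Substituting z = x0 + R x absorbs the divisor completely: R^n comes from the volume,
  R^(2 k) from the bump.\<close>

lemma bump_average_scale:
  fixes w :: "real^'n::finite \<Rightarrow> real"
  assumes "continuous_on UNIV w" "0 < R"
  shows "bump_average x0 k R w = (\<integral>x. w (x0 + R *\<^sub>R x) * bump k (1 - norm x ^ 2) \<partial>lborel)"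
proof -
  have "continuous_on UNIV (\<lambda>z. w z * bump k (R ^ 2 - norm (z - x0) ^ 2))"
    using assms by (intro continuous_intros)
  then have "bump_integral x0 k R w = \<bar>R\<bar> ^ DIM(real^'n) * (\<integral>x. w (x0 + R *\<^sub>R x) * bump k (R ^ 2 - norm (x0 + R *\<^sub>R x - x0) ^ 2) \<partial>lborel)"
    unfolding bump_integral_def using assms by (intro lborel_integral_affine) (auto intro: borel_measurable_continuous_onI)
  also have "(\<lambda>x::real^'n. w (x0 + R *\<^sub>R x) * bump k (R ^ 2 - norm (x0 + R *\<^sub>R x - x0) ^ 2)) =
    (\<lambda>x. R ^ (2 * k) * (w (x0 + R *\<^sub>R x) * bump k (1 - norm x ^ 2)))"
  proof
    fix x :: "real^'n"
    have "R ^ 2 - norm (x0 + R *\<^sub>R x - x0) ^ 2 = R ^ 2 * (1 - norm x ^ 2)"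
      by (simp add: power_mult_distrib right_diff_distrib)
    moreover have "max 0 (R ^ 2 * (1 - norm x ^ 2)) = R ^ 2 * max 0 (1 - norm x ^ 2)"
      by (simp add: max_mult_distrib_left)
    ultimately have "bump k (R ^ 2 - norm (x0 + R *\<^sub>R x - x0) ^ 2) = R ^ (2 * k) * bump k (1 - norm x ^ 2)"
      unfolding bump_def by (simp add: power_mult_distrib power_mult)
    then show "w (x0 + R *\<^sub>R x) * bump k (R ^ 2 - norm (x0 + R *\<^sub>R x - x0) ^ 2) = R ^ (2 * k) * (w (x0 + R *\<^sub>R x) * bump k (1 - norm x ^ 2))"
      by (simp add: mult_ac)
  qed
  finally show ?thesis using assms by (simp add: bump_average_def power_add)
qed

lemma bump_average_sym_frac_lap_tendsto:
  fixes u :: "real^'n::finite \<Rightarrow> real"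
  assumes "frac_admissible \<alpha> \<sigma> u" "continuous_on UNIV (sym_frac_lap \<alpha> u)" "2 \<le> real CARD('n) + \<alpha>" "3 \<le> k"
  shows "((\<lambda>R. bump_average x0 k R (\<lambda>x. c * sym_frac_lap \<alpha> u x)) \<longlongrightarrow> 0) at_top"
proof -
  interpret frac_admissible \<alpha> \<sigma> u by fact
  have "((\<lambda>R. \<integral>x. sym_frac_lap \<alpha> u (x0 + R *\<^sub>R x) * bump k (1 - norm x ^ 2) \<partial>lborel) \<longlongrightarrow> 0) at_top"
  proof (rule sym_frac_lap_average_tendsto_0)
    show "2 \<le> real DIM(real^'n) + \<alpha>" using assms by simp
    have "continuous_on UNIV (\<lambda>x::real^'n. bump k (1 - norm x ^ 2))" by (intro continuous_intros)
    then show "(\<lambda>x::real^'n. bump k (1 - norm x ^ 2)) \<in> borel_measurable borel" by (rule borel_measurable_continuous_onI)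
    show "bump k (1 - norm x ^ 2) = 0" if "1 \<le> norm x" for x :: "real^'n"
      using that assms(4) by (intro bump_eq_0) auto
    show "\<bar>bump k (1 - norm x ^ 2)\<bar> \<le> 1" for x :: "real^'n"
      using bump_le_1[of "1 - norm x ^ 2" k] by simp
    show "\<bar>sdiff (\<lambda>x. bump k (1 - norm x ^ 2)) x y\<bar> \<le> (32 * real k * real (k - 1) + 2 * real k) * norm y ^ 2"
      if "norm x \<le> 2" for x y :: "real^'n"
      using sdiff_bump_bound[OF assms(4) that] .
  qed
  then have "((\<lambda>R. c * (\<integral>x. sym_frac_lap \<alpha> u (x0 + R *\<^sub>R x) * bump k (1 - norm x ^ 2) \<partial>lborel)) \<longlongrightarrow> 0) at_top"
    by (rule tendsto_mult_right_zero)
  moreover have "eventually (\<lambda>R. c * (\<integral>x. sym_frac_lap \<alpha> u (x0 + R *\<^sub>R x) * bump k (1 - norm x ^ 2) \<partial>lborel) = bump_average x0 k R (\<lambda>x. c * sym_frac_lap \<alpha> u x)) at_top"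
    using eventually_gt_at_top[of 0]
  proof eventually_elim
    fix R :: real assume "0 < R"
    then show "c * (\<integral>x. sym_frac_lap \<alpha> u (x0 + R *\<^sub>R x) * bump k (1 - norm x ^ 2) \<partial>lborel) = bump_average x0 k R (\<lambda>x. c * sym_frac_lap \<alpha> u x)"
      using assms(2) by (subst bump_average_scale) (auto intro!: continuous_intros simp: mult.assoc)
  qed
  ultimately show ?thesis by (rule Lim_transform_eventually)
qed

section \<open>Comparison with barriers\<close>

text \<open>The first order condition gives \<open>h' 0 = 0\<close>; a negative \<open>D\<close>
  would make h' negative just to the right of 0, and h would fall below \<open>h 0\<close>.\<close>

lemma second_derivative_min:
  fixes h h' :: "real \<Rightarrow> real"
  assumes "0 < d" and h: "\<And>t. \<bar>t\<bar> < d \<Longrightarrow> (h has_real_derivative h' t) (at t)"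
    and h': "(h' has_real_derivative D) (at 0)" and min: "\<And>t. \<bar>t\<bar> < d \<Longrightarrow> h 0 \<le> h t"
  shows "0 \<le> D"
proof (rule ccontr)
  assume "\<not> 0 \<le> D"
  then obtain e where e: "0 < e" "\<And>t. 0 < t \<Longrightarrow> t < e \<Longrightarrow> h' t < h' 0"
    using DERIV_neg_dec_right[OF h'] by auto
  have h0: "h' 0 = 0"
    using DERIV_local_min[of h "h' 0" 0 d] h[of 0] min \<open>0 < d\<close> by auto
  define t where "t = min d e / 2"
  have t: "0 < t" "t < d" "t < e" using e(1) \<open>0 < d\<close> by (auto simp: t_def min_def)
  have "\<exists>z>0. z < t \<and> h t - h 0 = (t - 0) * h' z"
    using t by (intro MVT2 h) auto
  then obtain z where z: "0 < z" "z < t" "h t - h 0 = t * h' z" by auto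
  then have "h' z < 0" using e(2)[of z] t h0 by simp
  then have "t * h' z < 0" using t by (simp add: mult_pos_neg)
  then show False using z(3) min[of t] t by simp
qed

text \<open>The second derivative test is applied one coordinate at a time, so the barrier is
  differentiated along the slice in direction \<open>i\<close>.\<close>

lemma barrier_derivatives:
  fixes z x0 :: "real^'n::finite" and a :: real
  defines "s \<equiv> \<lambda>t i. a + norm (z + t *\<^sub>R axis i 1 - x0) ^ 2"
  assumes pos: "0 < a + norm (z - x0) ^ 2"
  shows "0 < s t i \<Longrightarrow> ((\<lambda>t. s t i powr (- p / 2)) has_real_derivative
      (- p / 2) * s t i powr (- p / 2 - 1) * (2 * ((z - x0) $ i + t))) (at t)"
    and "((\<lambda>t. (- p / 2) * s t i powr (- p / 2 - 1) * (2 * ((z - x0) $ i + t))) has_real_derivative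
      - p * (a + norm (z - x0) ^ 2) powr (- p / 2 - 1) + p * (p + 2) * ((z - x0) $ i) ^ 2 * (a + norm (z - x0) ^ 2) powr (- p / 2 - 2)) (at 0)"
proof -
  have sd: "((\<lambda>t. s t i) has_real_derivative 2 * ((z - x0) $ i + t)) (at t)" for t
  proof -
    have "((\<lambda>t. a + norm (z + t *\<^sub>R axis i 1 - x0) ^ 2) has_real_derivative 0 + 2 * (z + t *\<^sub>R axis i 1 - x0) $ i) (at t)"
      by (intro DERIV_add DERIV_const has_partial_at[OF has_partial_norm2])
    then show ?thesis by (simp add: s_def axis_def algebra_simps)
  qed
  show "0 < s t i \<Longrightarrow> ((\<lambda>t. s t i powr (- p / 2)) has_real_derivative
      (- p / 2) * s t i powr (- p / 2 - 1) * (2 * ((z - x0) $ i + t))) (at t)"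
    by (rule DERIV_chain2[OF has_real_derivative_powr sd])
  have s0: "s 0 i = a + norm (z - x0) ^ 2" by (simp add: s_def)
  then have "0 < s 0 i" using pos by simp
  have "((\<lambda>t. s t i powr (- p / 2 - 1)) has_real_derivative
      (- p / 2 - 1) * s 0 i powr (- p / 2 - 1 - 1) * (2 * ((z - x0) $ i + 0))) (at 0)"
    by (rule DERIV_chain2[OF has_real_derivative_powr sd]) fact
  moreover have "((\<lambda>t. 2 * ((z - x0) $ i + t)) has_real_derivative 2) (at 0)"
    by (auto intro!: derivative_eq_intros)
  ultimately
  have "((\<lambda>t. (- p / 2) * s t i powr (- p / 2 - 1) * (2 * ((z - x0) $ i + t))) has_real_derivative
     (- p / 2) * ((- p / 2 - 1) * s 0 i powr (- p / 2 - 1 - 1) * (2 * ((z - x0) $ i + 0))) * (2 * ((z - x0) $ i + 0)) + 2 * ((- p / 2) * s 0 i powr (- p / 2 - 1))) (at 0)"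
    by (intro DERIV_mult DERIV_cmult)
  also have "(- p / 2) * ((- p / 2 - 1) * s 0 i powr (- p / 2 - 1 - 1) * (2 * ((z - x0) $ i + 0))) * (2 * ((z - x0) $ i + 0)) + 2 * ((- p / 2) * s 0 i powr (- p / 2 - 1))
    = - p * (a + norm (z - x0) ^ 2) powr (- p / 2 - 1) + p * (p + 2) * ((z - x0) $ i) ^ 2 * (a + norm (z - x0) ^ 2) powr (- p / 2 - 2)"
    unfolding s0 by (simp add: power2_eq_square field_simps)
  finally show "((\<lambda>t. (- p / 2) * s t i powr (- p / 2 - 1) * (2 * ((z - x0) $ i + t))) has_real_derivative
      - p * (a + norm (z - x0) ^ 2) powr (- p / 2 - 1) + p * (p + 2) * ((z - x0) $ i) ^ 2 * (a + norm (z - x0) ^ 2) powr (- p / 2 - 2)) (at 0)" .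
qed

lemma partial_C2_pure_second:
  assumes "partial_C 2 w"
  obtains w1 w2 where "\<And>i. has_partial i w (w1 i)" "\<And>i. has_partial i (w1 i) (w2 i)" "\<And>z. neg_laplacian w z = - (\<Sum>i\<in>UNIV. w2 i z)"
proof -
  have p2: "partial_C (Suc (Suc 0)) w" using assms by (simp add: numeral_2_eq_2)
  have w1: "has_partial i w (partial_deriv i w)" "partial_C (Suc 0) (partial_deriv i w)" for i using partial_C_partial[OF p2, of i] by auto
  have w2: "has_partial i (partial_deriv i w) (partial_deriv i (partial_deriv i w))" for i using partial_C_partial[OF w1(2)[of i], of i] by auto
  show ?thesis using that[OF w1(1) w2] by (simp add: neg_laplacian_def)
qed

text \<open>Weak maximum principle for w - \<kappa> b on the exterior of a ball. Since
  \<open>w\<close> is nonnegative and the barrier decays, a negative value forces a negative minimum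
  at finite distance. It is off the inner sphere by \<open>bdry\<close>, so the pure second
  derivatives are nonnegative there, against the strict inequality \<open>lap\<close>. The parameter
  \<open>a\<close> admits two uses: 0 for the pure power outside a ball, 1 with negative
  \<open>r\<close> for the whole space.\<close>

lemma barrier_comparison:
  fixes w :: "real^'n::finite \<Rightarrow> real"
  assumes w: "partial_C 2 w" "\<And>z. 0 \<le> w z" and p: "0 < p" and \<kappa>: "0 < \<kappa>" and a: "0 \<le> a" "0 < a \<or> 0 < r"
    and bdry: "\<And>z. norm (z - x0) = r \<Longrightarrow> \<kappa> * (a + norm (z - x0) ^ 2) powr (- p / 2) \<le> w z"
    and lap: "\<And>z. r < norm (z - x0) \<Longrightarrow> \<kappa> * (p * real CARD('n) * (a + norm (z - x0) ^ 2) powr (- p / 2 - 1)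
        - p * (p + 2) * norm (z - x0) ^ 2 * (a + norm (z - x0) ^ 2) powr (- p / 2 - 2)) < neg_laplacian w z"
    and z1: "r \<le> norm (z1 - x0)"
  shows "\<kappa> * (a + norm (z1 - x0) ^ 2) powr (- p / 2) \<le> w z1"
proof (rule ccontr)
  define b where "b z = (a + norm (z - x0) ^ 2) powr (- p / 2)" for z
  assume "\<not> \<kappa> * (a + norm (z1 - x0) ^ 2) powr (- p / 2) \<le> w z1"
  then have neg: "w z1 < \<kappa> * b z1" by (simp add: b_def)
  define \<delta> where "\<delta> = \<kappa> * b z1 - w z1"
  have \<delta>: "0 < \<delta>" using neg by (simp add: \<delta>_def)
  have "((\<lambda>R. \<kappa> * R powr - p) \<longlongrightarrow> 0) at_top"
    using p by (intro tendsto_mult_right_zero tendsto_neg_powr filterlim_ident) auto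
  then have "eventually (\<lambda>R. \<kappa> * R powr - p < \<delta>) at_top"
    using \<delta> by (rule order_tendstoD)
  then have "eventually (\<lambda>R. \<kappa> * R powr - p < \<delta> \<and> 0 < R) at_top"
    using eventually_gt_at_top[of 0] by eventually_elim auto
  \<comment> \<open>From radius \<rho> on the barrier is smaller than the deficit \<delta>, so the
    minimum cannot lie there.\<close>
  then obtain \<rho> where \<rho>: "\<kappa> * \<rho> powr - p < \<delta>" "0 < \<rho>"
    using eventually_happens'[OF trivial_limit_at_top_linorder] by blast
  have far: "\<kappa> * b z < \<delta>" if "\<rho> \<le> norm (z - x0)" for z
  proof -
    have "0 < norm (z - x0)" using that \<rho> by linarith
    then have "b z \<le> (norm (z - x0) ^ 2) powr (- p / 2)"
      unfolding b_def using a p by (intro powr_mono2') auto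
    also have "\<dots> = norm (z - x0) powr - p"
    proof -
      have "norm (z - x0) ^ 2 = norm (z - x0) powr 2" using \<open>0 < norm (z - x0)\<close> by simp
      then show ?thesis by (simp only: powr_powr) simp
    qed
    also have "\<dots> \<le> \<rho> powr - p" using that \<rho> p by (intro powr_mono2') auto
    finally have "\<kappa> * b z \<le> \<kappa> * \<rho> powr - p" using \<kappa> by (intro mult_left_mono) auto
    then show ?thesis using \<rho> by linarith
  qed
  have z1\<rho>: "norm (z1 - x0) < \<rho>" using far[of z1] w(2)[of z1] by (force simp: \<delta>_def)
  define A where "A = {z. r \<le> norm (z - x0)} \<inter> cball x0 \<rho>"
  have "closed {z. r \<le> norm (z - x0)}" by (intro closed_Collect_le continuous_intros)
  then have A: "compact A" unfolding A_def by (intro closed_Int_compact) auto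
  have z1A: "z1 \<in> A" using z1 z1\<rho> by (simp add: A_def dist_norm norm_minus_commute)
  have spos: "0 < a + norm (z - x0) ^ 2" if "r \<le> norm (z - x0)" for z
    using a(2)
  proof
    assume "0 < r"
    then have "0 < norm (z - x0)" using that by linarith
    then show ?thesis using a(1) by (intro add_nonneg_pos) auto
  qed (simp add: add_pos_nonneg)
  define g where "g z = w z - \<kappa> * b z" for z
  have cg: "continuous_on A g"
    unfolding g_def b_def using spos continuous_on_subset[OF partial_C_continuous[OF w(1)]]
    by (intro continuous_intros) (force simp: A_def)+
  obtain z2 where z2: "z2 \<in> A" "\<And>z. z \<in> A \<Longrightarrow> g z2 \<le> g z"
    using continuous_attains_inf[OF A _ cg] z1A by auto
  have g2: "g z2 \<le> - \<delta>" using z2(2)[OF z1A] by (simp add: g_def \<delta>_def)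
  have r2: "r < norm (z2 - x0)"
  proof (rule ccontr)
    assume "\<not> r < norm (z2 - x0)"
    then have "norm (z2 - x0) = r" using z2(1) by (auto simp: A_def)
    then show False using bdry[of z2] g2 \<delta> by (simp add: g_def b_def)
  qed
  have \<rho>2: "norm (z2 - x0) < \<rho>"
    using far[of z2] g2 w(2)[of z2] by (force simp: g_def)
  \<comment> \<open>A move by less than \<open>d\<close> along an axis stays between the spheres of
    radii r and \<rho>.\<close>
  define d where "d = min (norm (z2 - x0) - r) (\<rho> - norm (z2 - x0))"
  have d: "0 < d" using r2 \<rho>2 by (simp add: d_def)
  have nb: "z2 + t *\<^sub>R axis i 1 \<in> A" if "\<bar>t\<bar> < d" for t i
  proof -
    have "\<bar>norm (z2 + t *\<^sub>R axis i 1 - x0) - norm (z2 - x0)\<bar> \<le> \<bar>t\<bar>"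
      using norm_triangle_ineq3[of "z2 + t *\<^sub>R axis i 1 - x0" "z2 - x0"] by simp
    moreover have "\<bar>t\<bar> < norm (z2 - x0) - r" "\<bar>t\<bar> < \<rho> - norm (z2 - x0)" using that by (auto simp: d_def)
    ultimately have "r \<le> norm (z2 + t *\<^sub>R axis i 1 - x0)" "norm (z2 + t *\<^sub>R axis i 1 - x0) \<le> \<rho>" by linarith+
    then show ?thesis by (simp add: A_def dist_norm norm_minus_commute)
  qed
  obtain w1 w2 where ww: "\<And>i. has_partial i w (w1 i)" "\<And>i. has_partial i (w1 i) (w2 i)" "\<And>z. neg_laplacian w z = - (\<Sum>i\<in>UNIV. w2 i z)"
    using partial_C2_pure_second[OF w(1)] by blast
  let ?s = "a + norm (z2 - x0) ^ 2"
  let ?D = "\<lambda>i. - p * ?s powr (- p / 2 - 1) + p * (p + 2) * ((z2 - x0) $ i) ^ 2 * ?s powr (- p / 2 - 2)"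
  have "0 \<le> w2 i z2 - \<kappa> * ?D i" for i
  proof (rule second_derivative_min[OF d])
    let ?e = "\<lambda>t. t *\<^sub>R axis i 1"
    show "((\<lambda>t. g (z2 + ?e t)) has_real_derivative
       w1 i (z2 + ?e t) - \<kappa> * ((- p / 2) * (a + norm (z2 + ?e t - x0) ^ 2) powr (- p / 2 - 1) * (2 * ((z2 - x0) $ i + t)))) (at t)"
      if "\<bar>t\<bar> < d" for t
    proof -
      have pt: "0 < a + norm (z2 + ?e t - x0) ^ 2" using spos nb[OF that] by (simp add: A_def)
      show ?thesis unfolding g_def b_def
        by (intro DERIV_diff DERIV_cmult has_partial_at[OF ww(1)] barrier_derivatives(1)) (use pt spos r2 in auto)
    qed
    have "((\<lambda>t. w1 i (z2 + ?e t)) has_real_derivative w2 i (z2 + ?e 0)) (at 0)" by (rule has_partial_at[OF ww(2)])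
    then have "((\<lambda>t. w1 i (z2 + ?e t)) has_real_derivative w2 i z2) (at 0)" by simp
    then show "((\<lambda>t. w1 i (z2 + ?e t) - \<kappa> * ((- p / 2) * (a + norm (z2 + ?e t - x0) ^ 2) powr (- p / 2 - 1) * (2 * ((z2 - x0) $ i + t))))
        has_real_derivative w2 i z2 - \<kappa> * ?D i) (at 0)"
      by (intro DERIV_diff DERIV_cmult barrier_derivatives(2)) (use spos r2 in auto)
    show "g (z2 + ?e 0) \<le> g (z2 + ?e t)" if "\<bar>t\<bar> < d" for t
      using z2(2)[OF nb[OF that, of i]] by simp
  qed
  then have "0 \<le> (\<Sum>i\<in>UNIV. w2 i z2 - \<kappa> * ?D i)" by (rule sum_nonneg)
  also have "\<dots> = - neg_laplacian w z2 - \<kappa> * (\<Sum>i\<in>UNIV. ?D i)"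
    using ww(3)[of z2] by (simp only: sum_subtractf sum_distrib_left)
  also have "(\<Sum>i\<in>UNIV. ?D i) = - (p * real CARD('n) * ?s powr (- p / 2 - 1) - p * (p + 2) * norm (z2 - x0) ^ 2 * ?s powr (- p / 2 - 2))"
  proof -
    have n2: "norm (z2 - x0) ^ 2 = (\<Sum>i\<in>UNIV. ((z2 - x0) $ i) ^ 2)"
      by (simp add: norm_vec_def L2_set_def sum_nonneg)
    have "p * (p + 2) * norm (z2 - x0) ^ 2 * ?s powr (- p / 2 - 2) = (\<Sum>i\<in>UNIV. p * (p + 2) * ((z2 - x0) $ i) ^ 2 * ?s powr (- p / 2 - 2))"
      by (subst n2) (simp only: sum_distrib_left sum_distrib_right)
    then show ?thesis by (simp add: sum.distrib sum_subtractf)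
  qed
  finally have "neg_laplacian w z2 \<le> \<kappa> * (p * real CARD('n) * ?s powr (- p / 2 - 1) - p * (p + 2) * norm (z2 - x0) ^ 2 * ?s powr (- p / 2 - 2))"
    by (simp only: mult_minus_right diff_minus_eq_add)
  then show False using lap[OF r2] by simp
qed

text \<open>
  The barrier \<open>|z - x\<^sub>0|\<^sup>-\<^sup>p\<close> is strictly subharmonic only for \<open>p > n - 2\<close>; the borderline exponent
  \<open>n - 2\<close>, which is needed when \<open>n = 2m + \<alpha>\<close>, is reached in the limit.
\<close>

lemma superharmonic_lower_bound_first:
  fixes w :: "real^'n::finite \<Rightarrow> real"
  assumes w: "partial_C 2 w" "\<And>z. 0 \<le> w z" "\<And>z. 0 \<le> neg_laplacian w z" "0 < neg_laplacian w x0"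
    and n: "2 \<le> CARD('n)" "real CARD('n) - 2 \<le> q"
  obtains c where "0 < c" "\<And>z. c * (1 + norm (z - x0) ^ 2) powr (- q / 2) \<le> w z"
proof -
  obtain w1 w2 where ww: "\<And>i. has_partial i w (w1 i)" "\<And>i. has_partial i (w1 i) (w2 i)" "\<And>z. neg_laplacian w z = - (\<Sum>i\<in>UNIV. w2 i z)"
    using partial_C2_pure_second[OF w(1)] by blast
  \<comment> \<open>A zero at x0 would be a minimum of \<open>w\<close>, where
    \<open>neg_laplacian w\<close> is at most 0.\<close>
  have "w x0 \<noteq> 0"
  proof
    assume 0: "w x0 = 0"
    have "0 \<le> w2 i x0" for i
    proof (rule second_derivative_min[of 1])
      show "((\<lambda>t. w (x0 + t *\<^sub>R axis i 1)) has_real_derivative w1 i (x0 + t *\<^sub>R axis i 1)) (at t)" for t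
        by (rule has_partial_at[OF ww(1)])
      show "((\<lambda>t. w1 i (x0 + t *\<^sub>R axis i 1)) has_real_derivative w2 i x0) (at 0)"
        using has_partial_at[OF ww(2), of i x0 0] by simp
    qed (use 0 w(2) in auto)
    then have "neg_laplacian w x0 \<le> 0" using ww(3)[of x0] by (simp add: sum_nonneg)
    then show False using w(4) by simp
  qed
  then have wx0: "0 < w x0" using w(2)[of x0] by simp
  define \<delta> where "\<delta> = w x0 / 2"
  have \<delta>: "0 < \<delta>" using wx0 by (simp add: \<delta>_def)
  have "isCont w x0" using partial_C_continuous[OF w(1)] by (simp add: continuous_on_eq_continuous_at)
  then obtain e where e: "0 < e" "\<And>z. dist z x0 < e \<Longrightarrow> dist (w z) (w x0) < \<delta>"
    using \<delta> unfolding continuous_at_eps_delta by metis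
  define r where "r = e / 2"
  have r: "0 < r" using e by (simp add: r_def)
  have near: "\<delta> \<le> w z" if "norm (z - x0) \<le> r" for z
  proof -
    have "dist (w z) (w x0) < \<delta>" using e that by (intro e(2)) (simp add: r_def dist_norm)
    then show ?thesis unfolding dist_real_def \<delta>_def by linarith
  qed
  define n where "n = real CARD('n)"
  have n2: "0 \<le> n - 2" using assms(5) by (simp add: n_def)
  have far_p: "\<delta> * (r / norm (z - x0)) powr p \<le> w z" if p: "n - 2 < p" and z: "r \<le> norm (z - x0)" for p z
  proof -
    have p0: "0 < p" using p n2 by linarith
    have sq: "(norm (y - x0) ^ 2) powr (- p / 2) = norm (y - x0) powr - p" if "0 < norm (y - x0)" for y
    proof -
      have "norm (y - x0) ^ 2 = norm (y - x0) powr 2" using that by simp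
      then show ?thesis by (simp only: powr_powr) simp
    qed
    have "(\<delta> * r powr p) * (0 + norm (z - x0) ^ 2) powr (- p / 2) \<le> w z"
    proof (rule barrier_comparison[OF w(1,2) p0 _ _ _ _ _ z])
      show "0 < \<delta> * r powr p" using \<delta> r by simp
      show "(\<delta> * r powr p) * (0 + norm (y - x0) ^ 2) powr (- p / 2) \<le> w y" if "norm (y - x0) = r" for y
      proof -
        have "(0 + norm (y - x0) ^ 2) powr (- p / 2) = r powr - p"
          using sq[of y] r unfolding that by simp
        then have "(\<delta> * r powr p) * (0 + norm (y - x0) ^ 2) powr (- p / 2) = \<delta> * (r powr p * r powr - p)"
          by (simp only: mult.assoc)
        also have "\<dots> = \<delta>" using r by (simp flip: powr_add)
        finally have "(\<delta> * r powr p) * (0 + norm (y - x0) ^ 2) powr (- p / 2) = \<delta>" .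
        with near[OF eq_refl[OF that]] show ?thesis by linarith
      qed
      show "(\<delta> * r powr p) * (p * real CARD('n) * (0 + norm (y - x0) ^ 2) powr (- p / 2 - 1)
        - p * (p + 2) * norm (y - x0) ^ 2 * (0 + norm (y - x0) ^ 2) powr (- p / 2 - 2)) < neg_laplacian w y"
        if "r < norm (y - x0)" for y
      proof -
        let ?s = "norm (y - x0) ^ 2"
        have "0 < norm (y - x0)" using that r by linarith
        then have s: "0 < ?s" by simp
        have "?s * ?s powr (- p / 2 - 2) = ?s powr (1 + (- p / 2 - 2))"
          using s by (subst powr_add) simp
        also have "1 + (- p / 2 - 2) = - p / 2 - 1" by simp
        finally have e: "?s * ?s powr (- p / 2 - 2) = ?s powr (- p / 2 - 1)" .
        have "p * real CARD('n) * ?s powr (- p / 2 - 1) - p * (p + 2) * ?s * ?s powr (- p / 2 - 2)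
          = p * (n - 2 - p) * ?s powr (- p / 2 - 1)"
          unfolding mult.assoc e n_def by (simp add: algebra_simps)
        also have "\<dots> < 0" using p p0 s by (intro mult_neg_pos mult_pos_neg) auto
        finally have "(\<delta> * r powr p) * (p * real CARD('n) * ?s powr (- p / 2 - 1) - p * (p + 2) * ?s * ?s powr (- p / 2 - 2)) < 0"
          using \<delta> r by (intro mult_pos_neg) auto
        then show ?thesis using w(3)[of y] by simp
      qed
    qed (use r in auto)
    moreover have "0 < norm (z - x0)" using z r by linarith
    ultimately show ?thesis using r sq[of z] by (simp add: powr_divide powr_minus_divide)
  qed
  have far: "\<delta> * (r / norm (z - x0)) powr (n - 2) \<le> w z" if z: "r \<le> norm (z - x0)" for z
  proof (rule tendsto_upperbound)
    have "0 < r / norm (z - x0)" using r z by (intro divide_pos_pos) auto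
    then show "((\<lambda>p. \<delta> * (r / norm (z - x0)) powr p) \<longlongrightarrow> \<delta> * (r / norm (z - x0)) powr (n - 2)) (at_right (n - 2))"
      by (intro tendsto_intros) auto
    show "eventually (\<lambda>p. \<delta> * (r / norm (z - x0)) powr p \<le> w z) (at_right (n - 2))"
      by (rule eventually_at_rightI[of _ "n - 1"]) (use far_p z in auto)
  qed simp
  \<comment> \<open>The first entry serves the ball of radius r, the second the exterior, where the
    factor r^(n - 2) is split off from the bound \<open>far\<close>.\<close>
  define c where "c = min \<delta> (\<delta> * r powr (n - 2))"
  show ?thesis
  proof (rule that[of c])
    show "0 < c" using \<delta> r by (simp add: c_def)
    fix z
    have q: "0 \<le> q" using n2 assms(6) by (simp add: n_def)
    have s1: "1 \<le> 1 + norm (z - x0) ^ 2" by simp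
    show "c * (1 + norm (z - x0) ^ 2) powr (- q / 2) \<le> w z"
    proof (cases "norm (z - x0) \<le> r")
      case True
      have "(1 + norm (z - x0) ^ 2) powr (- q / 2) \<le> 1 powr (- q / 2)"
        using q s1 by (intro powr_mono2') auto
      then have "c * (1 + norm (z - x0) ^ 2) powr (- q / 2) \<le> \<delta> * 1"
        using \<delta> by (intro mult_mono) (auto simp: c_def)
      then show ?thesis using near[OF True] by simp
    next
      case False
      then have pos: "0 < norm (z - x0)" using r by linarith
      have "(1 + norm (z - x0) ^ 2) powr (- q / 2) \<le> (1 + norm (z - x0) ^ 2) powr (- (n - 2) / 2)"
        using s1 assms(6) by (intro powr_mono) (auto simp: n_def)
      also have "\<dots> \<le> (norm (z - x0) ^ 2) powr (- (n - 2) / 2)"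
        using pos n2 by (intro powr_mono2') auto
      also have "\<dots> = norm (z - x0) powr - (n - 2)"
      proof -
        have "norm (z - x0) ^ 2 = norm (z - x0) powr 2" using pos by simp
        moreover have "2 * (- (n - 2) / 2) = - (n - 2)" by simp
        ultimately show ?thesis by (simp only: powr_powr)
      qed
      finally have "c * (1 + norm (z - x0) ^ 2) powr (- q / 2) \<le> (\<delta> * r powr (n - 2)) * norm (z - x0) powr - (n - 2)"
        using \<delta> by (intro mult_mono) (auto simp: c_def)
      also have "\<dots> = \<delta> * (r / norm (z - x0)) powr (n - 2)"
        unfolding powr_minus_divide using pos r by (simp add: powr_divide)
      also have "\<dots> \<le> w z" using False by (intro far) simp
      finally show ?thesis .
    qed
  qed
qed

text \<open>With s = 1 + |z - x0|^2, the negative Laplacian of the barrier s^(-q/2) is at most q n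
  s^(-q/2 - 1), and q' \<le> q + 2 makes this of no larger order than the given s^(-q'/2). A small
  multiple of the barrier therefore stays below \<open>w\<close>.\<close>

lemma superharmonic_lower_bound_step:
  fixes w :: "real^'n::finite \<Rightarrow> real"
  assumes w: "partial_C 2 w" "\<And>z. 0 \<le> w z" and c: "0 < c" "\<And>z. c * (1 + norm (z - x0) ^ 2) powr (- q' / 2) \<le> neg_laplacian w z"
    and q: "0 < q" "q' \<le> q + 2"
  obtains d where "0 < d" "\<And>z. d * (1 + norm (z - x0) ^ 2) powr (- q / 2) \<le> w z"
proof -
  define d where "d = c / (q * real CARD('n) + 1)"
  have qn: "0 \<le> q * real CARD('n)" using q by simp
  have d: "0 < d" "d * (q * real CARD('n)) < c" using c(1) qn by (auto simp: d_def divide_simps add_pos_nonneg)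
  show ?thesis
  proof (rule that[OF d(1)])
    fix z1
    show "d * (1 + norm (z1 - x0) ^ 2) powr (- q / 2) \<le> w z1"
    \<comment> \<open>With \<open>r = -1\<close> the inner sphere is empty and the exterior is the
      whole space.\<close>
    proof (rule barrier_comparison[OF w q(1) d(1), where r="-1"])
      fix z
      let ?s = "1 + norm (z - x0) ^ 2"
      have s1: "1 \<le> ?s" by simp
      have "d * (q * real CARD('n) * ?s powr (- q / 2 - 1) - q * (q + 2) * norm (z - x0) ^ 2 * ?s powr (- q / 2 - 2))
        \<le> d * (q * real CARD('n) * ?s powr (- q / 2 - 1))"
        using d q by (intro mult_left_mono) auto
      also have "\<dots> < c * ?s powr (- q / 2 - 1)"
      proof -
        have "0 < ?s powr (- q / 2 - 1)" using s1 by (subst powr_gt_zero) linarith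
        from mult_strict_right_mono[OF d(2) this] show ?thesis by (simp only: mult.assoc)
      qed
      also have "\<dots> \<le> c * ?s powr (- q' / 2)"
        using c(1) q s1 by (intro mult_left_mono powr_mono) auto
      also have "\<dots> \<le> neg_laplacian w z" by (rule c(2))
      finally show "d * (q * real CARD('n) * ?s powr (- q / 2 - 1) - q * (q + 2) * norm (z - x0) ^ 2 * ?s powr (- q / 2 - 2)) < neg_laplacian w z" .
      show "- 1 \<le> norm (z1 - x0)" using norm_ge_zero[of "z1 - x0"] by linarith
    next
      fix z assume "norm (z - x0) = - 1"
      then show "d * (1 + norm (z - x0) ^ 2) powr (- q / 2) \<le> w z"
        using norm_ge_zero[of "z - x0"] by linarith
    qed auto
  qed
qed

text \<open>At a zero of a nonnegative function the integrand of the operator is nonpositive, so a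
  nonnegative integral makes it vanish almost everywhere; continuity removes the exceptional
  set.\<close>

lemma (in frac_admissible) sym_frac_lap_zero_at_zero:
  assumes u0: "\<And>x. 0 \<le> u x" and "u x1 = 0" "0 \<le> sym_frac_lap \<alpha> u x1"
  shows "u x = 0"
proof -
  let ?F = "\<lambda>y. (u (x1 + y) + u (x1 - y)) * riesz \<alpha> y"
  have e: "sdiff u x1 y * riesz \<alpha> y = - ?F y" for y using assms(2) by (simp add: sdiff_def algebra_simps)
  have iF: "integrable lborel ?F" using integrable_sdiff[of x1] unfolding e by simp
  have nn: "0 \<le> ?F y" for y using u0 by simp
  have "integral\<^sup>L lborel ?F \<le> 0" using assms(3) unfolding sym_frac_lap_def e by simp
  moreover have "0 \<le> integral\<^sup>L lborel ?F" using nn by (intro Bochner_Integration.integral_nonneg)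
  ultimately have "AE y in lborel. ?F y = 0"
    using integral_nonneg_eq_0_iff_AE[OF iF] nn by auto
  \<comment> \<open>The origin is excluded because \<open>riesz \<alpha> 0\<close> is 0 and gives no
    information there.\<close>
  then have ae: "AE y in lborel. y \<noteq> 0 \<longrightarrow> u (x1 + y) = 0"
  proof eventually_elim
    case (elim y)
    have "riesz \<alpha> y \<noteq> 0" if "y \<noteq> 0" using that by (simp add: riesz_def)
    then show ?case using elim u0[of "x1 + y"] u0[of "x1 - y"] by (auto simp: add_nonneg_eq_0_iff)
  qed
  show ?thesis
  proof (rule ccontr)
    assume x: "u x \<noteq> 0"
    have cont': "continuous_on UNIV (\<lambda>y. u (x1 + y))"
      by (intro continuous_on_compose2[OF cont] continuous_intros) auto
    define S where "S = {y. u (x1 + y) \<noteq> 0}"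
    have S: "open S" unfolding S_def by (intro open_Collect_neq cont' continuous_intros)
    have xS: "x - x1 \<in> S" using x by (simp add: S_def)
    have S0: "0 \<notin> S" using assms(2) by (simp add: S_def)
    have "AE y in lborel. y \<notin> S"
      using ae by eventually_elim (use S0 in \<open>auto simp: S_def\<close>)
    then have "emeasure lborel S = 0"
      using S AE_iff_measurable[of S lborel "\<lambda>y. y \<notin> S"] by (auto simp: borel_open)
    moreover obtain e where "0 < e" "ball (x - x1) e \<subseteq> S" using S xS open_contains_ball by blast
    then have "emeasure lborel (ball (x - x1) e) \<le> emeasure lborel S" using S by (intro emeasure_mono) (auto simp: borel_open)
    moreover have "0 < emeasure lborel (ball (x - x1) e)"
      using content_ball_pos[OF \<open>0 < e\<close>, of "x - x1"] by (simp add: measure_def enn2real_positive_iff)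
    ultimately show False by simp
  qed
qed

section \<open>The Liouville theorem\<close>

theorem theorem1p14:
  fixes m :: nat and \<alpha> \<epsilon> :: real
    and f :: "real^'n::finite \<Rightarrow> ('n list \<Rightarrow> real) \<Rightarrow> real"
    and u :: "real^'n \<Rightarrow> real"
  assumes "CARD('n) \<ge> 3" and "m \<ge> 1" and "0 < \<alpha>" and "\<alpha> < 2"
    and "real CARD('n) / 2 \<le> real m + \<alpha> / 2"
    and f_nonneg: "\<And>x J. J [] \<ge> 0 \<Longrightarrow> f x J \<ge> 0"
    and f_cont: "continuous_on UNIV (\<lambda>x. f x (jet (2 * m + nat \<lfloor>\<alpha>\<rfloor>) u x))"
    and f_pos: "(\<forall>x. u x > 0) \<Longrightarrow> \<exists>x0. f x0 (jet (2 * m + nat \<lfloor>\<alpha>\<rfloor>) u x0) > 0"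
    and "0 < \<epsilon>" and "frac \<alpha> + \<epsilon> < 1"
    and u_reg: "u \<in> C_holder_loc (2 * m + nat \<lfloor>\<alpha>\<rfloor>) (frac \<alpha> + \<epsilon>) \<inter> L_space \<alpha>"
    and u_nonneg: "\<And>x. u x \<ge> 0"
    and u_eq: "\<And>x. higher_frac_laplacian m \<alpha> u x = f x (jet (2 * m + nat \<lfloor>\<alpha>\<rfloor>) u x)"
  shows "\<forall>x. u x = 0"
proof -
  have adm: "frac_admissible \<alpha> (\<alpha> + \<epsilon>) u" and second_holder_C: "second_holder_C (\<alpha> + \<epsilon>) (2 * m) u"
    using frac_admissibleI[of \<alpha> \<epsilon> u "2 * m"] assms by auto
  interpret frac_admissible \<alpha> "\<alpha> + \<epsilon>" u by (rule adm)
  have n2: "2 \<le> real CARD('n) + \<alpha>" using assms(1,3) by linarith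
  \<comment> \<open>Half the constant, since \<open>sym_frac_lap\<close> is twice the principal
    value.\<close>
  define c0 where "c0 = frac_lap_const CARD('n) \<alpha> / 2"
  have c0: "0 < c0" using frac_lap_const_pos[OF assms(3,4)] by (simp add: c0_def)
  define v where "v x = c0 * sym_frac_lap \<alpha> u x" for x
  have v: "frac_laplacian \<alpha> u = v"
    using frac_laplacian_eq_sym_frac_lap[OF adm] by (simp add: fun_eq_iff v_def c0_def)
  have pv: "partial_C (2 * m) v"
    unfolding v_def[abs_def] by (intro partial_C_cmult sym_frac_lap_partial_C[OF adm second_holder_C])
  define W where "W j = (neg_laplacian ^^ j) v" for j
  have WS: "W (Suc j) = neg_laplacian (W j)" for j by (simp add: W_def)
  have pW: "partial_C 2 (W j)" if "j < m" for j
  proof -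
    have "2 * j + 2 \<le> 2 * m" using that by simp
    then show ?thesis unfolding W_def by (intro partial_C_neg_laplacian_iter partial_C_mono[OF pv])
  qed
  \<comment> \<open>The fractional Laplacian itself needs a bump of exponent at least 3, and each
    further Laplacian refers back to the exponents k - 1 and k - 2; hence the threshold 3 + 2
    j.\<close>
  have lim: "((\<lambda>R. bump_average x0 k R (W j)) \<longlongrightarrow> 0) at_top" if "j < m" "3 + 2 * j \<le> k" for j k x0
    using that
  proof (induction j arbitrary: k)
    case 0
    have "continuous_on UNIV (sym_frac_lap \<alpha> u)" using partial_C_continuous[OF sym_frac_lap_partial_C[OF adm second_holder_C]] .
    then show ?case
      using bump_average_sym_frac_lap_tendsto[OF adm _ n2, of k x0 c0] 0 by (simp add: W_def v_def[abs_def])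
  next
    case (Suc j)
    then show ?case
      unfolding WS using Suc.prems by (intro bump_average_neg_laplacian_tendsto pW Suc.IH) auto
  qed
  have Wm: "W m x = f x (jet (2 * m + nat \<lfloor>\<alpha>\<rfloor>) u x)" for x
    using u_eq[of x] by (simp add: higher_frac_laplacian_def v W_def)
  \<comment> \<open>Turns the condition on \<open>J []\<close> in \<open>f_nonneg\<close> into the
    sign of \<open>u\<close>.\<close>
  have jet0: "jet k u x [] = u x" for k x by (simp add: jet_def iter_partial_def)
  \<comment> \<open>Downward induction from the right-hand side at j = m; the averages of W j are
    taken at the smallest admissible exponent 3 + 2 j.\<close>
  have nonneg: "0 \<le> W j x" if "j \<le> m" for j x
    using that
  proof (induction j arbitrary: x rule: inc_induct)
    case base
    show ?case unfolding Wm by (intro f_nonneg) (simp add: jet0 u_nonneg)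
  next
    case (step j)
    show ?case
      by (rule superharmonic_nonneg[OF pW[OF step(2)] _ _ lim[OF step(2) order_refl]])
         (use step in \<open>simp_all flip: WS\<close>)
  qed
  have sfl0: "0 \<le> sym_frac_lap \<alpha> u x" for x
    using nonneg[of 0 x] c0 by (simp add: W_def v_def zero_le_mult_iff)
  show ?thesis
  proof (cases "\<forall>x. 0 < u x")
    case False
    then obtain x1 where "u x1 = 0" using u_nonneg by (metis less_eq_real_def)
    then show ?thesis using sym_frac_lap_zero_at_zero[OF u_nonneg _ sfl0] by blast
  next
    case True
    then obtain x0 where x0: "0 < W m x0" using f_pos Wm by auto
    \<comment> \<open>Inverting the Laplacian m - j times from a positive source gives decay of
      order n - 2 (m - j). The maximum with \<alpha> keeps the exponent positive, as
      \<open>superharmonic_lower_bound_step\<close> requires, and is all that the final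
      contradiction asks for.\<close>
    define q where "q j = max (real CARD('n) - 2 * real (m - j)) \<alpha>" for j
    have bound: "\<exists>c>0. \<forall>z. c * (1 + norm (z - x0) ^ 2) powr (- q j / 2) \<le> W j z" if "j \<le> m - 1" for j
      using that
    proof (induction j rule: inc_induct)
      case base
      have m: "m - 1 < m" "Suc (m - 1) = m" using assms(2) by auto
      have "real CARD('n) - 2 \<le> q (m - 1)" using m by (simp add: q_def)
      moreover have "neg_laplacian (W (m - 1)) = W m" using WS[of "m - 1"] m by simp
      moreover have "2 \<le> CARD('n)" using assms(1) by simp
      ultimately obtain c where "0 < c" "\<And>z. c * (1 + norm (z - x0) ^ 2) powr (- q (m - 1) / 2) \<le> W (m - 1) z"
        using superharmonic_lower_bound_first[OF pW[OF m(1)] nonneg, of x0 "q (m - 1)"] nonneg[of m] x0 by auto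
      then show ?case by blast
    next
      case (step j)
      then obtain c where c: "0 < c" "\<And>z. c * (1 + norm (z - x0) ^ 2) powr (- q (Suc j) / 2) \<le> neg_laplacian (W j) z"
        by (auto simp: WS)
      have j: "j < m" using step(2) by linarith
      have "0 < q j" using assms(3) by (simp add: q_def)
      moreover have "real (m - Suc j) = real (m - j) - 1" using j by (simp add: of_nat_diff)
      then have "q (Suc j) \<le> q j + 2" unfolding q_def by (simp add: max_def)
      ultimately obtain d where "0 < d" "\<And>z. d * (1 + norm (z - x0) ^ 2) powr (- q j / 2) \<le> W j z"
        using superharmonic_lower_bound_step[OF pW[OF j] nonneg[of j] c] j by auto
      then show ?case by blast
    qed
    \<comment> \<open>The dimension condition enters here, in the form n - 2 m \<le>
      \<alpha>.\<close>
    have "q 0 = \<alpha>" using assms(5) by (simp add: q_def max_def)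
    then obtain c where c: "0 < c" "\<And>z. c * (1 + norm (z - x0) ^ 2) powr (- \<alpha> / 2) \<le> c0 * sym_frac_lap \<alpha> u z"
      using bound[of 0] by (auto simp: W_def v_def)
    have "False"
    proof (rule sym_frac_lap_not_bounded_below[OF _ u_nonneg])
      show "2 \<le> real DIM(real^'n) + \<alpha>" using n2 by simp
      show "0 < c / c0" using c c0 by simp
      show "c / c0 * (1 + norm (z - x0) ^ 2) powr (- \<alpha> / 2) \<le> sym_frac_lap \<alpha> u z" for z
        using c(2)[of z] c0 by (simp add: divide_le_eq mult.commute)
    qed
    then show ?thesis ..
  qed
qed

end
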